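(* Let $V$ be a finite-dimensional real or complex vector space, let $\mu$ be a probability measure on $\mathrm{GL}(V)$ with finite first moment and let $W$ be a $\mu$-invariant subspace of $V$. Then for every $\mu$-stationary ergodic probability measure $\overline{\nu}$ on $P(V/W)$ whose cocycle average satisfies $\alpha(\overline{\nu})>\lambda_1(W)$, there exists a unique $\mu$-stationary lift $\nu$ of $\overline{\nu}$ on $P(V)\setminus P(W)$.
   Context: $P(V)$ is the projective space of lines of $V$; measures are Borel. Fix any norm on $V$. A probability measure $\mu$ on $\mathrm{GL}(V)$ has finite first moment if $\int \log\max\{\|g\|,\|g^{-1}\|\}\,d\mu(g)<\infty$. $\Gamma_\mu$ is the semigroup generated by the support of $\mu$; a subspace $W$ is called $\mu$-invariant if it is $\Gamma_\mu$-invariant. In that case $\mu$ induces probability measures on $\mathrm{GL}(W)$ and $\mathrm{GL}(V/W)$. Let $X_1,X_2,\dots$ be iid with law $\mu$ and $L_n=X_n\cdots X_1$. The top Lyapunov exponent $\lambda_1$ of $\mu$ is the almost sure limit of $\frac1n\log\|L_n\|$; $\lambda_1(W)$ denotes the top Lyapunov exponent of the measure induced by $\mu$ on $\mathrm{GL}(W)$ (with $\lambda_1(\{0\})=-\infty$). A probability measure $\nu$ on a space acted on by $\mathrm{GL}(V)$ or $\Gamma_\mu$ is $\mu$-stationary if $\mu*\nu=\nu$, where $\int f\,d(\mu*\nu)=\iint f(gx)\,d\mu(g)\,d\nu(x)$ for bounded measurable $f$; it is ergodic if it is extremal in the convex set of $\mu$-stationary probability measures. The cocycle average of a $\mu$-stationary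 $\overline\nu$ on $P(V/W)$ is $\alpha(\overline\nu)=\iint\log\frac{\|gv\|}{\|v\|}\,d\mu(g)\,d\overline\nu([v])$, with $[v]$ the line spanned by $v$ and any norm on $V/W$ (the value does not depend on the norm). A $\mu$-stationary lift of $\overline\nu$ is a $\mu$-stationary probability measure $\nu$ on $P(V)\setminus P(W)$ whose push-forward under the map $P(V)\setminus P(W)\to P(V/W)$ induced by $V\to V/W$ is $\overline\nu$. *)

theory Defs
  imports "HOL-Probability.Probability"
begin

text \<open>
  The vector space is \<open>V = 'k^'n\<close> with \<open>'k\<close> of sort \<open>{real_normed_field, euclidean_space}\<close>.
  Both \<open>real\<close> and \<open>complex\<close> have this sort, and up to isomorphism they are the only fields that do
  (Gelfand--Mazur). All spans and subspaces (\<open>vec.span\<close>, \<open>vec.subspace\<close>) are over \<open>'k\<close>.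
  The norm fixed on \<open>V\<close> is the standard one, on \<open>V/W\<close> it is the quotient norm.
\<close>

text \<open>The Borel sigma-algebra of the quotient topology on \<open>p ` S\<close>, where \<open>S\<close> has the subspace topology.\<close>

definition quotient_borel :: "('a::topological_space \<Rightarrow> 'b) \<Rightarrow> 'a set \<Rightarrow> 'b measure" where
  "quotient_borel p S = sigma (p ` S) {U. U \<subseteq> p ` S \<and> openin (top_of_set S) {v\<in>S. p v \<in> U}}"

definition line :: "'k::field^'n \<Rightarrow> ('k^'n) set" where
  "line v = vec.span {v}"

definition proj_space :: "('k::{real_normed_field,euclidean_space}^'n) set measure" where
  "proj_space = quotient_borel line (UNIV - {0})"

definition lines_in :: "('k::field^'n) set \<Rightarrow> ('k^'n) set set" where
  "lines_in W = line ` (W - {0})"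

definition proj_diff ::
    "('k::{real_normed_field,euclidean_space}^'n) set \<Rightarrow> ('k^'n) set measure" where
  "proj_diff W = restrict_space proj_space (lines_in UNIV - lines_in W)"

definition coset :: "('k::field^'n) set \<Rightarrow> 'k^'n \<Rightarrow> ('k^'n) set" where
  "coset W v = (\<lambda>w. v + w) ` W"

text \<open>
  A line of \<open>V/W\<close> is a set of cosets: \<open>coset W ` line v\<close> with \<open>v \<notin> W\<close> is the line spanned by
  \<open>v + W\<close>. The topology on \<open>P(V/W)\<close> is the quotient topology from \<open>V/W\<close> minus the origin, which
  itself is a quotient of \<open>V - W\<close>; the composite is a quotient map from \<open>V - W\<close>.
\<close>

definition proj_quot ::
    "('k::{real_normed_field,euclidean_space}^'n) set \<Rightarrow> ('k^'n) set set measure" where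
  "proj_quot W = quotient_borel (\<lambda>v. coset W ` line v) (UNIV - W)"

definition proj_map :: "('k::field^'n) set \<Rightarrow> ('k^'n) set \<Rightarrow> ('k^'n) set set" where
  "proj_map W l = coset W ` l"

definition act :: "'k::field^'n^'n \<Rightarrow> ('k^'n) set \<Rightarrow> ('k^'n) set" where
  "act g l = (\<lambda>v. g *v v) ` l"

definition act_quot :: "'k::field^'n^'n \<Rightarrow> ('k^'n) set set \<Rightarrow> ('k^'n) set set" where
  "act_quot g L = act g ` L"

definition GL_borel :: "('k::{real_normed_field,euclidean_space}^'n^'n) measure" where
  "GL_borel = restrict_space borel {g. invertible g}"

definition finite_first_moment ::
    "('k::{real_normed_field,euclidean_space}^'n^'n) measure \<Rightarrow> bool" where
  "finite_first_moment \<mu> \<longleftrightarrow>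
     integrable \<mu> (\<lambda>g. ln (max (onorm ((*v) g)) (onorm ((*v) (matrix_inv g)))))"

definition msupport :: "'a::topological_space measure \<Rightarrow> 'a set" where
  "msupport \<mu> = {g \<in> space \<mu>. \<forall>U. open U \<and> g \<in> U \<longrightarrow> emeasure \<mu> (U \<inter> space \<mu>) > 0}"

inductive_set semigroup_of :: "('k::{real_normed_field,euclidean_space}^'n^'n) measure
    \<Rightarrow> ('k^'n^'n) set" for \<mu> where
  gen: "g \<in> msupport \<mu> \<Longrightarrow> g \<in> semigroup_of \<mu>"
| mult: "g \<in> semigroup_of \<mu> \<Longrightarrow> h \<in> semigroup_of \<mu> \<Longrightarrow> g ** h \<in> semigroup_of \<mu>"

definition invariant_subspace ::
    "('k::{real_normed_field,euclidean_space}^'n^'n) measure \<Rightarrow> ('k^'n) set \<Rightarrow> bool" where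
  "invariant_subspace \<mu> W \<longleftrightarrow>
     vec.subspace W \<and> (\<forall>g\<in>semigroup_of \<mu>. \<forall>w\<in>W. g *v w \<in> W)"

text \<open>\<open>\<omega> i\<close> plays the role of \<open>X\<^sub>i\<^sub>+\<^sub>1\<close>.\<close>

primrec walk :: "(nat \<Rightarrow> 'k::field^'n^'n) \<Rightarrow> nat \<Rightarrow> 'k^'n^'n" where
  "walk \<omega> 0 = mat 1"
| "walk \<omega> (Suc n) = \<omega> n ** walk \<omega> n"

text \<open>Operator norm of \<open>g\<close> restricted to \<open>W\<close>; cf. \<open>onorm_def\<close>, including \<open>0 / 0 = 0\<close> at \<open>w = 0\<close>.\<close>

definition onorm_on ::
    "('k::{real_normed_field,euclidean_space}^'n) set \<Rightarrow> 'k^'n^'n \<Rightarrow> real" where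
  "onorm_on W g = (SUP w\<in>W. norm (g *v w) / norm w)"

definition top_lyapunov ::
    "('k::{real_normed_field,euclidean_space}^'n^'n) measure \<Rightarrow> ('k^'n) set \<Rightarrow> ereal" where
  "top_lyapunov \<mu> W =
     (if W = {0} then -\<infinity>
      else THE l. AE \<omega> in PiM (UNIV::nat set) (\<lambda>_. \<mu>).
             (\<lambda>n. ereal (1 / real n * ln (onorm_on W (walk \<omega> n)))) \<longlonglongrightarrow> l)"

text \<open>
  \<open>X\<close> is the measurable space acted on and \<open>a\<close> the action. On \<open>P(V/W)\<close> and \<open>P(V) - P(W)\<close> only
  the \<open>g\<close> preserving \<open>W\<close> act. They form a set of full measure when \<open>W\<close> is invariant; the test
  excluding \<open>a g x \<notin> space X\<close> keeps the values of \<open>f\<close> outside of the space out of the integral.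
\<close>

definition stationary :: "('g \<Rightarrow> 'x \<Rightarrow> 'x) \<Rightarrow> 'g measure \<Rightarrow> 'x measure \<Rightarrow> 'x measure \<Rightarrow> bool" where
  "stationary a \<mu> X \<nu> \<longleftrightarrow>
     prob_space \<nu> \<and> sets \<nu> = sets X \<and>
     (\<forall>f \<in> borel_measurable X. (\<exists>B. \<forall>x\<in>space X. \<bar>f x\<bar> \<le> B) \<longrightarrow>
        (\<integral>x. (\<integral>g. (if a g x \<in> space X then f (a g x) else 0) \<partial>\<mu>) \<partial>\<nu>) = (\<integral>x. f x \<partial>\<nu> :: real))"

definition ergodic :: "('g \<Rightarrow> 'x \<Rightarrow> 'x) \<Rightarrow> 'g measure \<Rightarrow> 'x measure \<Rightarrow> 'x measure \<Rightarrow> bool" where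
  "ergodic a \<mu> X \<nu> \<longleftrightarrow>
     stationary a \<mu> X \<nu> \<and>
     (\<forall>\<nu>1 \<nu>2 t. stationary a \<mu> X \<nu>1 \<and> stationary a \<mu> X \<nu>2 \<and> 0 < t \<and> t < 1 \<and>
        (\<forall>A\<in>sets X. measure \<nu> A = t * measure \<nu>1 A + (1 - t) * measure \<nu>2 A)
        \<longrightarrow> \<nu>1 = \<nu> \<and> \<nu>2 = \<nu>)"

definition quot_norm :: "('k::{real_normed_field,euclidean_space}^'n) set \<Rightarrow> real" where
  "quot_norm C = (INF v\<in>C. norm v)"

text \<open>The choice of the nonzero element \<open>C\<close> of the line \<open>L\<close> of \<open>V/W\<close> does not matter.\<close>

definition cocycle :: "('k::{real_normed_field,euclidean_space}^'n) set
    \<Rightarrow> 'k^'n^'n \<Rightarrow> ('k^'n) set set \<Rightarrow> real" where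
  "cocycle W g L = (let C = (SOME C. C \<in> L \<and> C \<noteq> W) in ln (quot_norm (act g C) / quot_norm C))"

definition cocycle_average :: "('k::{real_normed_field,euclidean_space}^'n^'n) measure
    \<Rightarrow> ('k^'n) set \<Rightarrow> ('k^'n) set set measure \<Rightarrow> real" where
  "cocycle_average \<mu> W \<nu> = (\<integral>L. (\<integral>g. cocycle W g L \<partial>\<mu>) \<partial>\<nu>)"

definition stationary_lift :: "('k::{real_normed_field,euclidean_space}^'n^'n) measure
    \<Rightarrow> ('k^'n) set \<Rightarrow> ('k^'n) set set measure \<Rightarrow> ('k^'n) set measure \<Rightarrow> bool" where
  "stationary_lift \<mu> W \<nu>' \<nu> \<longleftrightarrow>
     stationary act \<mu> (proj_diff W) \<nu> \<and> distr \<nu> (proj_quot W) (proj_map W) = \<nu>'"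

end

theory Submission
  imports Defs
begin

text \<open>
  A line outside \<open>W\<close> is determined by its image in \<open>P(V/W)\<close> and a point of an affine space directed by
  \<open>W\<close>: with \<open>normal\<close> the representative scaled to have quotient norm \<open>1\<close>, two lines over the same point
  have representatives that differ by a vector of \<open>W\<close>. In these coordinates a matrix \<open>g\<close> acts on the
  fibre over \<open>c\<close> by an affine map with linear part \<open>g\<close> restricted to \<open>W\<close>, divided by a scalar whose
  absolute value is the growth of the quotient norm of \<open>c\<close> under \<open>g\<close>. Along the random walk the linear
  parts grow like \<open>exp (n * (\<lambda> - \<alpha>))\<close>, where \<open>\<lambda>\<close> is the top exponent on \<open>W\<close> and \<open>\<alpha>\<close> the cocycle average.
  The hypothesis \<open>\<alpha> > \<lambda>\<close> says that this random affine recursion contracts, and a contracting affine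
  recursion in a stationary environment has exactly one stationary law.

  To iterate the recursion from the infinite past, a stationary measure is extended to a system
  \<open>(P, T, \<gamma>)\<close>: a point of it is a past trajectory, \<open>T\<close> forgets its last step, and \<open>\<gamma>\<close> is the matrix
  of that step, so that a stationary point \<open>C\<close> satisfies \<open>C = \<gamma> \<cdot> C \<circ> T\<close> (\<open>stationary_system\<close>). For existence
  (\<open>ex_stationary_lift\<close>) the points \<open>g\<^sub>1 \<cdots> g\<^sub>n c\<^sub>n\<close> of the fibre over \<open>C\<close>, with \<open>c\<^sub>n\<close> the
  representative of \<open>C \<circ> T\<^sup>n\<close> in a complement of \<open>W\<close>, converge exponentially fast, and the limit \<open>Y\<close> satisfies
  \<open>Y = \<gamma> \<cdot> Y \<circ> T\<close>, so that its law is stationary. For uniqueness (\<open>unique_stationary_lift\<close>) any lift has an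
  extension of its own; there its point is approximated by the same expressions, whose laws depend
  only on \<open>\<mu>\<close> and on the measure on \<open>P(V/W)\<close> (\<open>law_pullback\<close>).

  Both parts rest on \<open>kappa_decay\<close>: almost surely the norm of the linear part of \<open>g\<^sub>1 \<cdots> g\<^sub>n\<close> decays
  exponentially. It follows from two limit theorems for a measure preserving map, which are
  instances of one covering argument of Katznelson and Weiss (\<open>covering_integral\<close>). The first is the
  subadditive theorem for the norms on \<open>W\<close>; the increments are independent, which makes the limit
  constant. The same theorem, applied to the walk itself, shows that the limit that defines the top
  exponent exists. The second is the ergodic theorem for the cocycle. It needs the integral of the
  cocycle over every \<open>T\<close>-invariant event \<open>D\<close>. The law of \<open>C\<close> conditioned on \<open>D\<close> is again stationary,
  hence extremality of the given measure makes \<open>C\<close> independent of \<open>D\<close> (\<open>indep_C\<close>).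
\<close>

section \<open>Almost sure convergence of subadditive cocycles\<close>

lemma sum_lessThan_split:
  fixes f :: "nat \<Rightarrow> 'a::comm_monoid_add"
  assumes "n \<le> m"
  shows "sum f {..<m} = sum f {..<n} + (\<Sum>i<m-n. f (i + n))"
proof -
  have "sum f {..<m} = sum f {..<n} + sum f {n..<m}"
    using assms by (metis sum.atLeastLessThan_concat lessThan_atLeast0 le0)
  also have "sum f {n..<m} = (\<Sum>i<m-n. f (i + n))"
    using sum.shift_bounds_nat_ivl[of f 0 n "m-n"] assms by (simp add: lessThan_atLeast0)
  finally show ?thesis .
qed

locale measure_preserving = prob_space M for M :: "'a measure" +
  fixes T :: "'a \<Rightarrow> 'a"
  assumes T_measurable [measurable]: "T \<in> M \<rightarrow>\<^sub>M M"
    and distr_T: "distr M M T = M"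
begin

lemma T_space: "x \<in> space M \<Longrightarrow> T x \<in> space M"
  by (rule measurable_space[OF T_measurable])

lemma iter_measurable [measurable]: "(T ^^ n) \<in> M \<rightarrow>\<^sub>M M"
  by (induction n) auto

lemma iter_space: "x \<in> space M \<Longrightarrow> (T ^^ n) x \<in> space M"
  by (rule measurable_space[OF iter_measurable])

lemma distr_iter: "distr M M (T ^^ n) = M"
proof (induction n)
  case 0 then show ?case by (simp add: distr_id2 id_def)
next
  case (Suc n)
  have "distr M M (T ^^ Suc n) = distr (distr M M T) M (T ^^ n)"
    by (subst distr_distr) (auto simp: comp_def funpow_swap1)
  then show ?case unfolding distr_T Suc .
qed

lemma measure_preserving_iter: "measure_preserving M (T ^^ n)"
  by unfold_locales (auto simp: distr_iter)

lemma integrable_iter: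
  fixes f :: "'a \<Rightarrow> real"
  assumes "integrable M f"
  shows "integrable M (\<lambda>x. f ((T ^^ n) x))"
  using assms by (intro integrable_distr[of "T ^^ n" M M]) (simp_all add: distr_iter)

lemma integral_iter:
  fixes f :: "'a \<Rightarrow> real"
  assumes "f \<in> borel_measurable M"
  shows "(\<integral>x. f ((T ^^ n) x) \<partial>M) = (\<integral>x. f x \<partial>M)"
  using assms integral_distr[of "T ^^ n" M M f] by (simp add: distr_iter)

lemma AE_iter:
  assumes "AE x in M. Q x"
  shows "AE x in M. Q ((T ^^ n) x)"
proof (rule AE_distrD[of _ M M])
  show "AE x in distr M M (T ^^ n). Q x" using assms unfolding distr_iter .
qed simp

text \<open>
  Walk along the orbit of \<open>x\<close> from time \<open>0\<close> to \<open>m\<close>. At a time whose point is outside \<open>B\<close>, jump over a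
  block of length at most \<open>K\<close> on which \<open>F\<close> is small; at a point of \<open>B\<close>, and in the last \<open>K\<close> steps where a
  block may not fit any more, move by a single step at cost at most \<open>l\<close>. Subadditivity adds up these
  bounds. The summand \<open>\<bar>\<beta>\<bar>\<close> pays for the bound \<open>\<beta>\<close> that the single steps do not satisfy.
\<close>

lemma covering_bound:
  fixes F :: "nat \<Rightarrow> 'a \<Rightarrow> real"
  assumes F0: "\<And>x. x \<in> space M \<Longrightarrow> F 0 x = 0"
    and sub: "\<And>n m x. x \<in> space M \<Longrightarrow> F (n + m) x \<le> F n x + F m ((T ^^ n) x)"
    and F1: "\<And>x. x \<in> space M \<Longrightarrow> F 1 x \<le> l x" and l0: "\<And>x. x \<in> space M \<Longrightarrow> 0 \<le> l x"
    and D: "D \<subseteq> space M" and inv: "\<And>x. x \<in> D \<Longrightarrow> T x \<in> D"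
    and B: "\<And>x. x \<in> D \<Longrightarrow> x \<notin> B \<Longrightarrow> \<exists>n\<in>{1..K}. F n x < real n * \<beta>"
    and x: "x \<in> D"
  shows "F m x \<le> real m * \<beta> + (\<Sum>i<m. (if (T ^^ i) x \<in> B \<or> m \<le> i + K then l ((T ^^ i) x) + \<bar>\<beta>\<bar> else 0))"
  using x
proof (induction m arbitrary: x rule: less_induct)
  case (less m)
  let ?G = "\<lambda>m x i. (if (T ^^ i) x \<in> B \<or> m \<le> i + K then l ((T ^^ i) x) + \<bar>\<beta>\<bar> else 0)"
  have invn: "(T ^^ n) y \<in> D" if "y \<in> D" for n y
    using that by (induction n) (auto simp: inv)
  have lD: "0 \<le> l ((T ^^ n) x)" for n using invn[OF less.prems, of n] D l0 by auto
  have G0: "0 \<le> ?G m x i" for i using lD[of i] by auto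
  show ?case
  proof (cases "m = 0")
    case True then show ?thesis using F0 less.prems D by auto
  next
    case m: False
    have block: "F m x \<le> real m * \<beta> + sum (?G m x) {..<m}"
      if n: "1 \<le> n" "n \<le> m" and Fn: "F n x \<le> real n * \<beta> + sum (?G m x) {..<n}" for n
    proof -
      have shift: "?G (m - n) ((T ^^ n) x) i = ?G m x (i + n)" if "i < m - n" for i
      proof -
        have "(T ^^ i) ((T ^^ n) x) = (T ^^ (i + n)) x" by (simp add: funpow_add)
        moreover have "(m - n \<le> i + K) = (m \<le> i + n + K)" using n by auto
        ultimately show ?thesis by simp
      qed
      have "F (n + (m - n)) x \<le> F n x + F (m - n) ((T ^^ n) x)"
        using sub less.prems D by blast
      also have "F (m - n) ((T ^^ n) x) \<le> real (m - n) * \<beta> + sum (?G (m - n) ((T ^^ n) x)) {..<m - n}"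
        using n by (intro less.IH invn less.prems) auto
      also have "sum (?G (m - n) ((T ^^ n) x)) {..<m - n} = (\<Sum>i<m - n. ?G m x (i + n))"
        by (intro sum.cong refl shift) auto
      finally have "F m x \<le> F n x + (real (m - n) * \<beta> + (\<Sum>i<m - n. ?G m x (i + n)))"
        using n by simp
      moreover have "sum (?G m x) {..<m} = sum (?G m x) {..<n} + (\<Sum>i<m - n. ?G m x (i + n))"
        using n by (intro sum_lessThan_split)
      moreover have "real (m - n) * \<beta> = real m * \<beta> - real n * \<beta>"
        using n by (simp add: of_nat_diff algebra_simps)
      ultimately show ?thesis using Fn by linarith
    qed
    show ?thesis
    proof (cases "x \<in> B")
      case True
      have "F 1 x \<le> l x" using F1 less.prems D by auto
      also have "\<dots> \<le> real 1 * \<beta> + sum (?G m x) {..<1}" using True by simp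
      finally show ?thesis using m by (intro block[of 1]) auto
    next
      case False
      then obtain n where n: "n \<in> {1..K}" "F n x < real n * \<beta>" using B less.prems by blast
      show ?thesis
      proof (cases "n \<le> m")
        case True
        have "0 \<le> sum (?G m x) {..<n}" by (intro sum_nonneg G0)
        then show ?thesis using n True by (intro block[of n]) auto
      next
        case False
        have "F k x \<le> (\<Sum>i<k. l ((T ^^ i) x))" for k
        proof (induction k)
          case 0 then show ?case using F0 less.prems D by auto
        next
          case (Suc k)
          have xs: "x \<in> space M" using less.prems D by auto
          have "F (k + 1) x \<le> F k x + F 1 ((T ^^ k) x)" using sub xs by blast
          also have "F 1 ((T ^^ k) x) \<le> l ((T ^^ k) x)" using F1 iter_space xs by blast
          finally show ?case using Suc by simp
        qed
        from this[of m] have "F m x \<le> (\<Sum>i<m. l ((T ^^ i) x))" .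
        also have "\<dots> = (\<Sum>i<m. ?G m x i - \<bar>\<beta>\<bar>)"
          using False n by (intro sum.cong) auto
        also have "\<dots> = sum (?G m x) {..<m} - real m * \<bar>\<beta>\<bar>" by (simp only: sum_subtractf sum_constant card_lessThan)
        also have "\<dots> \<le> real m * \<beta> + sum (?G m x) {..<m}"
        proof -
          have "real m * (-\<bar>\<beta>\<bar>) \<le> real m * \<beta>" by (intro mult_left_mono) auto
          then show ?thesis by simp
        qed
        finally show ?thesis .
      qed
    qed
  qed
qed

text \<open>
  Integrate \<open>covering_bound\<close> over \<open>D\<close>. The points without a good block of length at most \<open>K\<close> decrease to
  the empty set as \<open>K\<close> grows, so their contribution per step is small, and for a long orbit the last
  \<open>K\<close> steps are negligible.
\<close>

lemma covering_integral:
  fixes F :: "nat \<Rightarrow> 'a \<Rightarrow> real"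
  assumes F0: "\<And>x. x \<in> space M \<Longrightarrow> F 0 x = 0"
    and Fi: "\<And>n. integrable M (F n)"
    and sub: "\<And>n m x. x \<in> space M \<Longrightarrow> F (n + m) x \<le> F n x + F m ((T ^^ n) x)"
    and F1: "\<And>x. x \<in> space M \<Longrightarrow> F 1 x \<le> l x" and l0: "\<And>x. x \<in> space M \<Longrightarrow> 0 \<le> l x"
    and li: "integrable M l"
    and D [measurable]: "D \<in> sets M" and inv: "\<And>x. x \<in> D \<Longrightarrow> T x \<in> D"
    and ex: "\<And>x. x \<in> D \<Longrightarrow> \<exists>n\<ge>1. F n x < real n * \<beta>"
    and e: "\<epsilon> > 0"
  shows "\<exists>m\<ge>1. (\<integral>x. F m x * indicator D x \<partial>M) \<le> real m * (\<beta> * prob D + \<epsilon>)"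
proof -
  have [measurable]: "F n \<in> borel_measurable M" for n using Fi by auto
  have [measurable]: "l \<in> borel_measurable M" using li by auto
  define u where "u = (\<lambda>x. l x + \<bar>\<beta>\<bar>)"
  have ui: "integrable M u" unfolding u_def using li by auto
  have u0: "0 \<le> u x" if "x \<in> space M" for x using l0[OF that] by (simp add: u_def)
  have [measurable]: "u \<in> borel_measurable M" using ui by auto
  define B where "B = (\<lambda>K. {x\<in>space M. x \<in> D \<and> (\<forall>n\<in>{1..K}. \<not> F n x < real n * \<beta>)})"
  have [measurable]: "B K \<in> sets M" for K unfolding B_def by measurable
  have "(\<lambda>K. \<integral>x. u x * indicator (B K) x \<partial>M) \<longlonglongrightarrow> (\<integral>x. 0 \<partial>M)"
  proof (rule integral_dominated_convergence[where w=u])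
    show "AE x in M. (\<lambda>K. u x * indicator (B K) x) \<longlonglongrightarrow> 0"
    proof (rule AE_I2)
      fix x assume x: "x \<in> space M"
      have "\<exists>K0. \<forall>K\<ge>K0. x \<notin> B K"
      proof (cases "x \<in> D")
        case True
        then obtain n where "n \<ge> 1" "F n x < real n * \<beta>" using ex by blast
        then show ?thesis by (intro exI[of _ n]) (auto simp: B_def)
      qed (auto simp: B_def)
      then obtain K0 where "\<forall>K\<ge>K0. x \<notin> B K" by blast
      then show "(\<lambda>K. u x * indicator (B K) x) \<longlonglongrightarrow> 0"
        by (intro tendsto_eventually) (metis (mono_tags, lifting) eventually_sequentially indicator_simps(2) mult_zero_right)
    qed
    show "AE x in M. norm (u x * indicator (B K) x) \<le> u x" for K
      using u0 by (intro AE_I2) (auto simp: indicator_def)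
  qed (use ui in auto)
  then have "\<forall>\<^sub>F K in sequentially. (\<integral>x. u x * indicator (B K) x \<partial>M) < \<epsilon>/2"
    using e by (intro order_tendstoD(2)) auto
  then obtain K where K: "(\<integral>x. u x * indicator (B K) x \<partial>M) < \<epsilon>/2"
    by (auto simp: eventually_sequentially)
  define U where "U = (\<integral>x. u x \<partial>M)"
  have U0: "0 \<le> U" unfolding U_def using u0 by (intro Bochner_Integration.integral_nonneg_AE) auto
  obtain m :: nat where m: "real m \<ge> 2 * real K * U / \<epsilon>" "m \<ge> 1"
    by (meson nle_le order_trans real_arch_simple of_nat_le_iff linear)
  define h where "h = (\<lambda>x. u x * indicator (B K) x)"
  have hi: "integrable M h" unfolding h_def using ui by (intro integrable_mult_indicator[of _ M u, simplified mult.commute scaleR_conv_of_real of_real_eq_id id_apply]) auto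
  have h0: "0 \<le> h x" if "x \<in> space M" for x using u0[OF that] by (simp add: h_def)
  let ?R = "\<lambda>x. real m * \<beta> * indicator D x + (\<Sum>i<m. h ((T ^^ i) x) + (if m \<le> i + K then u ((T ^^ i) x) else 0))"
  have pt: "F m x * indicator D x \<le> ?R x" if x: "x \<in> space M" for x
  proof (cases "x \<in> D")
    case True
    have "F m x \<le> real m * \<beta> + (\<Sum>i<m. (if (T ^^ i) x \<in> B K \<or> m \<le> i + K then l ((T ^^ i) x) + \<bar>\<beta>\<bar> else 0))"
      by (rule covering_bound[OF F0 sub F1 l0 _ inv _ True]) (use D[THEN sets.sets_into_space] in \<open>auto simp: B_def\<close>)
    also have "\<dots> \<le> real m * \<beta> + (\<Sum>i<m. h ((T ^^ i) x) + (if m \<le> i + K then u ((T ^^ i) x) else 0))"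
      using u0[OF iter_space[OF x]] by (intro add_left_mono sum_mono) (auto simp: h_def u_def)
    finally show ?thesis using True by simp
  next
    case False
    have "0 \<le> (\<Sum>i<m. h ((T ^^ i) x) + (if m \<le> i + K then u ((T ^^ i) x) else 0))"
      using h0[OF iter_space[OF x]] u0[OF iter_space[OF x]] by (intro sum_nonneg) auto
    then show ?thesis using False by simp
  qed
  have int1: "integrable M (\<lambda>x. h ((T ^^ i) x) + (if m \<le> i + K then u ((T ^^ i) x) else 0))" for i
    using integrable_iter[OF hi, of i] integrable_iter[OF ui, of i] by (cases "m \<le> i + K") auto
  have int2: "integrable M (\<lambda>x. real m * \<beta> * indicator D x)"
    by (intro integrable_mult_right integrable_real_indicator) (auto simp: emeasure_eq_measure)
  have "(\<integral>x. F m x * indicator D x \<partial>M) \<le> (\<integral>x. ?R x \<partial>M)"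
    using pt by (intro integral_mono Bochner_Integration.integrable_add Bochner_Integration.integrable_sum
        integrable_real_mult_indicator int2 Fi D int1)
  also have "\<dots> = real m * \<beta> * prob D + (\<Sum>i<m. (\<integral>x. h ((T ^^ i) x) + (if m \<le> i + K then u ((T ^^ i) x) else 0) \<partial>M))"
    using int1 int2 by (subst Bochner_Integration.integral_add) (auto intro!: Bochner_Integration.integrable_sum)
  also have "\<dots> = real m * \<beta> * prob D + (\<Sum>i<m. (\<integral>x. h x \<partial>M) + (if m \<le> i + K then U else 0))"
  proof -
    have "(\<integral>x. h ((T ^^ i) x) + (if m \<le> i + K then u ((T ^^ i) x) else 0) \<partial>M)
        = (\<integral>x. h x \<partial>M) + (if m \<le> i + K then U else 0)" for i
      using integrable_iter[OF hi, of i] integrable_iter[OF ui, of i] hi ui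
        integral_iter[of h i] integral_iter[of u i] by (cases "m \<le> i + K") (auto simp: U_def)
    then show ?thesis by simp
  qed
  also have "\<dots> = real m * \<beta> * prob D + real m * (\<integral>x. h x \<partial>M) + (\<Sum>i<m. (if m \<le> i + K then U else 0))"
    by (simp add: sum.distrib)
  also have "(\<Sum>i<m. (if m \<le> i + K then U else 0)) \<le> real K * U"
  proof -
    have "(\<Sum>i<m. (if m \<le> i + K then U else 0)) = (\<Sum>i\<in>{i\<in>{..<m}. m \<le> i + K}. U)"
      by (rule sum.inter_filter[symmetric]) simp
    also have "\<dots> = real (card {i\<in>{..<m}. m \<le> i + K}) * U" by simp
    also have "\<dots> \<le> real (card {m - K..<m}) * U"
      using U0 by (intro mult_right_mono of_nat_mono card_mono) auto
    also have "\<dots> \<le> real K * U" using U0 by (intro mult_right_mono of_nat_mono) auto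
    finally show ?thesis .
  qed
  also have "real m * \<beta> * prob D + real m * (\<integral>x. h x \<partial>M) + real K * U \<le> real m * (\<beta> * prob D + \<epsilon>)"
  proof -
    have "real m * (\<integral>x. h x \<partial>M) \<le> real m * (\<epsilon>/2)"
      using K by (intro mult_left_mono) (auto simp: h_def)
    moreover have "real K * U \<le> real m * (\<epsilon>/2)" using m e by (simp add: field_simps)
    ultimately show ?thesis by (simp add: algebra_simps)
  qed
  finally show ?thesis using m by auto
qed

text \<open>
  If the lower limit of \<open>F n x / n\<close> were below \<open>\<beta> < a\<close> on an event of positive probability,
  \<open>covering_integral\<close> on this event would contradict the lower bound on the integrals of \<open>F\<close>.
\<close>

lemma liminf_ge:
  fixes F :: "nat \<Rightarrow> 'a \<Rightarrow> real"
  assumes F0: "\<And>x. x \<in> space M \<Longrightarrow> F 0 x = 0"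
    and Fi: "\<And>n. integrable M (F n)"
    and sub: "\<And>n m x. x \<in> space M \<Longrightarrow> F (n + m) x \<le> F n x + F m ((T ^^ n) x)"
    and step: "\<And>n x. x \<in> space M \<Longrightarrow> \<bar>F (Suc n) x - F n (T x)\<bar> \<le> l x"
    and li: "integrable M l"
    and D: "\<And>D m. D \<in> sets M \<Longrightarrow> (\<And>x. x \<in> space M \<Longrightarrow> T x \<in> D \<longleftrightarrow> x \<in> D) \<Longrightarrow> m \<ge> 1 \<Longrightarrow>
              (\<integral>x. F m x * indicator D x \<partial>M) \<ge> real m * a * prob D"
  shows "AE x in M. \<forall>\<beta><a. \<forall>\<^sub>F n in sequentially. F n x \<ge> real n * \<beta>"
proof -
  have [measurable]: "F n \<in> borel_measurable M" for n using Fi by auto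
  \<comment> \<open>The margin \<open>1 / (k + 1)\<close> absorbs the bounded error \<open>l x\<close> of \<open>step\<close> and makes \<open>E \<beta>\<close> exactly invariant.\<close>
  define E where "E = (\<lambda>\<beta>. {x\<in>space M. \<exists>k::nat. \<forall>n0::nat. \<exists>n\<ge>n0. F n x < real n * (\<beta> - 1 / real (Suc k))})"
  have E [measurable]: "E \<beta> \<in> sets M" for \<beta> unfolding E_def by measurable
  have mono_step: "\<exists>k'. \<forall>n0::nat. \<exists>n\<ge>n0. F' n < real n * (\<beta> - 1 / real (Suc k'))"
    if h: "\<forall>n0. \<exists>n\<ge>n0. F'' n < real n * (\<beta> - 1 / real (Suc k))"
      and c: "\<And>n. n \<ge> 1 \<Longrightarrow> F' (t n) \<le> F'' n + d" and t: "\<And>n. n \<ge> 1 \<Longrightarrow> n \<le> t n + 1 \<and> t n \<le> n + 1"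
    for F' F'' :: "nat \<Rightarrow> real" and d k \<beta> t
  proof (rule exI[of _ "Suc k"], rule allI)
    fix n0 :: nat
    define \<eta> where "\<eta> = 1 / real (Suc k) - 1 / real (Suc (Suc k))"
    have \<eta>: "\<eta> > 0" unfolding \<eta>_def by (simp add: frac_less2)
    define q where "q = \<beta> - 1 / real (Suc (Suc k))"
    obtain n1 :: nat where n1: "real n1 \<ge> (\<bar>d\<bar> + \<bar>q\<bar>) / \<eta>" using real_arch_simple by blast
    obtain n where n: "n \<ge> n0 + n1 + 2" "F'' n < real n * (\<beta> - 1 / real (Suc k))" using h by blast
    have tn: "n \<le> t n + 1" "t n \<le> n + 1" using t[of n] n by auto
    have "F' (t n) \<le> F'' n + d" using c n by auto
    also have "\<dots> < real n * (q - \<eta>) + d" using n(2) by (simp add: q_def \<eta>_def)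
    also have "\<dots> \<le> real (t n) * q"
    proof -
      have "real n * q - real (t n) * q \<le> \<bar>q\<bar>"
      proof -
        have "\<bar>(real n - real (t n)) * q\<bar> \<le> 1 * \<bar>q\<bar>"
          unfolding abs_mult using tn by (intro mult_right_mono) auto
        then show ?thesis by (simp add: algebra_simps)
      qed
      moreover have "real n * \<eta> \<ge> \<bar>d\<bar> + \<bar>q\<bar>"
      proof -
        have "\<bar>d\<bar> + \<bar>q\<bar> \<le> real n1 * \<eta>" using n1 \<eta> by (simp add: field_simps)
        also have "\<dots> \<le> real n * \<eta>" using n \<eta> by (intro mult_right_mono) auto
        finally show ?thesis .
      qed
      ultimately show ?thesis by (simp add: algebra_simps)
    qed
    finally show "\<exists>n\<ge>n0. F' n < real n * (\<beta> - 1 / real (Suc (Suc k)))"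
      using tn n by (intro exI[of _ "t n"]) (auto simp: q_def)
  qed
  have inv: "T x \<in> E \<beta> \<longleftrightarrow> x \<in> E \<beta>" if x: "x \<in> space M" for x \<beta>
  proof
    assume "T x \<in> E \<beta>"
    then obtain k where "\<forall>n0. \<exists>n\<ge>n0. F n (T x) < real n * (\<beta> - 1 / real (Suc k))" by (auto simp: E_def)
    from mono_step[OF this, of "\<lambda>n. F n x" Suc "l x"] show "x \<in> E \<beta>"
      using step[OF x] x by (force simp: E_def abs_le_iff algebra_simps)
  next
    assume "x \<in> E \<beta>"
    then obtain k where k: "\<forall>n0. \<exists>n\<ge>n0. F n x < real n * (\<beta> - 1 / real (Suc k))" by (auto simp: E_def)
    have c: "F (n - 1) (T x) \<le> F n x + l x" if "1 \<le> n" for n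
      using step[OF x, of "n - 1"] that by (auto simp: abs_le_iff)
    have "\<exists>k'. \<forall>n0. \<exists>n\<ge>n0. F n (T x) < real n * (\<beta> - 1 / real (Suc k'))"
      using mono_step[OF k, of "\<lambda>n. F n (T x)" "\<lambda>n. n - 1" "l x"] c by force
    then show "T x \<in> E \<beta>" using T_space[OF x] by (auto simp: E_def)
  qed
  have null: "prob (E \<beta>) = 0" if b: "\<beta> < a" for \<beta>
  proof (rule ccontr)
    assume "prob (E \<beta>) \<noteq> 0"
    then have p: "prob (E \<beta>) > 0" by (simp add: zero_less_measure_iff)
    define \<epsilon> where "\<epsilon> = (a - \<beta>) * prob (E \<beta>) / 2"
    have e: "\<epsilon> > 0" using p b by (simp add: \<epsilon>_def)
    have "\<exists>m\<ge>1. (\<integral>x. F m x * indicator (E \<beta>) x \<partial>M) \<le> real m * (\<beta> * prob (E \<beta>) + \<epsilon>)"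
    proof (rule covering_integral[OF F0 Fi sub _ _ li E _ _ e])
      show "F 1 x \<le> l x" "0 \<le> l x" if "x \<in> space M" for x
        using step[OF that, of 0] F0[OF T_space[OF that]] by auto
      show "T x \<in> E \<beta>" if "x \<in> E \<beta>" for x using that inv by (auto simp: E_def)
      show "\<exists>n\<ge>1. F n x < real n * \<beta>" if "x \<in> E \<beta>" for x
      proof -
        obtain k where "\<forall>n0. \<exists>n\<ge>n0. F n x < real n * (\<beta> - 1 / real (Suc k))" using \<open>x \<in> E \<beta>\<close> by (auto simp: E_def)
        then obtain n where n: "n \<ge> 1" "F n x < real n * (\<beta> - 1 / real (Suc k))" by blast
        have "real n * (\<beta> - 1 / real (Suc k)) \<le> real n * \<beta>" by (intro mult_left_mono) auto
        then have "F n x < real n * \<beta>" using n by linarith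
        then show ?thesis using n by blast
      qed
    qed
    then obtain m where m: "m \<ge> 1" "(\<integral>x. F m x * indicator (E \<beta>) x \<partial>M) \<le> real m * (\<beta> * prob (E \<beta>) + \<epsilon>)" by blast
    have "real m * a * prob (E \<beta>) \<le> real m * (\<beta> * prob (E \<beta>) + \<epsilon>)"
      by (rule order_trans[OF D[OF E inv m(1)] m(2)])
    then have "a * prob (E \<beta>) \<le> \<beta> * prob (E \<beta>) + \<epsilon>" using m(1) by simp
    then have "a * prob (E \<beta>) \<le> \<beta> * prob (E \<beta>)"
      by (simp add: \<epsilon>_def field_simps)
    then show False using p b by simp
  qed
  have "AE x in M. \<forall>j::nat. x \<notin> E (a - 1 / real (Suc j))"
    unfolding AE_all_countable
  proof
    fix j
    have "emeasure M (E (a - 1 / real (Suc j))) = 0" using null by (simp add: emeasure_eq_measure)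
    then show "AE x in M. x \<notin> E (a - 1 / real (Suc j))" by (intro AE_not_in) auto
  qed
  then show ?thesis
  proof (rule AE_mp, intro AE_I2 impI allI)
    fix x \<beta> assume x: "x \<in> space M" and h: "\<forall>j::nat. x \<notin> E (a - 1 / real (Suc j))" and b: "\<beta> < a"
    obtain j where j: "2 / real (Suc j) < a - \<beta>" 
      using b reals_Archimedean[of "(a - \<beta>) / 2"] by (auto simp: field_simps)
    have "\<not> (\<forall>n0. \<exists>n\<ge>n0. F n x < real n * (a - 1 / real (Suc j) - 1 / real (Suc j)))"
      using h[THEN spec, of j] x unfolding E_def by blast
    then obtain n0 where n0: "\<And>n. n \<ge> n0 \<Longrightarrow> F n x \<ge> real n * (a - 1 / real (Suc j) - 1 / real (Suc j))"
      by (meson not_less)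
    have "F n x \<ge> real n * \<beta>" if "n \<ge> n0" for n
    proof -
      have "real n * \<beta> \<le> real n * (a - 1 / real (Suc j) - 1 / real (Suc j))" 
        using j by (intro mult_left_mono) auto
      then show ?thesis using n0[OF that] by linarith
    qed
    then show "\<forall>\<^sub>F n in sequentially. F n x \<ge> real n * \<beta>" by (auto simp: eventually_sequentially)
  qed
qed

text \<open>
  Ergodicity enters only through the value of the integral of \<open>f\<close> over invariant events. The two
  halves are \<open>liminf_ge\<close> for the Birkhoff sums of \<open>f\<close> and of \<open>- f\<close>.
\<close>

lemma birkhoff:
  fixes f :: "'a \<Rightarrow> real"
  assumes fi: "integrable M f"
    and D: "\<And>D. D \<in> sets M \<Longrightarrow> (\<And>x. x \<in> space M \<Longrightarrow> T x \<in> D \<longleftrightarrow> x \<in> D) \<Longrightarrow>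
              (\<integral>x. f x * indicator D x \<partial>M) = a * prob D"
  shows "AE x in M. (\<lambda>n. (\<Sum>i<n. f ((T ^^ i) x)) / real n) \<longlonglongrightarrow> a"
proof -
  have [measurable]: "f \<in> borel_measurable M" using fi by auto
  have *: "AE x in M. \<forall>\<beta><s * a. \<forall>\<^sub>F n in sequentially. s * (\<Sum>i<n. f ((T ^^ i) x)) \<ge> real n * \<beta>" for s :: real
  proof (rule liminf_ge[where l="\<lambda>x. \<bar>s * f x\<bar>"])
    show "integrable M (\<lambda>x. s * (\<Sum>i<n. f ((T ^^ i) x)))" for n
      using integrable_iter[OF fi] by auto
    show "s * (\<Sum>i<n + m. f ((T ^^ i) x)) \<le> s * (\<Sum>i<n. f ((T ^^ i) x)) + s * (\<Sum>i<m. f ((T ^^ i) ((T ^^ n) x)))" for n m x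
      using sum_lessThan_split[of n "n + m" "\<lambda>i. f ((T ^^ i) x)"] by (simp add: funpow_add distrib_left)
    show "\<bar>s * (\<Sum>i<Suc n. f ((T ^^ i) x)) - s * (\<Sum>i<n. f ((T ^^ i) (T x)))\<bar> \<le> \<bar>s * f x\<bar>" for n x
      by (subst sum.lessThan_Suc_shift) (simp add: funpow_swap1 algebra_simps)
    show "integrable M (\<lambda>x. \<bar>s * f x\<bar>)" using fi by auto
    fix E :: "'a set" and m :: nat
    assume E [measurable]: "E \<in> sets M" and inv: "\<And>x. x \<in> space M \<Longrightarrow> T x \<in> E \<longleftrightarrow> x \<in> E"
    have invn: "(T ^^ i) x \<in> E \<longleftrightarrow> x \<in> E" if "x \<in> space M" for x i
      using that by (induction i) (auto simp: inv iter_space)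
    have ci: "integrable M (\<lambda>x. f x * indicator E x)"
      using fi by (intro integrable_real_mult_indicator) auto
    have c: "(\<integral>x. f ((T ^^ i) x) * indicator E x \<partial>M) = a * prob E" for i
    proof -
      have "(\<integral>x. f ((T ^^ i) x) * indicator E x \<partial>M) = (\<integral>x. f ((T ^^ i) x) * indicator E ((T ^^ i) x) \<partial>M)"
        by (intro Bochner_Integration.integral_cong) (auto simp: invn indicator_def)
      also have "\<dots> = (\<integral>x. f x * indicator E x \<partial>M)" by (rule integral_iter) measurable
      finally show ?thesis using D[OF E inv] by simp
    qed
    have "(\<integral>x. s * (\<Sum>i<m. f ((T ^^ i) x)) * indicator E x \<partial>M) = (\<integral>x. s * (\<Sum>i<m. f ((T ^^ i) x) * indicator E x) \<partial>M)"
      by (simp only: sum_distrib_right mult.assoc)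
    also have "\<dots> = s * (\<Sum>i<m. a * prob E)"
    proof -
      have "(\<integral>x. (\<Sum>i<m. f ((T ^^ i) x) * indicator E x) \<partial>M) = (\<Sum>i<m. a * prob E)"
        by (subst Bochner_Integration.integral_sum, intro integrable_real_mult_indicator E integrable_iter[OF fi], simp only: c)
      then show ?thesis by simp
    qed
    finally show "real m * (s * a) * prob E \<le> (\<integral>x. s * (\<Sum>i<m. f ((T ^^ i) x)) * indicator E x \<partial>M)"
      by simp
  qed auto
  from *[of 1] *[of "-1"] show ?thesis
  proof eventually_elim
    case (elim x)
    show ?case
    proof (rule order_tendstoI)
      fix c assume "c < a"
      then obtain c' where c': "c < c'" "c' < a" using dense by blast
      with elim(1) have "\<forall>\<^sub>F n in sequentially. (\<Sum>i<n. f ((T ^^ i) x)) \<ge> real n * c'" by auto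
      then show "\<forall>\<^sub>F n in sequentially. c < (\<Sum>i<n. f ((T ^^ i) x)) / real n"
        using eventually_gt_at_top[of 0]
      proof eventually_elim
        case (elim n)
        then have "c' \<le> (\<Sum>i<n. f ((T ^^ i) x)) / real n" by (simp add: field_simps)
        then show ?case using c' by linarith
      qed
    next
      fix c assume "a < c"
      then obtain c' where c': "a < c'" "c' < c" using dense by blast
      then have "-c' < -1 * a" by simp
      with elim(2) have "\<forall>\<^sub>F n in sequentially. - (\<Sum>i<n. f ((T ^^ i) x)) \<ge> real n * (-c')" by fastforce
      then show "\<forall>\<^sub>F n in sequentially. (\<Sum>i<n. f ((T ^^ i) x)) / real n < c"
        using eventually_gt_at_top[of 0]
      proof eventually_elim
        case (elim n)
        then have "(\<Sum>i<n. f ((T ^^ i) x)) / real n \<le> c'" by (simp add: field_simps)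
        then show ?case using c' by linarith
      qed
    qed
  qed
qed

text \<open>
  Independence of \<open>F n\<close> from the future \<open>T\<^sup>n\<close> replaces ergodicity: an invariant event is an event of
  the future. The lower bound is \<open>liminf_ge\<close>. For the upper bound, cut the orbit into blocks of length
  \<open>N\<close>; the sum of \<open>F N\<close> over the blocks obeys \<open>birkhoff\<close> for \<open>T\<^sup>N\<close>, and starting the blocks at a
  position \<open>r < N\<close> leaves only one of finitely many values \<open>F r x\<close> as an error.
\<close>

lemma kingman_indep:
  fixes F :: "nat \<Rightarrow> 'a \<Rightarrow> real"
  assumes F0: "\<And>x. x \<in> space M \<Longrightarrow> F 0 x = 0"
    and Fm: "\<And>n. F n \<in> borel_measurable M"
    and sub: "\<And>n m x. x \<in> space M \<Longrightarrow> F (n + m) x \<le> F n x + F m ((T ^^ n) x)"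
    and step: "\<And>n x. x \<in> space M \<Longrightarrow> \<bar>F (Suc n) x - F n (T x)\<bar> \<le> l x"
    and li: "integrable M l"
    and ind: "\<And>n A. A \<in> sets M \<Longrightarrow>
               (\<integral>x. F n x * indicator A ((T ^^ n) x) \<partial>M) = (\<integral>x. F n x \<partial>M) * prob A"
  shows "AE x in M. (\<lambda>n. F n x / real n) \<longlonglongrightarrow> (INF n\<in>{1..}. (\<integral>x. F n x \<partial>M) / real n)"
    and "bdd_below ((\<lambda>n. (\<integral>x. F n x \<partial>M) / real n) ` {1..})"
proof -
  note [measurable] = Fm
  have abs: "\<bar>F n x\<bar> \<le> (\<Sum>i<n. l ((T ^^ i) x))" if "x \<in> space M" for n x
    using that
  proof (induction n arbitrary: x)
    case 0 then show ?case by (simp add: F0)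
  next
    case (Suc n)
    have "\<bar>F (Suc n) x\<bar> \<le> l x + \<bar>F n (T x)\<bar>" using step[OF Suc.prems, of n] by linarith
    also have "\<bar>F n (T x)\<bar> \<le> (\<Sum>i<n. l ((T ^^ i) (T x)))" using Suc.IH[OF T_space[OF Suc.prems]] .
    also have "l x + (\<Sum>i<n. l ((T ^^ i) (T x))) = (\<Sum>i<Suc n. l ((T ^^ i) x))"
      by (subst sum.lessThan_Suc_shift) (simp add: funpow_swap1)
    finally show ?case by simp
  qed
  have si: "integrable M (\<lambda>x. \<Sum>i<n. l ((T ^^ i) x))" for n
    by (intro Bochner_Integration.integrable_sum integrable_iter li)
  have Fi: "integrable M (F n)" for n
    by (rule Bochner_Integration.integrable_bound[OF si[of n]])
      (use abs in \<open>auto intro!: AE_I2 simp: order_trans[OF _ abs_ge_self]\<close>)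
  define a where "a = (\<lambda>n. \<integral>x. F n x \<partial>M)"
  have alow: "a n \<ge> real n * (- (\<integral>x. l x \<partial>M))" for n
  proof -
    have "- a n = (\<integral>x. - F n x \<partial>M)" by (simp add: a_def)
    also have "\<dots> \<le> (\<integral>x. (\<Sum>i<n. l ((T ^^ i) x)) \<partial>M)"
    proof (intro integral_mono si)
      fix x assume "x \<in> space M" from abs[OF this, of n] show "- F n x \<le> (\<Sum>i<n. l ((T ^^ i) x))" by linarith
    qed (use Fi in auto)
    also have "\<dots> = real n * (\<integral>x. l x \<partial>M)"
      using integral_iter[of l] li by (subst Bochner_Integration.integral_sum) (auto intro!: integrable_iter)
    finally show ?thesis by simp
  qed
  have bdd: "bdd_below ((\<lambda>n. a n / real n) ` {1..})"
  proof (rule bdd_belowI2[where m="- (\<integral>x. l x \<partial>M)"])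
    fix n :: nat assume "n \<in> {1..}"
    then show "- (\<integral>x. l x \<partial>M) \<le> a n / real n" using alow[of n] by (simp add: field_simps)
  qed
  then show "bdd_below ((\<lambda>n. (\<integral>x. F n x \<partial>M) / real n) ` {1..})" by (simp add: a_def)
  define \<gamma> where "\<gamma> = (INF n\<in>{1..}. a n / real n)"
  have \<gamma>le: "\<gamma> \<le> a n / real n" if "n \<ge> 1" for n
    unfolding \<gamma>_def using that by (intro cINF_lower bdd) auto
  have inva: "(\<integral>x. F n x * indicator D x \<partial>M) = a n * prob D"
    if "D \<in> sets M" "\<And>x. x \<in> space M \<Longrightarrow> T x \<in> D \<longleftrightarrow> x \<in> D" for n D
  proof -
    have "(T ^^ n) x \<in> D \<longleftrightarrow> x \<in> D" if "x \<in> space M" for x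
      using that by (induction n) (auto simp: \<open>\<And>x. x \<in> space M \<Longrightarrow> T x \<in> D \<longleftrightarrow> x \<in> D\<close> iter_space)
    then have "(\<integral>x. F n x * indicator D x \<partial>M) = (\<integral>x. F n x * indicator D ((T ^^ n) x) \<partial>M)"
      by (intro Bochner_Integration.integral_cong) (auto simp: indicator_def)
    then show ?thesis using ind[OF that(1), of n] by (simp add: a_def)
  qed
  have lower: "AE x in M. \<forall>\<beta><\<gamma>. \<forall>\<^sub>F n in sequentially. F n x \<ge> real n * \<beta>"
  proof (rule liminf_ge[OF F0 Fi sub step li])
    fix D and m :: nat assume D: "D \<in> sets M" "\<And>x. x \<in> space M \<Longrightarrow> T x \<in> D \<longleftrightarrow> x \<in> D" and m: "m \<ge> 1"
    have "real m * \<gamma> \<le> a m" using \<gamma>le[OF m] m by (simp add: field_simps)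
    then show "real m * \<gamma> * prob D \<le> (\<integral>x. F m x * indicator D x \<partial>M)"
      by (subst inva[OF D]) (auto intro: mult_right_mono)
  qed
  have upper: "AE x in M. \<forall>c > a N / real N. \<forall>\<^sub>F n in sequentially. F n x \<le> real n * c" if N: "N \<ge> 1" for N
  proof -
    interpret TN: measure_preserving M "T ^^ N" by (rule measure_preserving_iter)
    have "AE x in M. (\<lambda>j. (\<Sum>i<j. F N (((T ^^ N) ^^ i) x)) / real j) \<longlonglongrightarrow> a N"
    proof (rule TN.birkhoff[OF Fi])
      fix D assume D: "D \<in> sets M" "\<And>x. x \<in> space M \<Longrightarrow> (T ^^ N) x \<in> D \<longleftrightarrow> x \<in> D"
      have "(\<integral>x. F N x * indicator D x \<partial>M) = (\<integral>x. F N x * indicator D ((T ^^ N) x) \<partial>M)"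
        using D(2) by (intro Bochner_Integration.integral_cong) (auto simp: indicator_def)
      then show "(\<integral>x. F N x * indicator D x \<partial>M) = a N * prob D" using ind[OF D(1), of N] by (simp add: a_def)
    qed
    from AE_iter[OF this] have "AE x in M. \<forall>r. (\<lambda>j. (\<Sum>i<j. F N (((T ^^ N) ^^ i) ((T ^^ r) x))) / real j) \<longlonglongrightarrow> a N"
      by (simp add: AE_all_countable)
    then show ?thesis
    proof (rule AE_mp, intro AE_I2 impI allI)
      fix x c assume x: "x \<in> space M" and conv: "\<forall>r. (\<lambda>j. (\<Sum>i<j. F N (((T ^^ N) ^^ i) ((T ^^ r) x))) / real j) \<longlonglongrightarrow> a N"
        and c: "a N / real N < c"
      obtain c1 where c1: "a N / real N < c1" "c1 < c" using dense[OF c] by blast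
      have aN: "a N < real N * c1" using c1 N by (simp add: field_simps)
      have "\<forall>\<^sub>F j in sequentially. \<forall>r\<in>{..<N}. (\<Sum>i<j. F N (((T ^^ N) ^^ i) ((T ^^ r) x))) \<le> real j * (real N * c1)"
      proof (rule eventually_ball_finite)
        show "finite {..<N}" by simp
        show "\<forall>r\<in>{..<N}. \<forall>\<^sub>F j in sequentially. (\<Sum>i<j. F N (((T ^^ N) ^^ i) ((T ^^ r) x))) \<le> real j * (real N * c1)"
        proof
          fix r
          have "\<forall>\<^sub>F j in sequentially. (\<Sum>i<j. F N (((T ^^ N) ^^ i) ((T ^^ r) x))) / real j < real N * c1"
            using conv aN by (intro order_tendstoD(2)) auto
          then show "\<forall>\<^sub>F j in sequentially. (\<Sum>i<j. F N (((T ^^ N) ^^ i) ((T ^^ r) x))) \<le> real j * (real N * c1)"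
            using eventually_gt_at_top[of 0] by eventually_elim (simp add: field_simps)
        qed
      qed
      then obtain j0 where j0: "\<And>j r. j \<ge> j0 \<Longrightarrow> r < N \<Longrightarrow> (\<Sum>i<j. F N (((T ^^ N) ^^ i) ((T ^^ r) x))) \<le> real j * (real N * c1)"
        by (auto simp: eventually_sequentially)
      define K where "K = Max ((\<lambda>r. F r x) ` {..<N}) + real N * \<bar>c1\<bar>"
      have K: "F r x \<le> K - real r * \<bar>c1\<bar>" if "r < N" for r
      proof -
        have "F r x \<le> Max ((\<lambda>r. F r x) ` {..<N})" using that by (intro Max_ge) auto
        moreover have "real r * \<bar>c1\<bar> \<le> real N * \<bar>c1\<bar>" using that by (intro mult_right_mono) auto
        ultimately show ?thesis by (simp add: K_def)
      qed
      have blocks: "F (j * N) y \<le> (\<Sum>i<j. F N (((T ^^ N) ^^ i) y))" if "y \<in> space M" for j y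
        using that
      proof (induction j arbitrary: y)
        case 0 then show ?case by (simp add: F0)
      next
        case (Suc j)
        have "F (N + j * N) y \<le> F N y + F (j * N) ((T ^^ N) y)" using sub Suc.prems .
        also have "F (j * N) ((T ^^ N) y) \<le> (\<Sum>i<j. F N (((T ^^ N) ^^ i) ((T ^^ N) y)))"
          using Suc.IH iter_space Suc.prems by blast
        also have "F N y + (\<Sum>i<j. F N (((T ^^ N) ^^ i) ((T ^^ N) y))) = (\<Sum>i<Suc j. F N (((T ^^ N) ^^ i) y))"
          by (subst sum.lessThan_Suc_shift) (simp add: funpow_swap1)
        finally show ?case by simp
      qed
      obtain n1 :: nat where n1: "real n1 \<ge> K / (c - c1)" using real_arch_simple by blast
      have "F n x \<le> real n * c" if n: "n \<ge> j0 * N + n1 + N" for n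
      proof -
        define j where "j = n div N" define r where "r = n mod N"
        have nr: "n = r + j * N" "r < N" using N by (auto simp: j_def r_def)
        have "j \<ge> j0"
        proof (rule ccontr)
          assume "\<not> j0 \<le> j" then have "j * N \<le> j0 * N" by simp
          then show False using n nr by linarith
        qed
        have "F n x \<le> F r x + F (j * N) ((T ^^ r) x)" unfolding nr(1) using sub x by blast
        also have "F (j * N) ((T ^^ r) x) \<le> real j * (real N * c1)"
          using blocks[OF iter_space[OF x]] j0[OF \<open>j \<ge> j0\<close> nr(2)] order_trans by blast
        also have "F r x \<le> K - real r * \<bar>c1\<bar>" using K nr by blast
        also have "K - real r * \<bar>c1\<bar> + real j * (real N * c1) \<le> K + real n * c1"
        proof -
          have "real n * c1 = real r * c1 + real j * (real N * c1)" by (subst nr(1)) (simp add: algebra_simps)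
          moreover have "real r * (- \<bar>c1\<bar>) \<le> real r * c1" by (intro mult_left_mono) auto
          ultimately show ?thesis by simp
        qed
        also have "\<dots> \<le> real n * c"
        proof -
          have "K \<le> real n1 * (c - c1)" using n1 c1 by (simp add: field_simps)
          also have "\<dots> \<le> real n * (c - c1)" using n c1 by (intro mult_right_mono) auto
          finally show ?thesis by (simp add: algebra_simps)
        qed
        finally show ?thesis by simp
      qed
      then show "\<forall>\<^sub>F n in sequentially. F n x \<le> real n * c" by (auto simp: eventually_sequentially)
    qed
  qed
  have "AE x in M. \<forall>N. N \<ge> 1 \<longrightarrow> (\<forall>c > a N / real N. \<forall>\<^sub>F n in sequentially. F n x \<le> real n * c)"
    using upper by (subst AE_all_countable) auto
  then have "AE x in M. (\<lambda>n. F n x / real n) \<longlonglongrightarrow> \<gamma>"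
    using lower
  proof eventually_elim
    case (elim x)
    show ?case
    proof (rule order_tendstoI)
      fix c assume "c < \<gamma>"
      then obtain c' where c': "c < c'" "c' < \<gamma>" using dense by blast
      with elim(2) have "\<forall>\<^sub>F n in sequentially. F n x \<ge> real n * c'" by blast
      then show "\<forall>\<^sub>F n in sequentially. c < F n x / real n"
        using eventually_gt_at_top[of 0]
      proof eventually_elim
        case (elim n)
        then have "c' \<le> F n x / real n" by (simp add: field_simps)
        then show ?case using c' by linarith
      qed
    next
      fix c assume "\<gamma> < c"
      then obtain c' where c': "\<gamma> < c'" "c' < c" using dense by blast
      then obtain N where N: "N \<ge> 1" "a N / real N < c'"
        unfolding \<gamma>_def by (subst (asm) cINF_less_iff[OF _ bdd]) auto
      with elim(1) have "\<forall>\<^sub>F n in sequentially. F n x \<le> real n * c'" by blast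
      then show "\<forall>\<^sub>F n in sequentially. F n x / real n < c"
        using eventually_gt_at_top[of 0]
      proof eventually_elim
        case (elim n)
        then have "F n x / real n \<le> c'" by (simp add: field_simps)
        then show ?case using c' by linarith
      qed
    qed
  qed
  then show "AE x in M. (\<lambda>n. F n x / real n) \<longlonglongrightarrow> (INF n\<in>{1..}. (\<integral>x. F n x \<partial>M) / real n)"
    by (simp add: \<gamma>_def a_def)
qed

end

section \<open>Coordinates on the two projective spaces\<close>

subsection \<open>Linear algebra relative to a subspace\<close>

lemma scaleR_eq_scale: "r *\<^sub>R v = of_real r *s (v :: 'k::real_normed_field^'n)"
  unfolding vec_eq_iff vector_scaleR_component vector_smult_component by (simp add: scaleR_conv_of_real)

lemma norm_scale: "norm (a *s (v :: 'k::real_normed_field^'n)) = norm a * norm v"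
  by (simp add: norm_vec_def norm_mult L2_set_right_distrib)

lemma linear_real:
  fixes f :: "'k::real_normed_field^'n \<Rightarrow> 'k^'m"
  assumes "Vector_Spaces.linear (*s) (*s) f"
  shows "linear f"
proof -
  interpret f: Vector_Spaces.linear "(*s)" "(*s)" f by fact
  show ?thesis by (rule linearI) (simp_all add: f.add f.scale scaleR_eq_scale)
qed

lemma bounded_linear_mv: "bounded_linear ((*v) (g :: 'k::{real_normed_field,euclidean_space}^'n^'m))"
  by (intro linear_conv_bounded_linear[THEN iffD1] linear_real matrix_vector_mul_linear_gen)

lemma norm_mv_le: "norm (g *v v) \<le> onorm ((*v) (g :: 'k::{real_normed_field,euclidean_space}^'n^'m)) * norm v"
  by (rule onorm[OF bounded_linear_mv])

lemma continuous_on_mv [continuous_intros]: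
  fixes f :: "'a::topological_space \<Rightarrow> 'k::{real_normed_field,euclidean_space}^'n^'m"
  assumes "continuous_on S f" "continuous_on S h"
  shows "continuous_on S (\<lambda>x. f x *v h x)"
  unfolding matrix_vector_mult_def
  by (intro continuous_on_vec_lambda continuous_on_sum continuous_on_mult continuous_on_component assms)

lemma continuous_on_mm [continuous_intros]:
  fixes f :: "'a::topological_space \<Rightarrow> 'k::{real_normed_field,euclidean_space}^'n^'m"
    and h :: "'a \<Rightarrow> 'k^'l^'n"
  assumes "continuous_on S f" "continuous_on S h"
  shows "continuous_on S (\<lambda>x. f x ** h x)"
  unfolding matrix_matrix_mult_def
  by (intro continuous_on_vec_lambda continuous_on_sum continuous_on_mult continuous_on_component assms)

lemma measurable_mv [measurable (raw)]:
  fixes f :: "'a \<Rightarrow> 'k::{real_normed_field,euclidean_space}^'n^'m"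
  assumes [measurable]: "f \<in> borel_measurable M" "h \<in> borel_measurable M"
  shows "(\<lambda>x. f x *v h x) \<in> borel_measurable M"
  by (rule borel_measurable_continuous_Pair[OF assms]) (intro continuous_intros)

lemma measurable_mm [measurable (raw)]:
  fixes f :: "'a \<Rightarrow> 'k::{real_normed_field,euclidean_space}^'n^'m"
    and h :: "'a \<Rightarrow> 'k^'l^'n"
  assumes [measurable]: "f \<in> borel_measurable M" "h \<in> borel_measurable M"
  shows "(\<lambda>x. f x ** h x) \<in> borel_measurable M"
  by (rule borel_measurable_continuous_Pair[OF assms]) (intro continuous_intros)

lemma continuous_on_scale [continuous_intros]:
  fixes f :: "'a::topological_space \<Rightarrow> 'k::{real_normed_field,euclidean_space}"
    and h :: "'a \<Rightarrow> 'k^'n"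
  assumes "continuous_on S f" "continuous_on S h"
  shows "continuous_on S (\<lambda>x. f x *s h x)"
  unfolding vector_scalar_mult_def
  by (intro continuous_on_vec_lambda continuous_on_mult continuous_on_component assms)

lemma measurable_scale [measurable (raw)]:
  fixes f :: "'a \<Rightarrow> 'k::{real_normed_field,euclidean_space}"
    and h :: "'a \<Rightarrow> 'k^'n"
  assumes [measurable]: "f \<in> borel_measurable M" "h \<in> borel_measurable M"
  shows "(\<lambda>x. f x *s h x) \<in> borel_measurable M"
  by (rule borel_measurable_continuous_Pair[OF assms]) (intro continuous_intros)

lemma line_eq: "line v = range (\<lambda>a. a *s v)"
  unfolding line_def by (rule vec.span_singleton)

text \<open>
  The integrand of the first moment condition. It controls the growth of all norms under \<open>g\<close> in both directions.
\<close>

definition log_norm :: "'k::{real_normed_field,euclidean_space}^'n^'n \<Rightarrow> real" where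
  "log_norm g = ln (max (onorm ((*v) g)) (onorm ((*v) (matrix_inv g))))"

lemma invertible_inv:
  fixes g :: "'k::field^'n^'n"
  assumes "invertible g"
  shows "g ** matrix_inv g = mat 1" "matrix_inv g ** g = mat 1" "invertible (matrix_inv g)"
        "matrix_inv (matrix_inv g) = g"
proof -
  show 1: "g ** matrix_inv g = mat 1" "matrix_inv g ** g = mat 1"
    using someI_ex[OF assms[unfolded invertible_def]] by (simp_all add: matrix_inv_def)
  show 2: "invertible (matrix_inv g)" unfolding invertible_def using 1 by blast
  show "matrix_inv (matrix_inv g) = g"
  proof -
    have "matrix_inv g ** matrix_inv (matrix_inv g) = mat 1"
      using someI_ex[OF 2[unfolded invertible_def]] by (simp add: matrix_inv_def[of "matrix_inv g"])
    then show ?thesis by (metis 1 matrix_mul_assoc matrix_mul_lid matrix_mul_rid)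
  qed
qed

lemma onorm_pos_invertible:
  fixes g :: "'k::{real_normed_field,euclidean_space}^'n^'n"
  assumes "invertible g"
  shows "onorm ((*v) g) > 0" "1 \<le> onorm ((*v) g) * onorm ((*v) (matrix_inv g))"
proof -
  obtain v :: "'k^'n" where v: "v \<noteq> 0" by (rule that[of "axis undefined 1"]) (simp add: axis_eq_0_iff)
  have "v = matrix_inv g *v (g *v v)" by (simp add: matrix_vector_mul_assoc invertible_inv assms)
  then have "norm v \<le> onorm ((*v) (matrix_inv g)) * norm (g *v v)" by (metis norm_mv_le)
  also have "\<dots> \<le> onorm ((*v) (matrix_inv g)) * (onorm ((*v) g) * norm v)"
    by (intro mult_left_mono norm_mv_le onorm_pos_le bounded_linear_mv)
  finally show "1 \<le> onorm ((*v) g) * onorm ((*v) (matrix_inv g))" using v by (simp add: mult.commute mult.left_commute)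
  then have "onorm ((*v) g) \<noteq> 0" by auto
  then show "onorm ((*v) g) > 0" using onorm_pos_le[OF bounded_linear_mv, of g] by simp
qed

lemma log_norm_bounds:
  fixes g :: "'k::{real_normed_field,euclidean_space}^'n^'n"
  assumes "invertible g"
  shows "0 \<le> log_norm g" "onorm ((*v) g) \<le> exp (log_norm g)" "onorm ((*v) (matrix_inv g)) \<le> exp (log_norm g)"
    "log_norm (matrix_inv g) = log_norm g"
proof -
  let ?a = "onorm ((*v) g)" let ?b = "onorm ((*v) (matrix_inv g))"
  have a: "?a > 0" "?b > 0" "1 \<le> ?a * ?b" using onorm_pos_invertible invertible_inv assms by blast+
  have m: "max ?a ?b \<ge> 1"
  proof (rule ccontr)
    assume "\<not> 1 \<le> max ?a ?b"
    then have "?a * ?b < 1 * 1" using a by (intro mult_strict_mono) auto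
    then show False using a by simp
  qed
  then show "0 \<le> log_norm g" by (simp add: log_norm_def)
  have "exp (log_norm g) = max ?a ?b" using m by (simp add: log_norm_def)
  then show "?a \<le> exp (log_norm g)" "?b \<le> exp (log_norm g)" by auto
  show "log_norm (matrix_inv g) = log_norm g" by (simp add: log_norm_def invertible_inv assms max.commute)
qed

definition stab :: "('k::field^'n) set \<Rightarrow> ('k^'n^'n) set" where
  "stab W = {g. invertible g \<and> (\<forall>w\<in>W. g *v w \<in> W)}"

lemma stab_mult: "g \<in> stab W \<Longrightarrow> h \<in> stab W \<Longrightarrow> g ** h \<in> stab W"
  by (auto simp: stab_def invertible_mult matrix_vector_mul_assoc[symmetric])

lemma stab_one: "mat 1 \<in> stab W"
  by (auto simp: stab_def invertible_def intro: exI[of _ "mat 1"])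

text \<open>
  The projection \<open>\<pi>\<close> along \<open>W\<close> onto a complement identifies \<open>V/W\<close> with the range of \<open>\<pi>\<close>. It is the means
  to choose representatives measurably.
\<close>

locale split_subspace =
  fixes W :: "('k::{real_normed_field,euclidean_space}^'n) set" and \<pi> :: "'k^'n \<Rightarrow> 'k^'n"
  assumes W: "vec.subspace W" and lin: "Vector_Spaces.linear (*s) (*s) \<pi>"
    and ker: "\<pi> v = 0 \<longleftrightarrow> v \<in> W" and retr: "\<pi> v - v \<in> W"

lemma ex_split_subspace:
  fixes W :: "('k::{real_normed_field,euclidean_space}^'n) set"
  assumes "vec.subspace W"
  obtains \<pi> where "split_subspace W \<pi>"
proof -
  have "Vector_Spaces.linear (*s) (*s) (\<lambda>v :: 'k^'n. v)" by (rule vec.linear_ident)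
  from vec.linear_exists_left_inverse_on[OF this assms]
  obtain p where p: "p ` UNIV \<subseteq> W" "Vector_Spaces.linear (*s) (*s) p" "\<forall>v\<in>W. p v = v" by auto
  interpret p: Vector_Spaces.linear "(*s)" "(*s)" p by fact
  have "split_subspace W (\<lambda>v. v - p v)"
  proof
    show "v - p v = 0 \<longleftrightarrow> v \<in> W" for v using p by (auto simp: image_subset_iff) metis
    show "v - p v - v \<in> W" for v using p vec.subspace_neg[OF assms] by (auto simp: image_subset_iff)
  qed (auto simp: assms p.add p.scale vec.scale_right_diff_distrib)
  then show thesis by (rule that)
qed

context split_subspace
begin

sublocale pi: Vector_Spaces.linear "(*s)" "(*s)" \<pi> by (rule lin)

lemma W0: "0 \<in> W" by (rule vec.subspace_0[OF W])
lemma W_add: "a \<in> W \<Longrightarrow> b \<in> W \<Longrightarrow> a + b \<in> W" by (rule vec.subspace_add[OF W])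
lemma W_diff: "a \<in> W \<Longrightarrow> b \<in> W \<Longrightarrow> a - b \<in> W" by (rule vec.subspace_diff[OF W])
lemma W_scale: "a \<in> W \<Longrightarrow> c *s a \<in> W" by (rule vec.subspace_scale[OF W])
lemma W_scale_iff: "c \<noteq> 0 \<Longrightarrow> c *s a \<in> W \<longleftrightarrow> a \<in> W"
  using W_scale[of "c *s a" "inverse c"] W_scale[of a c] by auto

lemma pi_add_W: "w \<in> W \<Longrightarrow> \<pi> (v + w) = \<pi> v"
  using ker[of w] by (simp add: pi.add)

lemma pi_eq_iff: "\<pi> u = \<pi> v \<longleftrightarrow> u - v \<in> W"
  using ker[of "u - v"] by (simp add: pi.diff)

lemma pi_pi: "\<pi> (\<pi> v) = \<pi> v"
  using retr by (simp add: pi_eq_iff)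

lemma bounded_linear_pi: "bounded_linear \<pi>"
  by (intro linear_conv_bounded_linear[THEN iffD1] linear_real lin)

lemma continuous_on_pi [continuous_intros]: "continuous_on S f \<Longrightarrow> continuous_on S (\<lambda>x. \<pi> (f x))"
  by (rule bounded_linear.continuous_on[OF bounded_linear_pi])

lemma pi_measurable [measurable]: "\<pi> \<in> borel_measurable borel"
  by (intro borel_measurable_continuous_onI continuous_intros)

lemma pi_in_W: "\<pi> v \<in> W \<longleftrightarrow> v \<in> W"
  using W_diff[OF _ retr[of v], of "\<pi> v"] W_add[OF _ retr[of v], of v] by auto

lemma closed_W: "closed W"
  by (rule closed_subspace)
    (auto intro!: subspaceI W0 W_add W_scale simp: scaleR_eq_scale)

lemma W_sets [measurable]: "W \<in> sets borel" using closed_W by auto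

lemma infdist_eq_0: "infdist v W = 0 \<longleftrightarrow> v \<in> W"
  using in_closed_iff_infdist_zero[OF closed_W] W0 by auto

lemma infdist_pos: "v \<notin> W \<Longrightarrow> infdist v W > 0"
  using infdist_eq_0[of v] infdist_nonneg[of v W] by linarith

lemma le_infdist: "(\<And>w. w \<in> W \<Longrightarrow> c \<le> dist v w) \<Longrightarrow> c \<le> infdist v W"
  using W0 by (subst infdist_notempty) (auto intro!: cINF_greatest)

lemma infdist_add_W: assumes "w \<in> W" shows "infdist (v + w) W = infdist v W"
proof (rule antisym)
  show "infdist (v + w) W \<le> infdist v W"
  proof (rule le_infdist)
    fix u assume "u \<in> W"
    then have "infdist (v + w) W \<le> dist (v + w) (u + w)" by (intro infdist_le W_add assms)
    then show "infdist (v + w) W \<le> dist v u" by simp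
  qed
  show "infdist v W \<le> infdist (v + w) W"
  proof (rule le_infdist)
    fix u assume "u \<in> W"
    then have "infdist v W \<le> dist v (u - w)" by (intro infdist_le W_diff assms)
    then show "infdist v W \<le> dist (v + w) u" by (simp add: dist_norm algebra_simps)
  qed
qed

lemma infdist_map_le:
  assumes "bounded_linear f" "f ` W \<subseteq> W"
  shows "infdist (f v) W \<le> onorm f * infdist v W"
proof (cases "onorm f = 0")
  case True
  then have "f v = 0" using onorm_eq_0[OF assms(1)] by simp
  then show ?thesis using True W0 by simp
next
  case False
  then have o: "onorm f > 0" using onorm_pos_le[OF assms(1)] by simp
  have "infdist (f v) W / onorm f \<le> infdist v W"
  proof (rule le_infdist)
    fix w assume "w \<in> W"
    then have "infdist (f v) W \<le> dist (f v) (f w)" using assms by (intro infdist_le) auto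
    also have "\<dots> = norm (f (v - w))" by (simp add: dist_norm bounded_linear.linear[OF assms(1), THEN linear_diff])
    also have "\<dots> \<le> onorm f * norm (v - w)" by (rule onorm[OF assms(1)])
    finally show "infdist (f v) W / onorm f \<le> dist v w" using o by (simp add: field_simps dist_norm)
  qed
  then show ?thesis using o by (simp add: field_simps)
qed

lemma infdist_scale: "infdist (c *s v) W = norm c * infdist v W"
proof -
  have bl: "bounded_linear ((*s) c :: 'k^'n \<Rightarrow> 'k^'n)" for c
    by (intro linear_conv_bounded_linear[THEN iffD1] linear_real vec.linear_scale_self)
  have on: "onorm ((*s) c :: 'k^'n \<Rightarrow> 'k^'n) \<le> norm c" for c
    by (rule onorm_bound) (auto simp: norm_scale)
  have le: "infdist (c *s v) W \<le> norm c * infdist v W" for c v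
  proof -
    have "infdist (c *s v) W \<le> onorm ((*s) c :: 'k^'n \<Rightarrow> 'k^'n) * infdist v W"
      by (intro infdist_map_le bl) (auto intro: W_scale)
    also have "\<dots> \<le> norm c * infdist v W" by (intro mult_right_mono on infdist_nonneg)
    finally show ?thesis .
  qed
  show ?thesis
  proof (cases "c = 0")
    case True then show ?thesis using W0 by simp
  next
    case False
    have "infdist v W \<le> norm (inverse c) * infdist (c *s v) W" using le[of "inverse c" "c *s v"] False by simp
    then have "norm c * infdist v W \<le> norm c * (norm (inverse c) * infdist (c *s v) W)"
      by (intro mult_left_mono) auto
    also have "\<dots> = infdist (c *s v) W" using False by (simp add: norm_inverse[symmetric] mult.assoc[symmetric] norm_mult[symmetric])
    finally have "norm c * infdist v W \<le> infdist (c *s v) W" .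
    then show ?thesis using le[of c v] by linarith
  qed
qed

lemma norm_pi_le: "norm (\<pi> v) \<le> onorm \<pi> * infdist v W"
proof (cases "onorm \<pi> = 0")
  case True then show ?thesis using onorm_eq_0[OF bounded_linear_pi] by simp
next
  case False
  then have o: "onorm \<pi> > 0" using onorm_pos_le[OF bounded_linear_pi] by simp
  have "norm (\<pi> v) / onorm \<pi> \<le> infdist v W"
  proof (rule le_infdist)
    fix w assume "w \<in> W"
    then have "\<pi> (v - w) = \<pi> v" using pi_eq_iff[of "v - w" v] W_scale[of w "-1"] by simp
    then have "norm (\<pi> v) \<le> onorm \<pi> * norm (v - w)" using onorm[OF bounded_linear_pi, of "v - w"] by simp
    then show "norm (\<pi> v) / onorm \<pi> \<le> dist v w" using o by (simp add: field_simps dist_norm)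
  qed
  then show ?thesis using o by (simp add: field_simps)
qed

lemma stab_image: assumes "g \<in> stab W" shows "(*v) g ` W = W"
proof -
  have inj: "inj_on ((*v) g) S" for S
    using assms invertible_inv(2)[of g] unfolding stab_def
    by (intro inj_on_inverseI[of _ "(*v) (matrix_inv g)"]) (auto simp: matrix_vector_mul_assoc)
  show ?thesis
  proof (rule vec.subspace_dim_equal)
    show "vec.subspace ((*v) g ` W)" by (intro vec.linear_subspace_image W matrix_vector_mul_linear_gen)
    show "(*v) g ` W \<subseteq> W" using assms by (auto simp: stab_def)
    show "vec.dim W \<le> vec.dim ((*v) g ` W)"
      by (subst vec.dim_image_eq[OF matrix_vector_mul_linear_gen inj]) auto
  qed (rule W)
qed

lemma stabD: "g \<in> stab W \<Longrightarrow> invertible g" "g \<in> stab W \<Longrightarrow> w \<in> W \<Longrightarrow> g *v w \<in> W"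
  by (auto simp: stab_def)

lemma inv_mv_cancel:
  fixes g :: "'k^'n^'n"
  assumes "invertible g" shows "matrix_inv g *v (g *v v) = v"
  unfolding matrix_vector_mul_assoc invertible_inv(2)[OF assms] by simp

text \<open>
  In finite dimension an injective map of \<open>W\<close> into itself is onto \<open>W\<close>.
\<close>

lemma stab_inv: assumes "g \<in> stab W" shows "matrix_inv g \<in> stab W"
  unfolding stab_def
proof (intro CollectI conjI ballI)
  show "invertible (matrix_inv g)" by (rule invertible_inv(3)[OF stabD(1)[OF assms]])
  fix w assume "w \<in> W"
  then obtain u where "u \<in> W" "w = g *v u" using stab_image[OF assms] by blast
  then show "matrix_inv g *v w \<in> W" by (simp only: inv_mv_cancel[OF stabD(1)[OF assms]])
qed

lemma stab_in_W: assumes "g \<in> stab W" shows "g *v v \<in> W \<longleftrightarrow> v \<in> W"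
  using stabD(2)[OF stab_inv[OF assms], of "g *v v"] stabD(2)[OF assms, of v]
  by (simp only: inv_mv_cancel[OF stabD(1)[OF assms]]) iprover

lemma stab_infdist:
  assumes "g \<in> stab W"
  shows "infdist (g *v v) W \<le> exp (log_norm g) * infdist v W" "infdist v W \<le> exp (log_norm g) * infdist (g *v v) W"
proof -
  have g: "invertible g" using assms by (simp add: stab_def)
  have *: "infdist (h *v v) W \<le> exp (log_norm h) * infdist v W" if "h \<in> stab W" for h v
  proof -
    have "infdist (h *v v) W \<le> onorm ((*v) h) * infdist v W"
      by (intro infdist_map_le bounded_linear_mv) (simp add: stab_image that)
    also have "\<dots> \<le> exp (log_norm h) * infdist v W"
      using that by (intro mult_right_mono log_norm_bounds infdist_nonneg) (auto simp: stab_def)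
    finally show ?thesis .
  qed
  show "infdist (g *v v) W \<le> exp (log_norm g) * infdist v W" by (rule *[OF assms])
  show "infdist v W \<le> exp (log_norm g) * infdist (g *v v) W"
    using *[OF stab_inv[OF assms], of "g *v v"]
    by (simp add: matrix_vector_mul_assoc invertible_inv[OF g] log_norm_bounds[OF g])
qed

subsection \<open>The norm on the subspace\<close>

lemma onorm_on_bdd: "bdd_above ((\<lambda>w. norm (g *v w) / norm w) ` W)"
proof (rule bdd_aboveI2)
  fix w show "norm (g *v w) / norm w \<le> onorm ((*v) g)"
    by (rule le_onorm[OF bounded_linear_mv])
qed

lemma onorm_on_le: "w \<in> W \<Longrightarrow> norm (g *v w) \<le> onorm_on W g * norm w"
proof -
  assume w: "w \<in> W"
  have "norm (g *v w) / norm w \<le> onorm_on W g"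
    unfolding onorm_on_def by (intro cSUP_upper w onorm_on_bdd)
  then show ?thesis by (cases "w = 0") (auto simp: field_simps)
qed

lemma onorm_on_nonneg: "0 \<le> onorm_on W g"
proof -
  have "norm (g *v 0) / norm (0 :: 'k^'n) \<le> onorm_on W g"
    unfolding onorm_on_def by (intro cSUP_upper W0 onorm_on_bdd)
  then show ?thesis by simp
qed

lemma onorm_on_bound:
  assumes "\<And>w. w \<in> W \<Longrightarrow> norm (g *v w) \<le> c * norm w" "0 \<le> c"
  shows "onorm_on W g \<le> c"
  unfolding onorm_on_def
proof (rule cSUP_least)
  fix w assume "w \<in> W"
  then show "norm (g *v w) / norm w \<le> c" using assms(1)[of w] assms(2)
    by (cases "w = 0") (auto simp: field_simps)
qed (use W0 in auto)

lemma onorm_on_mult: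
  assumes "h \<in> stab W" shows "onorm_on W (g ** h) \<le> onorm_on W g * onorm_on W h"
proof (rule onorm_on_bound)
  fix w assume w: "w \<in> W"
  have hw: "h *v w \<in> W" using assms w by (simp add: stab_def)
  have "norm ((g ** h) *v w) \<le> onorm_on W g * norm (h *v w)"
    using onorm_on_le[OF hw, of g] by (simp add: matrix_vector_mul_assoc)
  also have "\<dots> \<le> onorm_on W g * (onorm_on W h * norm w)"
    by (intro mult_left_mono onorm_on_le w onorm_on_nonneg)
  finally show "norm ((g ** h) *v w) \<le> onorm_on W g * onorm_on W h * norm w" by simp
qed (intro mult_nonneg_nonneg onorm_on_nonneg)

lemma onorm_on_le_exp: assumes "invertible g" shows "onorm_on W g \<le> exp (log_norm g)"
proof (rule onorm_on_bound)
  fix w have "norm (g *v w) \<le> onorm ((*v) g) * norm w" by (rule norm_mv_le)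
  also have "\<dots> \<le> exp (log_norm g) * norm w" by (intro mult_right_mono log_norm_bounds assms) auto
  finally show "norm (g *v w) \<le> exp (log_norm g) * norm w" .
qed auto

text \<open>
  A supremum of continuous functions is lower semicontinuous.
\<close>

lemma onorm_on_measurable [measurable]: "onorm_on W \<in> borel_measurable borel"
proof (rule borel_measurableI_greater)
  fix a :: real
  have "{x \<in> space borel. a < onorm_on W x} = (\<Union>w\<in>W. {x. a < norm (x *v w) / norm w})"
  proof -
    have "W \<noteq> {}" using W0 by auto
    then have "a < onorm_on W x \<longleftrightarrow> (\<exists>w\<in>W. a < norm (x *v w) / norm w)" for x
      unfolding onorm_on_def by (rule less_cSUP_iff[OF _ onorm_on_bdd])
    then show ?thesis by auto
  qed
  moreover have "open {x :: 'k^'n^'n. a < norm (x *v w) / norm w}" for w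
    by (cases "w = 0") (auto intro!: open_Collect_less continuous_intros)
  ultimately show "{x \<in> space borel. a < onorm_on W x} \<in> sets borel" by (auto intro!: borel_open open_UN)
qed

lemma onorm_on_pos:
  assumes "W \<noteq> {0}" "invertible g" shows "onorm_on W g > 0"
proof -
  obtain w where w: "w \<in> W" "w \<noteq> 0" using assms W0 by blast
  have "g *v w \<noteq> 0"
    using w assms(2) invertible_inv(2)[of g] by (metis matrix_vector_mul_assoc matrix_vector_mul_lid matrix_vector_mult_0_right)
  then have "0 < norm (g *v w)" by simp
  also have "\<dots> \<le> onorm_on W g * norm w" by (rule onorm_on_le[OF w(1)])
  finally show ?thesis using w by (simp add: zero_less_mult_iff)
qed

lemma ln_onorm_on_mult:
  assumes "W \<noteq> {0}" "g \<in> stab W" "h \<in> stab W"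
  shows "ln (onorm_on W (g ** h)) \<le> ln (onorm_on W g) + ln (onorm_on W h)"
proof -
  have p: "onorm_on W k > 0" if "k \<in> stab W" for k using assms(1) that by (intro onorm_on_pos) (auto simp: stab_def)
  have "ln (onorm_on W (g ** h)) \<le> ln (onorm_on W g * onorm_on W h)"
    using p stab_mult[OF assms(2,3)] onorm_on_mult[OF assms(3), of g] by (intro ln_mono) auto
  then show ?thesis using p[OF assms(2)] p[OF assms(3)] by (simp add: ln_mult)
qed

lemma ln_onorm_on_le: "W \<noteq> {0} \<Longrightarrow> g \<in> stab W \<Longrightarrow> ln (onorm_on W g) \<le> log_norm g"
proof -
  assume "W \<noteq> {0}" "g \<in> stab W"
  then have g: "invertible g" "onorm_on W g > 0" by (auto simp: stab_def intro: onorm_on_pos)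
  then have "ln (onorm_on W g) \<le> ln (exp (log_norm g))" by (intro ln_mono onorm_on_le_exp) auto
  then show ?thesis by simp
qed

text \<open>
  Multiplying by \<open>g\<close> can be undone by multiplying by its inverse, which also preserves \<open>W\<close>.
\<close>

lemma ln_onorm_on_step:
  assumes "W \<noteq> {0}" "g \<in> stab W" "h \<in> stab W"
  shows "\<bar>ln (onorm_on W (g ** h)) - ln (onorm_on W h)\<bar> \<le> log_norm g"
    and "\<bar>ln (onorm_on W (h ** g)) - ln (onorm_on W h)\<bar> \<le> log_norm g"
proof -
  have g: "invertible g" using assms by (simp add: stab_def)
  have l: "ln (onorm_on W g) \<le> log_norm g" "ln (onorm_on W (matrix_inv g)) \<le> log_norm g"
    using ln_onorm_on_le[OF assms(1,2)] ln_onorm_on_le[OF assms(1) stab_inv[OF assms(2)]]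
    by (auto simp: log_norm_bounds[OF g])
  have e: "matrix_inv g ** (g ** h) = h" "(h ** g) ** matrix_inv g = h"
    by (simp_all add: matrix_mul_assoc[symmetric] invertible_inv[OF g])
      (simp add: matrix_mul_assoc invertible_inv[OF g])
  show "\<bar>ln (onorm_on W (g ** h)) - ln (onorm_on W h)\<bar> \<le> log_norm g"
    using ln_onorm_on_mult[OF assms] ln_onorm_on_mult[OF assms(1) stab_inv[OF assms(2)] stab_mult[OF assms(2,3)]] l e by auto
  show "\<bar>ln (onorm_on W (h ** g)) - ln (onorm_on W h)\<bar> \<le> log_norm g"
    using ln_onorm_on_mult[OF assms(1,3,2)] ln_onorm_on_mult[OF assms(1) stab_mult[OF assms(3,2)] stab_inv[OF assms(2)]] l e by auto
qed

end

subsection \<open>Measurability on quotient spaces\<close>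

lemma quotient_borel_closed: "{U. U \<subseteq> p ` S \<and> openin (top_of_set S) {v\<in>S. p v \<in> U}} \<subseteq> Pow (p ` S)"
  by auto

lemma space_quotient_borel [simp]: "space (quotient_borel p S) = p ` S"
  unfolding quotient_borel_def using quotient_borel_closed by (rule space_measure_of)

lemma quotient_borel_openI:
  assumes "U \<subseteq> p ` S" "openin (top_of_set S) {v\<in>S. p v \<in> U}"
  shows "U \<in> sets (quotient_borel p S)"
  unfolding quotient_borel_def using assms by (auto intro: in_measure_of)

lemma measurable_quotient_map:
  fixes p :: "'a::topological_space \<Rightarrow> 'b"
  shows "p \<in> restrict_space borel S \<rightarrow>\<^sub>M quotient_borel p S"
  unfolding quotient_borel_def
proof (rule measurable_measure_of[OF quotient_borel_closed])
  show "p \<in> space (restrict_space borel S) \<rightarrow> p ` S" by (auto simp: space_restrict_space)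
  fix U assume "U \<in> {U. U \<subseteq> p ` S \<and> openin (top_of_set S) {v\<in>S. p v \<in> U}}"
  then obtain O' where O': "open O'" "{v\<in>S. p v \<in> U} = O' \<inter> S"
    by (auto simp: openin_open Int_commute)
  have "p -` U \<inter> space (restrict_space borel S) = S \<inter> O'"
    using O'(2) by (auto simp: space_restrict_space)
  then show "p -` U \<inter> space (restrict_space borel S) \<in> sets (restrict_space borel S)"
    using O'(1) by (auto simp: sets_restrict_space)
qed

text \<open>
  The function induced on the quotient by a function that is constant on the fibres of \<open>p\<close>.
\<close>

definition lift_fun :: "('a \<Rightarrow> 'b) \<Rightarrow> 'a set \<Rightarrow> ('a \<Rightarrow> 'c) \<Rightarrow> 'b \<Rightarrow> 'c" where
  "lift_fun p S f y = f (SOME v. v \<in> S \<and> p v = y)"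

lemma lift_fun_eq:
  assumes "\<And>v v'. v \<in> S \<Longrightarrow> v' \<in> S \<Longrightarrow> p v = p v' \<Longrightarrow> f v = f v'" "v \<in> S"
  shows "lift_fun p S f (p v) = f v"
proof -
  have "(SOME u. u \<in> S \<and> p u = p v) \<in> S \<and> p (SOME u. u \<in> S \<and> p u = p v) = p v"
    by (rule someI[of _ v]) (simp add: assms)
  then show ?thesis unfolding lift_fun_def by (intro assms) auto
qed

text \<open>
  The sets \<open>O' i\<close> are charts: open unions of fibres on which \<open>f\<close> coincides with a continuous function
  \<open>f' i\<close>, except where a chart of smaller rank takes precedence. The images of the charts are open in the
  quotient, and cutting off those of smaller rank leaves finitely many measurable pieces on which
  the induced function is continuous.
\<close>

lemma lift_fun_measurable:
  fixes p :: "'a::topological_space \<Rightarrow> 'b" and f :: "'a \<Rightarrow> 'c::topological_space"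
    and rk :: "'i::finite \<Rightarrow> nat"
  assumes Y: "S' \<subseteq> S"
    and op: "\<And>i. open (O' i)" and sub: "\<And>i. O' i \<subseteq> S'"
    and sat: "\<And>i v v'. v \<in> S \<Longrightarrow> v' \<in> O' i \<Longrightarrow> p v = p v' \<Longrightarrow> v \<in> O' i"
    and ct: "\<And>i. continuous_on (O' i) (f' i)"
    and fc: "\<And>i v v'. v \<in> O' i \<Longrightarrow> v' \<in> O' i \<Longrightarrow> p v = p v' \<Longrightarrow> f' i v = f' i v'"
    and cov: "S' \<subseteq> (\<Union>i. O' i)"
    and first: "\<And>i v. v \<in> O' i \<Longrightarrow> (\<And>j. rk j < rk i \<Longrightarrow> v \<notin> O' j) \<Longrightarrow> f v = f' i v"
  shows "lift_fun p S' f \<in> borel_measurable (restrict_space (quotient_borel p S) (p ` S'))"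
proof -
  have opin: "p ` (O' i \<inter> B) \<in> sets (quotient_borel p S)"
    if "open B" "\<And>v v'. v \<in> O' i \<Longrightarrow> v' \<in> O' i \<inter> B \<Longrightarrow> p v = p v' \<Longrightarrow> v \<in> B" for i B
  proof (rule quotient_borel_openI)
    show "p ` (O' i \<inter> B) \<subseteq> p ` S" using sub Y by blast
    have "{v \<in> S. p v \<in> p ` (O' i \<inter> B)} = S \<inter> (O' i \<inter> B)"
      using sat that(2) sub Y by blast
    then show "openin (top_of_set S) {v \<in> S. p v \<in> p ` (O' i \<inter> B)}"
      using open_Int[OF op[of i] that(1)] unfolding openin_open by metis
  qed
  have set_i: "p ` O' i \<in> sets (quotient_borel p S)" for i using opin[of UNIV i] by simp
  define A where "A = (\<lambda>i. p ` O' i - (\<Union>j\<in>{j. rk j < rk i}. p ` O' j))"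
  have A: "A i \<in> sets (quotient_borel p S)" for i
    unfolding A_def by (intro sets.Diff set_i sets.finite_UN) auto
  have S'eq: "p ` S' = (\<Union>i. p ` O' i)"
  proof -
    have "S' = (\<Union>i. O' i)" using cov sub by (intro equalityI UN_least)
    then show ?thesis by (simp add: image_UN)
  qed
  have S'set: "p ` S' \<in> sets (quotient_borel p S)" unfolding S'eq by (intro sets.finite_UN set_i) auto
  have Acov: "p ` S' = (\<Union>i. A i)"
  proof (intro equalityI subsetI)
    fix y assume "y \<in> p ` S'"
    then obtain i where "y \<in> p ` O' i" unfolding S'eq by blast
    then have ex: "\<exists>k. \<exists>i. rk i = k \<and> y \<in> p ` O' i" by blast
    obtain i where i: "rk i = (LEAST k. \<exists>i. rk i = k \<and> y \<in> p ` O' i)" "y \<in> p ` O' i"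
      using LeastI_ex[OF ex] by blast
    have "y \<notin> p ` O' j" if "rk j < rk i" for j
      using not_less_Least[of "rk j" "\<lambda>k. \<exists>i. rk i = k \<and> y \<in> p ` O' i"] that i by auto
    then have "y \<in> A i" unfolding A_def using i(2) by blast
    then show "y \<in> (\<Union>i. A i)" by blast
  next
    fix y assume "y \<in> (\<Union>i. A i)"
    then show "y \<in> p ` S'" unfolding A_def S'eq by blast
  qed
  have val: "lift_fun p S' f (p v) = f' i v" if v: "v \<in> O' i" and pv: "p v \<in> A i" for i v
  proof -
    define u where "u = (SOME u. u \<in> S' \<and> p u = p v)"
    have u: "u \<in> S'" "p u = p v" using someI[of "\<lambda>u. u \<in> S' \<and> p u = p v" v] v sub by (auto simp: u_def)
    have uO: "u \<in> O' i" using sat[OF _ v u(2)] u(1) Y by blast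
    have "f u = f' i u"
    proof (rule first[OF uO])
      fix j assume "rk j < rk i"
      then show "u \<notin> O' j" using pv u(2) unfolding A_def by (metis DiffE UN_I imageI mem_Collect_eq)
    qed
    then show ?thesis using fc[OF uO v u(2)] by (simp add: lift_fun_def u_def)
  qed
  show ?thesis
  proof (rule borel_measurableI)
    fix B :: "'c set" assume B: "open B"
    have "lift_fun p S' f -` B \<inter> p ` S' = (\<Union>i. A i \<inter> p ` (O' i \<inter> {v\<in>O' i. f' i v \<in> B}))"
    proof (intro equalityI subsetI)
      fix y assume y: "y \<in> lift_fun p S' f -` B \<inter> p ` S'"
      then obtain i where i: "y \<in> A i" using Acov by blast
      then obtain v where "v \<in> O' i" "y = p v" by (auto simp: A_def)
      then show "y \<in> (\<Union>i. A i \<inter> p ` (O' i \<inter> {v\<in>O' i. f' i v \<in> B}))" using val[of v i] i y by auto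
    next
      fix y assume "y \<in> (\<Union>i. A i \<inter> p ` (O' i \<inter> {v\<in>O' i. f' i v \<in> B}))"
      then obtain i v where "y \<in> A i" "v \<in> O' i" "f' i v \<in> B" "y = p v" by auto
      then show "y \<in> lift_fun p S' f -` B \<inter> p ` S'" using val[of v i] sub by auto
    qed
    moreover have "p ` (O' i \<inter> {v\<in>O' i. f' i v \<in> B}) \<in> sets (quotient_borel p S)" for i
    proof (rule opin)
      have "open (f' i -` B \<inter> O' i)" using continuous_on_open_vimage[OF op[of i], of "f' i"] ct[of i] B by blast
      then show "open {v\<in>O' i. f' i v \<in> B}" by (simp add: vimage_def Int_def conj_commute)
      show "v \<in> {v\<in>O' i. f' i v \<in> B}" if "v \<in> O' i" "v' \<in> O' i \<inter> {v\<in>O' i. f' i v \<in> B}" "p v = p v'" for v v'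
        using fc[of v i v'] that by simp
    qed
    moreover have "(\<Union>i. A i \<inter> p ` (O' i \<inter> {v\<in>O' i. f' i v \<in> B})) \<in> sets (quotient_borel p S)"
      by (intro sets.finite_UN sets.Int A calculation(2)) auto
    ultimately have "lift_fun p S' f -` B \<inter> p ` S' \<in> sets (quotient_borel p S)" by (simp only:)
    moreover have "lift_fun p S' f -` B \<inter> p ` S' = p ` S' \<inter> (lift_fun p S' f -` B \<inter> p ` S')" by blast
    moreover have "p ` S' \<inter> p ` S = p ` S'" using Y by blast
    ultimately show "lift_fun p S' f -` B \<inter> space (restrict_space (quotient_borel p S) (p ` S'))
        \<in> sets (restrict_space (quotient_borel p S) (p ` S'))"
      unfolding space_restrict_space sets_restrict_space space_quotient_borel
      by (metis (no_types, lifting) imageI)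
  qed
qed

subsection \<open>Normalised representatives\<close>

lemma inverse_scale_cancel: "c \<noteq> 0 \<Longrightarrow> inverse (c * x) *s (c *s u) = inverse x *s (u :: 'k::field^'n)"
  by (simp add: inverse_mult_distrib)

context split_subspace
begin

text \<open>
  The position of the first nonzero entry of \<open>\<pi> v\<close>, for an arbitrary fixed order of the index type.
\<close>

definition idx :: "'k^'n \<Rightarrow> 'n" where
  "idx v = (ARG_MIN to_nat i. \<pi> v $ i \<noteq> 0)"

text \<open>
  A scalar of absolute value the quotient norm of \<open>v\<close> that depends only on \<open>v + W\<close> and is homogeneous.
  The phase \<open>sgn\<close> of an entry is what makes \<open>v / \<theta> v\<close> depend only on the line of \<open>v\<close>; over the reals it
  is a sign.
\<close>

definition \<theta> :: "'k^'n \<Rightarrow> 'k" where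
  "\<theta> v = infdist v W *\<^sub>R sgn (\<pi> v $ idx v)"

definition normal :: "'k^'n \<Rightarrow> 'k^'n" where
  "normal v = inverse (\<theta> v) *s v"

lemma idx: assumes "v \<notin> W" shows "\<pi> v $ idx v \<noteq> 0" "to_nat j < to_nat (idx v) \<Longrightarrow> \<pi> v $ j = 0"
proof -
  have "\<pi> v \<noteq> 0" using assms ker by blast
  then obtain i where "\<pi> v $ i \<noteq> 0" by (auto simp: vec_eq_iff)
  then show "\<pi> v $ idx v \<noteq> 0" unfolding idx_def by (rule arg_min_natI)
  show "to_nat j < to_nat (idx v) \<Longrightarrow> \<pi> v $ j = 0"
    unfolding idx_def using arg_min_nat_le[of "\<lambda>i. \<pi> v $ i \<noteq> 0" j to_nat] by force
qed

lemma idx_unique: assumes "\<pi> v $ i \<noteq> 0" "\<And>j. to_nat j < to_nat i \<Longrightarrow> \<pi> v $ j = 0" shows "idx v = i"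
proof -
  have "v \<notin> W" using assms(1) ker[of v] by auto
  from idx[OF this] have "\<not> to_nat (idx v) < to_nat i" "\<not> to_nat i < to_nat (idx v)" using assms by blast+
  then have "to_nat (idx v) = to_nat i" by simp
  then show ?thesis by simp
qed

lemma theta_add_W: "w \<in> W \<Longrightarrow> \<theta> (v + w) = \<theta> v"
  by (simp add: \<theta>_def idx_def pi_add_W infdist_add_W)

lemma theta_pi: "\<theta> (\<pi> v) = \<theta> v"
  using theta_add_W[OF retr, of v v] by simp

lemma theta_scale: "\<theta> (c *s v) = c * \<theta> v"
proof (cases "c = 0")
  case True then show ?thesis using W0 by (simp add: \<theta>_def)
next
  case False
  have "idx (c *s v) = idx v" using False by (simp add: idx_def pi.scale)
  moreover have "norm c *\<^sub>R sgn c = c" using False by (simp add: sgn_div_norm)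
  moreover have "(norm c * d) *\<^sub>R (sgn c * s) = (norm c *\<^sub>R sgn c) * (d *\<^sub>R s)" for d and s :: 'k
    by simp
  ultimately show ?thesis
    by (simp only: \<theta>_def infdist_scale pi.scale vector_smult_component Real_Vector_Spaces.sgn_mult)
qed

lemma norm_theta: "norm (\<theta> v) = infdist v W"
proof (cases "v \<in> W")
  case False then show ?thesis using idx(1)[OF False] by (simp add: \<theta>_def norm_sgn infdist_nonneg)
qed (simp add: \<theta>_def)

lemma theta_eq_0: "\<theta> v = 0 \<longleftrightarrow> v \<in> W"
  using norm_theta[of v] infdist_eq_0[of v] by (metis norm_eq_zero)

lemma theta_normal: "v \<notin> W \<Longrightarrow> \<theta> (normal v) = 1"
  using theta_eq_0[of v] by (simp add: normal_def theta_scale)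

lemma normal_scale: "c \<noteq> 0 \<Longrightarrow> normal (c *s v) = normal v"
  by (simp add: normal_def theta_scale)

lemma normal_notin_W: "v \<notin> W \<Longrightarrow> normal v \<notin> W"
  using theta_normal[of v] theta_eq_0[of "normal v"] by auto

lemma pi_normal: "\<pi> (normal v) = normal (\<pi> v)"
  by (simp add: normal_def pi.scale theta_pi)

lemma normal_id: "\<theta> v = 1 \<Longrightarrow> normal v = v"
  by (simp add: normal_def)

lemma infdist_normal: "v \<notin> W \<Longrightarrow> infdist (normal v) W = 1"
  using norm_theta[of "normal v"] theta_normal[of v] by simp

lemma line_normal: "v \<notin> W \<Longrightarrow> line (normal v) = line v"
  using theta_eq_0[of v] unfolding normal_def line_def by (intro vec.span_image_scale[of "{v}" "\<lambda>_. inverse (\<theta> v)", simplified]) auto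

lemma coset_eq_iff: "coset W u = coset W v \<longleftrightarrow> u - v \<in> W"
proof
  assume "coset W u = coset W v"
  moreover have "u \<in> coset W u" using W0 by (auto simp: coset_def intro!: image_eqI[of _ _ 0])
  ultimately obtain w where "w \<in> W" "u = v + w" by (auto simp: coset_def)
  then show "u - v \<in> W" by simp
next
  assume d: "u - v \<in> W"
  have "u + w \<in> coset W v" if "w \<in> W" for w
    using W_add[OF d that] by (auto simp: coset_def intro!: image_eqI[of _ _ "u - v + w"])
  moreover have "v + w \<in> coset W u" if "w \<in> W" for w
    using W_diff[OF that d] by (auto simp: coset_def intro!: image_eqI[of _ _ "w - (u - v)"])
  ultimately show "coset W u = coset W v" by (auto simp: coset_def)
qed

lemma coset_W: "coset W 0 = W" by (simp add: coset_def)

definition qline :: "'k^'n \<Rightarrow> ('k^'n) set set" where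
  "qline v = coset W ` line v"

lemma qline_eq: "qline v = range (\<lambda>a. coset W (a *s v))"
  by (auto simp: qline_def line_eq)

lemma qline_eqD:
  assumes "qline u = qline v" "u \<notin> W"
  obtains c where "c \<noteq> 0" "u - c *s v \<in> W"
proof -
  have "coset W (1 *s u) \<in> qline u" unfolding qline_eq by blast
  then obtain c where c: "coset W u = coset W (c *s v)" unfolding assms(1) by (auto simp: qline_eq)
  then have d: "u - c *s v \<in> W" by (simp add: coset_eq_iff)
  moreover have "c \<noteq> 0" using d assms(2) by auto
  ultimately show ?thesis by (rule that[rotated])
qed

lemma qline_cong: "c \<noteq> 0 \<Longrightarrow> u - c *s v \<in> W \<Longrightarrow> qline u = qline v"
proof -
  assume c: "c \<noteq> 0" and d: "u - c *s v \<in> W"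
  have "coset W (a *s u) = coset W ((a * c) *s v)" for a
    using W_scale[OF d, of a] by (simp add: coset_eq_iff vec.scale_right_diff_distrib)
  then have "qline u = range (\<lambda>a. coset W ((a * c) *s v))" by (simp add: qline_eq)
  also have "\<dots> = (\<lambda>b. coset W (b *s v)) ` range (\<lambda>a. a * c)" by auto
  also have "range (\<lambda>a. a * c) = UNIV" using c by (auto intro!: surjI[of _ "\<lambda>b. b / c"])
  finally show ?thesis by (simp add: qline_eq)
qed

lemma qline_pi: "qline (\<pi> v) = qline v"
  by (rule qline_cong[of 1]) (auto simp: retr)

lemma qline_normal: "v \<notin> W \<Longrightarrow> qline (normal v) = qline v"
  by (simp add: qline_def line_normal)

lemma proj_map_line: "proj_map W (line v) = qline v"
  by (simp add: proj_map_def qline_def)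

lemma act_line: "act g (line v) = line (g *v v)"
  by (auto simp: act_def line_eq vec.scale image_image vector_scalar_commute)

lemma act_coset: "g \<in> stab W \<Longrightarrow> act g (coset W v) = coset W (g *v v)"
proof -
  assume g: "g \<in> stab W"
  have "act g (coset W v) = (\<lambda>w. g *v v + w) ` (((*v) g) ` W)"
    by (simp add: act_def coset_def image_image matrix_vector_right_distrib)
  then show ?thesis by (simp add: stab_image[OF g] coset_def)
qed

lemma act_qline: "g \<in> stab W \<Longrightarrow> act_quot g (qline v) = qline (g *v v)"
  unfolding act_quot_def qline_eq image_image
  by (simp add: act_coset vector_scalar_commute)

text \<open>
  Measurable sections: \<open>\<sigma>\<close> picks a normalised vector in the complement of \<open>W\<close> for each point of \<open>P(V/W)\<close>,
  and \<open>\<tau>\<close> the normalised vector on each line outside \<open>W\<close>.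
\<close>

definition \<sigma> :: "('k^'n) set set \<Rightarrow> 'k^'n" where
  "\<sigma> = lift_fun qline (UNIV - W) (\<lambda>v. normal (\<pi> v))"

definition \<tau> :: "('k^'n) set \<Rightarrow> 'k^'n" where
  "\<tau> = lift_fun line (UNIV - W) normal"

lemma sigma_qline: "v \<notin> W \<Longrightarrow> \<sigma> (qline v) = normal (\<pi> v)"
  unfolding \<sigma>_def
proof (rule lift_fun_eq)
  fix v v' assume v: "v \<in> UNIV - W" "v' \<in> UNIV - W" "qline v = qline v'"
  then obtain c where c: "c \<noteq> 0" "v - c *s v' \<in> W" using qline_eqD by blast
  then have "\<pi> v = c *s \<pi> v'" using pi_eq_iff[of v "c *s v'"] by (simp add: pi.scale)
  then show "normal (\<pi> v) = normal (\<pi> v')" using c by (simp add: normal_scale)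
qed auto

lemma line_eqD:
  assumes "line u = line v" "u \<noteq> 0"
  obtains c where "c \<noteq> 0" "u = c *s v"
proof -
  have "1 *s u \<in> line u" unfolding line_eq by blast
  then obtain c where c: "u = c *s v" unfolding assms(1) by (auto simp: line_eq)
  then show ?thesis using assms(2) by (intro that[of c]) auto
qed

lemma tau_line: "v \<notin> W \<Longrightarrow> \<tau> (line v) = normal v"
  unfolding \<tau>_def
proof (rule lift_fun_eq)
  fix v v' assume v: "v \<in> UNIV - W" "v' \<in> UNIV - W" "line v = line v'"
  then have "v \<noteq> 0" using W0 by auto
  with v(3) obtain c where "c \<noteq> 0" "v = c *s v'" by (rule line_eqD)
  then show "normal v = normal v'" by (simp add: normal_scale)
qed auto

lemma space_proj_quot: "space (proj_quot W) = qline ` (UNIV - W)"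
  by (simp add: proj_quot_def qline_def)

lemma qline_in_space: "v \<notin> W \<Longrightarrow> qline v \<in> space (proj_quot W)"
  by (auto simp: space_proj_quot)

lemma space_proj_diff: "space (proj_diff W) = line ` (UNIV - W)"
proof -
  have "space (proj_diff W) = (lines_in UNIV - lines_in W) \<inter> line ` (UNIV - {0})"
    by (simp add: proj_diff_def space_restrict_space proj_space_def Int_commute)
  also have "\<dots> = line ` (UNIV - {0}) - line ` (W - {0})" by (auto simp: lines_in_def)
  also have "\<dots> = line ` (UNIV - W)"
  proof (intro equalityI subsetI)
    fix l assume "l \<in> line ` (UNIV - W)"
    then obtain v where v: "v \<notin> W" "l = line v" by auto
    have "line v \<notin> line ` (W - {0})"
    proof
      assume "line v \<in> line ` (W - {0})"
      then obtain w where "w \<in> W" "line v = line w" by auto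
      moreover have "v \<noteq> 0" using v W0 by auto
      ultimately show False using v(1) by (metis line_eqD W_scale)
    qed
    then show "l \<in> line ` (UNIV - {0}) - line ` (W - {0})" using v W0 by auto
  qed auto
  finally show ?thesis .
qed

lemma line_in_space: "v \<notin> W \<Longrightarrow> line v \<in> space (proj_diff W)"
  by (auto simp: space_proj_diff)

lemma qline_measurable: "qline \<in> restrict_space borel (UNIV - W) \<rightarrow>\<^sub>M proj_quot W"
  unfolding proj_quot_def qline_def[abs_def] by (rule measurable_quotient_map)

lemma line_measurable: "line \<in> restrict_space borel (UNIV - W) \<rightarrow>\<^sub>M proj_diff W"
  unfolding proj_diff_def
proof (rule measurable_restrict_space2)
  show "line \<in> space (restrict_space borel (UNIV - W)) \<rightarrow> lines_in UNIV - lines_in W"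
    using line_in_space by (auto simp: space_restrict_space proj_diff_def)
  have "line \<in> restrict_space borel (UNIV - {0}) \<rightarrow>\<^sub>M proj_space"
    unfolding proj_space_def by (rule measurable_quotient_map)
  then have "line \<in> restrict_space (restrict_space borel (UNIV - {0})) (UNIV - W) \<rightarrow>\<^sub>M proj_space"
    by (rule measurable_restrict_space1)
  moreover have "(UNIV - {0}) \<inter> (UNIV - W) = UNIV - W" using W0 by auto
  ultimately show "line \<in> restrict_space borel (UNIV - W) \<rightarrow>\<^sub>M proj_space"
    by (simp add: restrict_restrict_space)
qed

lemma qline_measurable' [measurable (raw)]:
  assumes "f \<in> borel_measurable M" "\<And>x. x \<in> space M \<Longrightarrow> f x \<notin> W"
  shows "(\<lambda>x. qline (f x)) \<in> M \<rightarrow>\<^sub>M proj_quot W"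
  by (rule measurable_compose[OF _ qline_measurable]) (use assms in \<open>auto intro!: measurable_restrict_space2\<close>)

lemma line_measurable' [measurable (raw)]:
  assumes "f \<in> borel_measurable M" "\<And>x. x \<in> space M \<Longrightarrow> f x \<notin> W"
  shows "(\<lambda>x. line (f x)) \<in> M \<rightarrow>\<^sub>M proj_diff W"
  by (rule measurable_compose[OF _ line_measurable]) (use assms in \<open>auto intro!: measurable_restrict_space2\<close>)

lemma nth_nonzero_notin: "\<pi> x $ i \<noteq> 0 \<Longrightarrow> x \<notin> W"
  using ker[of x] by auto

lemma open_chart: "open {v. \<pi> v $ i \<noteq> 0}"
  by (intro open_Collect_neq continuous_intros)

lemma continuous_chart: "continuous_on {v. \<pi> v $ i \<noteq> 0} (\<lambda>v. inverse (infdist v W *\<^sub>R sgn (\<pi> v $ i)))"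
proof -
  have "infdist v W \<noteq> 0" if "\<pi> v $ i \<noteq> 0" for v
    using that ker[of v] infdist_eq_0[of v] by auto
  then show ?thesis
    by (intro continuous_intros) (auto simp: sgn_zero_iff)
qed

lemma component_measurable [measurable]: "(\<lambda>v. \<pi> v $ i) \<in> borel_measurable borel"
  by (intro borel_measurable_continuous_onI continuous_intros)

lemma sigma_measurable [measurable]: "\<sigma> \<in> borel_measurable (proj_quot W)"
proof -
  have "lift_fun (\<lambda>v. coset W ` line v) (UNIV - W) (\<lambda>v. normal (\<pi> v)) \<in> borel_measurable
    (restrict_space (quotient_borel (\<lambda>v. coset W ` line v) (UNIV - W)) ((\<lambda>v. coset W ` line v) ` (UNIV - W)))"
    unfolding qline_def[symmetric]
  proof (rule lift_fun_measurable[where O'="\<lambda>i. {v. \<pi> v $ i \<noteq> 0}" and rk=to_nat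
        and f'="\<lambda>i v. inverse (infdist v W *\<^sub>R sgn (\<pi> v $ i)) *s \<pi> v"])
    fix i v v' assume "v \<in> UNIV - W" "v' \<in> {v. \<pi> v $ i \<noteq> 0}" "qline v = qline v'"
    then obtain c where c: "c \<noteq> 0" "v - c *s v' \<in> W" using qline_eqD by blast
    then have "\<pi> v = c *s \<pi> v'" using pi_eq_iff[of v "c *s v'"] by (simp add: pi.scale)
    then show "v \<in> {v. \<pi> v $ i \<noteq> 0}" using c \<open>v' \<in> _\<close> by simp
  next
    fix i v v' assume v: "v \<in> {v. \<pi> v $ i \<noteq> 0}" "v' \<in> {v. \<pi> v $ i \<noteq> 0}" "qline v = qline v'"
    have "v \<notin> W" using v(1) ker[of v] by auto
    then obtain c where c: "c \<noteq> 0" "v - c *s v' \<in> W" using qline_eqD v(3) by blast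
    then have e: "\<pi> v = c *s \<pi> v'" using pi_eq_iff[of v "c *s v'"] by (simp add: pi.scale)
    have d: "infdist v W = norm c * infdist v' W"
      using infdist_add_W[OF c(2), of "c *s v'"] by (simp add: infdist_scale)
    have sc: "norm c *\<^sub>R sgn c = c" using c by (simp add: sgn_div_norm)
    have "infdist v W *\<^sub>R sgn (\<pi> v $ i) = (norm c *\<^sub>R sgn c) * (infdist v' W *\<^sub>R sgn (\<pi> v' $ i))"
      by (simp add: d e Real_Vector_Spaces.sgn_mult scaleR_conv_of_real algebra_simps)
    then have t: "infdist v W *\<^sub>R sgn (\<pi> v $ i) = c * (infdist v' W *\<^sub>R sgn (\<pi> v' $ i))"
      unfolding sc .
    show "inverse (infdist v W *\<^sub>R sgn (\<pi> v $ i)) *s \<pi> v = inverse (infdist v' W *\<^sub>R sgn (\<pi> v' $ i)) *s \<pi> v'"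
      unfolding t by (subst e) (rule inverse_scale_cancel[OF c(1)])
  next
    fix i v assume "v \<in> {v. \<pi> v $ i \<noteq> 0}" "\<And>j. to_nat j < to_nat i \<Longrightarrow> v \<notin> {v. \<pi> v $ j \<noteq> 0}"
    then have "idx v = i" by (intro idx_unique) auto
    then show "normal (\<pi> v) = inverse (infdist v W *\<^sub>R sgn (\<pi> v $ i)) *s \<pi> v"
      by (simp add: normal_def theta_pi) (simp add: \<theta>_def)
  next
    show "UNIV - W \<subseteq> (\<Union>i. {v. \<pi> v $ i \<noteq> 0})" using idx(1) by blast
  qed (use nth_nonzero_notin in \<open>auto intro!: open_chart continuous_intros continuous_chart\<close>)
  then have "\<sigma> \<in> borel_measurable (restrict_space (proj_quot W) (space (proj_quot W)))"
    by (simp only: \<sigma>_def proj_quot_def qline_def[abs_def] space_quotient_borel)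
  moreover have eq: "sets (restrict_space (proj_quot W) (space (proj_quot W))) = sets (proj_quot W)"
  proof -
    have "space (proj_quot W) \<inter> B = B" if "B \<in> sets (proj_quot W)" for B using sets.sets_into_space[OF that] by blast
    then show ?thesis unfolding sets_restrict_space by simp
  qed
  ultimately show ?thesis by (simp only: measurable_cong_sets[OF eq refl])
qed

lemma tau_measurable [measurable]: "\<tau> \<in> borel_measurable (proj_diff W)"
proof -
  have m: "lift_fun line (UNIV - W) normal \<in> borel_measurable
    (restrict_space (quotient_borel line (UNIV - {0})) (line ` (UNIV - W)))"
  proof (rule lift_fun_measurable[where O'="\<lambda>i. {v. \<pi> v $ i \<noteq> 0}" and rk=to_nat
        and f'="\<lambda>i v. inverse (infdist v W *\<^sub>R sgn (\<pi> v $ i)) *s v"])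
    fix i v v' assume "v \<in> UNIV - {0}" "v' \<in> {v. \<pi> v $ i \<noteq> 0}" "line v = line v'"
    then obtain c where c: "c \<noteq> 0" "v = c *s v'" using line_eqD by blast
    then show "v \<in> {v. \<pi> v $ i \<noteq> 0}" using c \<open>v' \<in> _\<close> by (simp add: pi.scale)
  next
    fix i v v' assume v: "v \<in> {v. \<pi> v $ i \<noteq> 0}" "v' \<in> {v. \<pi> v $ i \<noteq> 0}" "line v = line v'"
    have "v \<noteq> 0" using v(1) by auto
    then obtain c where c: "c \<noteq> 0" "v = c *s v'" using line_eqD v(3) by blast
    have sc: "norm c *\<^sub>R sgn c = c" using c by (simp add: sgn_div_norm)
    have "infdist v W *\<^sub>R sgn (\<pi> v $ i) = (norm c *\<^sub>R sgn c) * (infdist v' W *\<^sub>R sgn (\<pi> v' $ i))"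
      by (simp add: infdist_scale c pi.scale Real_Vector_Spaces.sgn_mult scaleR_conv_of_real algebra_simps)
    then have t: "infdist v W *\<^sub>R sgn (\<pi> v $ i) = c * (infdist v' W *\<^sub>R sgn (\<pi> v' $ i))"
      unfolding sc .
    show "inverse (infdist v W *\<^sub>R sgn (\<pi> v $ i)) *s v = inverse (infdist v' W *\<^sub>R sgn (\<pi> v' $ i)) *s v'"
      unfolding t by (subst c(2)) (rule inverse_scale_cancel[OF c(1)])
  next
    fix i v assume "v \<in> {v. \<pi> v $ i \<noteq> 0}" "\<And>j. to_nat j < to_nat i \<Longrightarrow> v \<notin> {v. \<pi> v $ j \<noteq> 0}"
    then have "idx v = i" by (intro idx_unique) auto
    then show "normal v = inverse (infdist v W *\<^sub>R sgn (\<pi> v $ i)) *s v"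
      by (simp add: normal_def) (simp add: \<theta>_def)
  next
    show "UNIV - W \<subseteq> (\<Union>i. {v. \<pi> v $ i \<noteq> 0})" using idx(1) by blast
  qed (use nth_nonzero_notin W0 in \<open>auto intro!: open_chart continuous_intros continuous_chart\<close>)
  have eq: "sets (restrict_space proj_space (line ` (UNIV - W))) = sets (proj_diff W)"
  proof -
    have "line ` (UNIV - W) \<inter> B = (lines_in UNIV - lines_in W) \<inter> B" if "B \<in> sets proj_space" for B
      using sets.sets_into_space[OF that] unfolding space_proj_diff[symmetric]
      by (auto simp: proj_diff_def space_restrict_space)
    then show ?thesis unfolding proj_diff_def sets_restrict_space by (rule image_cong[OF refl])
  qed
  have "lift_fun line (UNIV - W) normal \<in> borel_measurable (restrict_space proj_space (line ` (UNIV - W)))"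
    using m by (simp only: proj_space_def)
  then show ?thesis unfolding measurable_cong_sets[OF eq refl] \<tau>_def .
qed

lemma theta_measurable [measurable]: "\<theta> \<in> borel_measurable borel"
proof -
  have idx_set: "{v. idx v = i \<and> v \<notin> W} \<in> sets borel" for i
  proof -
    have "{v. idx v = i \<and> v \<notin> W} = {v \<in> space borel. \<pi> v $ i \<noteq> 0 \<and> (\<forall>j. to_nat j < to_nat i \<longrightarrow> \<pi> v $ j = 0)}"
    proof (intro equalityI subsetI)
      fix v assume "v \<in> {v. idx v = i \<and> v \<notin> W}"
      then show "v \<in> {v \<in> space borel. \<pi> v $ i \<noteq> 0 \<and> (\<forall>j. to_nat j < to_nat i \<longrightarrow> \<pi> v $ j = 0)}"
        using idx[of v] by auto
    next
      fix v assume v: "v \<in> {v \<in> space borel. \<pi> v $ i \<noteq> 0 \<and> (\<forall>j. to_nat j < to_nat i \<longrightarrow> \<pi> v $ j = 0)}"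
      then have "v \<notin> W" using ker[of v] by auto
      then show "v \<in> {v. idx v = i \<and> v \<notin> W}" using idx_unique[of v i] v by auto
    qed
    also have "\<dots> = {v. \<pi> v $ i \<noteq> 0} \<inter> (\<Inter>j\<in>{j. to_nat j < to_nat i}. - {v. \<pi> v $ j \<noteq> 0}) \<inter> space borel"
      by auto
    also have "\<dots> \<in> sets borel"
      using open_chart by (cases "{j. to_nat j < to_nat i} = {}") (auto intro!: sets.Int sets.finite_INT borel_closed closed_Compl)
    finally show ?thesis .
  qed
  have "\<theta> v = (\<Sum>i\<in>UNIV. if idx v = i \<and> v \<notin> W then infdist v W *\<^sub>R sgn (\<pi> v $ i) else 0)" for v
    by (cases "v \<in> W") (simp_all add: \<theta>_def)
  then have "\<theta> = (\<lambda>v. \<Sum>i\<in>UNIV. if idx v = i \<and> v \<notin> W then infdist v W *\<^sub>R sgn (\<pi> v $ i) else 0)" by blast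
  also have "\<dots> \<in> borel_measurable borel"
  proof -
    have "(\<lambda>v. sgn (\<pi> v $ i)) \<in> borel_measurable borel" for i
      unfolding sgn_div_norm by (intro borel_measurable_scaleR borel_measurable_inverse component_measurable measurable_compose[OF component_measurable borel_measurable_norm])
    moreover have "(\<lambda>v. infdist v W) \<in> borel_measurable borel"
      by (intro borel_measurable_continuous_onI continuous_intros)
    ultimately show ?thesis
      by (intro borel_measurable_sum measurable_If borel_measurable_scaleR) (auto simp: pred_def[symmetric] idx_set)
  qed
  finally show ?thesis .
qed

lemma normal_measurable [measurable]: "normal \<in> borel_measurable borel"
  unfolding normal_def[abs_def] by measurable

end

section \<open>Random walks and their stationary extensions\<close>

lemma emeasure_distr_indicator:
  assumes f: "f \<in> M \<rightarrow>\<^sub>M N" and A: "A \<in> sets N"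
  shows "emeasure (distr M N f) A = (\<integral>\<^sup>+x. indicator A (f x) \<partial>M)"
proof -
  have "emeasure (distr M N f) A = (\<integral>\<^sup>+y. indicator A y \<partial>distr M N f)" using A by simp
  also have "\<dots> = (\<integral>\<^sup>+x. indicator A (f x) \<partial>M)" using f A by (intro nn_integral_distr) auto
  finally show ?thesis .
qed

text \<open>
  The data of the theorem without the stationary measure. Invariance of \<open>W\<close> enters as \<open>AE_stab\<close>.
\<close>

locale mu_space = split_subspace W \<pi> for W :: "('k::{real_normed_field,euclidean_space}^'n) set" and \<pi> +
  fixes \<mu> :: "('k^'n^'n) measure"
  assumes prob_mu: "prob_space \<mu>" and sets_mu: "sets \<mu> = sets GL_borel"
    and AE_stab: "AE g in \<mu>. g \<in> stab W" and int_log_norm: "integrable \<mu> log_norm"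
begin

sublocale mu: prob_space \<mu> by (rule prob_mu)

lemma space_mu: "space \<mu> = {g. invertible g}"
  using sets_eq_imp_space_eq[OF sets_mu] by (simp add: GL_borel_def space_restrict_space)

lemma id_mu_borel: "(\<lambda>g. g) \<in> \<mu> \<rightarrow>\<^sub>M borel"
  unfolding measurable_cong_sets[OF sets_mu refl] GL_borel_def
  by (rule measurable_restrict_space1) simp

lemma measurable_to_mu:
  assumes "f \<in> borel_measurable M" "\<And>x. x \<in> space M \<Longrightarrow> invertible (f x)"
  shows "f \<in> M \<rightarrow>\<^sub>M \<mu>"
  unfolding measurable_cong_sets[OF refl sets_mu] GL_borel_def
  by (rule measurable_restrict_space2) (use assms in auto)

lemma measurable_from_mu: "f \<in> M \<rightarrow>\<^sub>M \<mu> \<Longrightarrow> f \<in> M \<rightarrow>\<^sub>M borel"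
  using measurable_compose[OF _ id_mu_borel] by auto

lemma closed_preserve: "closed {g :: 'k^'n^'n. \<forall>w\<in>W. g *v w \<in> W}"
proof -
  have "closed {g :: 'k^'n^'n. g *v w \<in> W}" for w
  proof -
    have "closed ((\<lambda>g :: 'k^'n^'n. g *v w) -` W)" by (intro closed_vimage closed_W continuous_intros)
    then show ?thesis by (simp add: vimage_def)
  qed
  then have "closed (\<Inter>w\<in>W. {g :: 'k^'n^'n. g *v w \<in> W})" by blast
  moreover have "(\<Inter>w\<in>W. {g :: 'k^'n^'n. g *v w \<in> W}) = {g. \<forall>w\<in>W. g *v w \<in> W}" by auto
  ultimately show ?thesis by simp
qed

lemma stab_sets [measurable]: "stab W \<in> sets \<mu>"
proof -
  have "stab W = (\<lambda>g. g) -` {g. \<forall>w\<in>W. g *v w \<in> W} \<inter> space \<mu>" by (auto simp: stab_def space_mu)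
  also have "\<dots> \<in> sets \<mu>" by (rule measurable_sets[OF id_mu_borel borel_closed[OF closed_preserve]])
  finally show ?thesis .
qed

text \<open>Replacing the null set of matrices that do not preserve \<open>W\<close> by the identity.\<close>

definition retract :: "'k^'n^'n \<Rightarrow> 'k^'n^'n" where
  "retract g = (if g \<in> stab W then g else mat 1)"

lemma retract_stab: "retract g \<in> stab W" by (simp add: retract_def stab_one)
lemma retract_id: "g \<in> stab W \<Longrightarrow> retract g = g" by (simp add: retract_def)
lemma AE_retract: "AE g in \<mu>. retract g = g" using AE_stab by eventually_elim (simp add: retract_id)

lemma retract_borel [measurable]: "retract \<in> \<mu> \<rightarrow>\<^sub>M borel"
proof -
  have "{g \<in> space \<mu>. g \<in> stab W} \<in> sets \<mu>"
    using sets.sets_into_space[OF stab_sets] stab_sets by (simp add: Collect_conj_eq Int_absorb1)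
  then show ?thesis unfolding retract_def[abs_def] by (intro measurable_If id_mu_borel measurable_const) auto
qed

lemma retract_mu: "retract \<in> \<mu> \<rightarrow>\<^sub>M \<mu>"
  by (rule measurable_to_mu[OF retract_borel]) (use retract_stab in \<open>auto simp: stab_def\<close>)

text \<open>
  The law of a product of \<open>n\<close> independent matrices, as a measure on all matrices.
\<close>

primrec conv_pow :: "nat \<Rightarrow> ('k^'n^'n) measure" where
  "conv_pow 0 = return borel (mat 1)"
| "conv_pow (Suc n) = distr (\<mu> \<Otimes>\<^sub>M conv_pow n) borel (\<lambda>(g, h). retract g ** h)"

lemma sets_conv_pow [measurable_cong, simp]: "sets (conv_pow n) = sets borel"
  by (cases n) auto

lemma step_measurable [measurable]: "(\<lambda>(g, h). retract g ** h) \<in> \<mu> \<Otimes>\<^sub>M (borel :: ('k^'n^'n) measure) \<rightarrow>\<^sub>M borel"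
  unfolding split_beta' by (intro measurable_mm measurable_compose[OF measurable_fst retract_borel] measurable_snd)

lemma prob_conv_pow: "prob_space (conv_pow n)"
proof (induction n)
  case (Suc n)
  interpret c: prob_space "conv_pow n" by fact
  interpret p: pair_prob_space \<mu> "conv_pow n" ..
  have "(\<lambda>(g, h). retract g ** h) \<in> \<mu> \<Otimes>\<^sub>M conv_pow n \<rightarrow>\<^sub>M borel" by measurable
  then show ?case unfolding conv_pow.simps by (rule p.prob_space_distr)
qed (auto intro: prob_space_return)

text \<open>
  The two orders of integration correspond to adding a factor at either end of the sequence of
  independent matrices; they serve the products \<open>bwd\<close> and \<open>fwd\<close> below.
\<close>

lemma nn_conv_pow_Suc:
  assumes [measurable]: "h \<in> borel_measurable borel"
  shows "(\<integral>\<^sup>+x. h x \<partial>conv_pow (Suc n)) = (\<integral>\<^sup>+g. \<integral>\<^sup>+x. h (retract g ** x) \<partial>conv_pow n \<partial>\<mu>)"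
    and "(\<integral>\<^sup>+x. h x \<partial>conv_pow (Suc n)) = (\<integral>\<^sup>+x. \<integral>\<^sup>+g. h (retract g ** x) \<partial>\<mu> \<partial>conv_pow n)"
proof -
  interpret c: prob_space "conv_pow n" by (rule prob_conv_pow)
  interpret p: pair_prob_space \<mu> "conv_pow n" ..
  have m: "(\<lambda>(g, h). retract g ** h) \<in> \<mu> \<Otimes>\<^sub>M conv_pow n \<rightarrow>\<^sub>M borel" by measurable
  have m2: "(\<lambda>(g, x). h (retract g ** x)) \<in> borel_measurable (\<mu> \<Otimes>\<^sub>M conv_pow n)" by measurable
  have "(\<integral>\<^sup>+x. h x \<partial>conv_pow (Suc n)) = (\<integral>\<^sup>+p. h ((\<lambda>(g, h). retract g ** h) p) \<partial>(\<mu> \<Otimes>\<^sub>M conv_pow n))"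
    unfolding conv_pow.simps by (rule nn_integral_distr[OF m]) measurable
  also have "\<dots> = (\<integral>\<^sup>+p. (\<lambda>(g, x). h (retract g ** x)) p \<partial>(\<mu> \<Otimes>\<^sub>M conv_pow n))"
    by (simp add: split_beta)
  also have "\<dots> = (\<integral>\<^sup>+g. \<integral>\<^sup>+x. h (retract g ** x) \<partial>conv_pow n \<partial>\<mu>)"
    using c.nn_integral_fst[OF m2] by simp
  finally show 1: "(\<integral>\<^sup>+x. h x \<partial>conv_pow (Suc n)) = (\<integral>\<^sup>+g. \<integral>\<^sup>+x. h (retract g ** x) \<partial>conv_pow n \<partial>\<mu>)" .
  show "(\<integral>\<^sup>+x. h x \<partial>conv_pow (Suc n)) = (\<integral>\<^sup>+x. \<integral>\<^sup>+g. h (retract g ** x) \<partial>\<mu> \<partial>conv_pow n)"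
    unfolding 1 by (rule p.Fubini'[OF m2, symmetric])
qed

end

text \<open>
  An abstract source of the walk. By \<open>law\<close>, the matrix \<open>\<gamma>\<close> has law \<open>\<mu>\<close> and is independent of \<open>T\<close>, which
  preserves \<open>P\<close>; hence \<open>\<gamma>, \<gamma> \<circ> T, \<gamma> \<circ> T\<^sup>2, \<dots>\<close> are independent. In the space of all sequences of
  matrices with the shift, these are the steps \<open>X\<^sub>1, X\<^sub>2, \<dots>\<close> of the walk. In a stationary extension
  they are the steps that led to the present, in reverse order.
\<close>

locale walk_system = mu_space W \<pi> \<mu> for W :: "('k::{real_normed_field,euclidean_space}^'n) set" and \<pi> \<mu> +
  fixes P :: "'w measure" and T :: "'w \<Rightarrow> 'w" and \<gamma> :: "'w \<Rightarrow> 'k^'n^'n"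
  assumes prob_P: "prob_space P" and T_meas [measurable]: "T \<in> P \<rightarrow>\<^sub>M P"
    and gamma_mu [measurable]: "\<gamma> \<in> P \<rightarrow>\<^sub>M \<mu>"
    and gamma_stab: "\<And>x. x \<in> space P \<Longrightarrow> \<gamma> x \<in> stab W"
    and law: "\<And>h. h \<in> borel_measurable (\<mu> \<Otimes>\<^sub>M P) \<Longrightarrow>
        (\<integral>\<^sup>+x. h (\<gamma> x, T x) \<partial>P) = (\<integral>\<^sup>+g. \<integral>\<^sup>+x. h (g, x) \<partial>P \<partial>\<mu>)"
begin

sublocale P: prob_space P by (rule prob_P)

lemma gamma_borel [measurable]: "\<gamma> \<in> P \<rightarrow>\<^sub>M borel" by (rule measurable_from_mu[OF gamma_mu])

sublocale measure_preserving P T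
proof
  show "T \<in> P \<rightarrow>\<^sub>M P" by (rule T_meas)
  show "distr P P T = P"
  proof (rule measure_eqI)
    fix A assume "A \<in> sets (distr P P T)"
    then have A [measurable]: "A \<in> sets P" by simp
    have "emeasure (distr P P T) A = (\<integral>\<^sup>+x. indicator A (T x) \<partial>P)"
      by (rule emeasure_distr_indicator) measurable
    also have "\<dots> = (\<integral>\<^sup>+g. \<integral>\<^sup>+x. indicator A x \<partial>P \<partial>\<mu>)"
      using law[of "\<lambda>p. indicator A (snd p)"] by simp
    also have "\<dots> = emeasure P A" by (simp add: mu.emeasure_space_1)
    finally show "emeasure (distr P P T) A = emeasure P A" .
  qed simp
qed

lemma law_distr: "distr P (\<mu> \<Otimes>\<^sub>M P) (\<lambda>x. (\<gamma> x, T x)) = \<mu> \<Otimes>\<^sub>M P"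
proof (rule measure_eqI)
  fix A assume "A \<in> sets (distr P (\<mu> \<Otimes>\<^sub>M P) (\<lambda>x. (\<gamma> x, T x)))"
  then have A [measurable]: "A \<in> sets (\<mu> \<Otimes>\<^sub>M P)" by simp
  have "emeasure (distr P (\<mu> \<Otimes>\<^sub>M P) (\<lambda>x. (\<gamma> x, T x))) A = (\<integral>\<^sup>+x. indicator A (\<gamma> x, T x) \<partial>P)"
    by (rule emeasure_distr_indicator) measurable
  also have "\<dots> = (\<integral>\<^sup>+g. \<integral>\<^sup>+x. indicator A (g, x) \<partial>P \<partial>\<mu>)" by (rule law) measurable
  also have "\<dots> = emeasure (\<mu> \<Otimes>\<^sub>M P) A" by (simp add: P.emeasure_pair_measure)
  finally show "emeasure (distr P (\<mu> \<Otimes>\<^sub>M P) (\<lambda>x. (\<gamma> x, T x))) A = emeasure (\<mu> \<Otimes>\<^sub>M P) A" .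
qed simp

lemma distr_gamma: "distr P \<mu> \<gamma> = \<mu>"
proof (rule measure_eqI)
  fix A assume "A \<in> sets (distr P \<mu> \<gamma>)"
  then have A [measurable]: "A \<in> sets \<mu>" by simp
  have "emeasure (distr P \<mu> \<gamma>) A = (\<integral>\<^sup>+x. indicator A (\<gamma> x) \<partial>P)"
    by (rule emeasure_distr_indicator) measurable
  also have "\<dots> = (\<integral>\<^sup>+g. \<integral>\<^sup>+x. indicator A g \<partial>P \<partial>\<mu>)"
    using law[of "\<lambda>p. indicator A (fst p)"] by simp
  also have "\<dots> = emeasure \<mu> A" by (simp add: P.emeasure_space_1)
  finally show "emeasure (distr P \<mu> \<gamma>) A = emeasure \<mu> A" .
qed simp

lemma integrable_log_gamma: "integrable P (\<lambda>x. log_norm (\<gamma> x))"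
proof -
  have "integrable (distr P \<mu> \<gamma>) log_norm" by (simp add: distr_gamma int_log_norm)
  then show ?thesis by (rule integrable_distr[OF gamma_mu])
qed

text \<open>
  With \<open>g\<^sub>i = \<gamma> \<circ> T\<^sup>i\<^sup>-\<^sup>1\<close>, the products \<open>bwd n = g\<^sub>1 \<cdots> g\<^sub>n\<close> and \<open>fwd n = g\<^sub>n \<cdots> g\<^sub>1\<close>. The second one is
  the walk of the definition of the exponent, the first one acts along a past trajectory.
\<close>

primrec bwd :: "nat \<Rightarrow> 'w \<Rightarrow> 'k^'n^'n" where
  "bwd 0 x = mat 1"
| "bwd (Suc n) x = \<gamma> x ** bwd n (T x)"

primrec fwd :: "nat \<Rightarrow> 'w \<Rightarrow> 'k^'n^'n" where
  "fwd 0 x = mat 1"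
| "fwd (Suc n) x = \<gamma> ((T ^^ n) x) ** fwd n x"

lemma bwd_add: "bwd (n + m) x = bwd n x ** bwd m ((T ^^ n) x)"
  by (induction n arbitrary: x) (simp_all add: matrix_mul_assoc funpow_swap1)

lemma fwd_add: "fwd (n + m) x = fwd m ((T ^^ n) x) ** fwd n x"
proof (induction m)
  case (Suc m)
  have "(T ^^ (n + m)) x = (T ^^ m) ((T ^^ n) x)" by (metis add.commute comp_apply funpow_add)
  then show ?case using Suc by (simp add: matrix_mul_assoc)
qed simp

lemma bwd_stab: "x \<in> space P \<Longrightarrow> bwd n x \<in> stab W"
  by (induction n arbitrary: x) (auto simp: stab_one T_space intro!: stab_mult gamma_stab)

lemma fwd_stab: "x \<in> space P \<Longrightarrow> fwd n x \<in> stab W"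
  by (induction n) (auto simp: stab_one iter_space intro!: stab_mult gamma_stab)

lemma bwd_measurable [measurable]: "bwd n \<in> P \<rightarrow>\<^sub>M borel"
proof (induction n)
  case 0 have "bwd 0 = (\<lambda>x. mat 1)" by (simp add: fun_eq_iff) then show ?case by simp
next
  case (Suc n)
  have "bwd (Suc n) = (\<lambda>x. \<gamma> x ** bwd n (T x))" by (simp add: fun_eq_iff)
  also have "\<dots> \<in> P \<rightarrow>\<^sub>M borel" using measurable_compose[OF T_meas Suc] by measurable
  finally show ?case .
qed

lemma fwd_measurable [measurable]: "fwd n \<in> P \<rightarrow>\<^sub>M borel"
proof (induction n)
  case 0 have "fwd 0 = (\<lambda>x. mat 1)" by (simp add: fun_eq_iff) then show ?case by simp
next
  case (Suc n)
  have "fwd (Suc n) = (\<lambda>x. \<gamma> ((T ^^ n) x) ** fwd n x)" by (simp add: fun_eq_iff)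
  also have "\<dots> \<in> P \<rightarrow>\<^sub>M borel" using Suc by measurable
  finally show ?case .
qed

lemma law_retract:
  assumes h [measurable]: "h \<in> borel_measurable (\<mu> \<Otimes>\<^sub>M P)"
  shows "(\<integral>\<^sup>+x. h (\<gamma> x, T x) \<partial>P) = (\<integral>\<^sup>+g. \<integral>\<^sup>+x. h (retract g, x) \<partial>P \<partial>\<mu>)"
proof -
  have "(\<integral>\<^sup>+g. \<integral>\<^sup>+x. h (g, x) \<partial>P \<partial>\<mu>) = (\<integral>\<^sup>+g. \<integral>\<^sup>+x. h (retract g, x) \<partial>P \<partial>\<mu>)"
    using AE_retract by (intro nn_integral_cong_AE) auto
  then show ?thesis using law[OF h] by simp
qed

lemma law_bwd:
  assumes h: "h \<in> borel_measurable (borel \<Otimes>\<^sub>M P)"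
  shows "(\<integral>\<^sup>+x. h (bwd n x, (T ^^ n) x) \<partial>P) = (\<integral>\<^sup>+g. \<integral>\<^sup>+x. h (g, x) \<partial>P \<partial>conv_pow n)"
  using h
proof (induction n arbitrary: h)
  case 0
  note [measurable] = 0
  show ?case by (subst conv_pow.simps, subst nn_integral_return) auto
next
  case (Suc n)
  note [measurable] = Suc.prems
  have "(\<integral>\<^sup>+x. h (bwd (Suc n) x, (T ^^ Suc n) x) \<partial>P) =
      (\<integral>\<^sup>+x. (\<lambda>(g, y). h (g ** bwd n y, (T ^^ n) y)) (\<gamma> x, T x) \<partial>P)"
    by (simp add: funpow_swap1)
  also have "\<dots> = (\<integral>\<^sup>+g. \<integral>\<^sup>+x. (\<lambda>(g, y). h (g ** bwd n y, (T ^^ n) y)) (retract g, x) \<partial>P \<partial>\<mu>)"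
  proof (rule law_retract)
    have "(\<lambda>p. (fst p ** bwd n (snd p), (T ^^ n) (snd p))) \<in> \<mu> \<Otimes>\<^sub>M P \<rightarrow>\<^sub>M borel \<Otimes>\<^sub>M P"
      by (intro measurable_Pair measurable_mm measurable_compose[OF measurable_fst id_mu_borel]
          measurable_compose[OF measurable_snd bwd_measurable] measurable_compose[OF measurable_snd iter_measurable])
    then show "(\<lambda>(g, y). h (g ** bwd n y, (T ^^ n) y)) \<in> borel_measurable (\<mu> \<Otimes>\<^sub>M P)"
      unfolding split_beta' by (rule measurable_compose[OF _ Suc.prems])
  qed
  also have "\<dots> = (\<integral>\<^sup>+g. \<integral>\<^sup>+x. h (retract g ** bwd n x, (T ^^ n) x) \<partial>P \<partial>\<mu>)" by simp
  also have "\<dots> = (\<integral>\<^sup>+g. \<integral>\<^sup>+g'. \<integral>\<^sup>+x. h (retract g ** g', x) \<partial>P \<partial>conv_pow n \<partial>\<mu>)"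
  proof (rule nn_integral_cong)
    fix g
    have "(\<lambda>p. h (retract g ** fst p, snd p)) \<in> borel_measurable (borel \<Otimes>\<^sub>M P)" by measurable
    from Suc.IH[OF this] show "(\<integral>\<^sup>+x. h (retract g ** bwd n x, (T ^^ n) x) \<partial>P) = (\<integral>\<^sup>+g'. \<integral>\<^sup>+x. h (retract g ** g', x) \<partial>P \<partial>conv_pow n)"
      by simp
  qed
  also have "\<dots> = (\<integral>\<^sup>+g. \<integral>\<^sup>+x. h (g, x) \<partial>P \<partial>conv_pow (Suc n))"
    by (rule nn_conv_pow_Suc(1)[symmetric]) measurable
  finally show ?case .
qed

lemma law_fwd:
  assumes h: "h \<in> borel_measurable (borel \<Otimes>\<^sub>M P)"
  shows "(\<integral>\<^sup>+x. h (fwd n x, (T ^^ n) x) \<partial>P) = (\<integral>\<^sup>+g. \<integral>\<^sup>+x. h (g, x) \<partial>P \<partial>conv_pow n)"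
  using h
proof (induction n arbitrary: h)
  case 0
  note [measurable] = 0
  show ?case by (subst conv_pow.simps, subst nn_integral_return) auto
next
  case (Suc n)
  note [measurable] = Suc.prems
  have m: "(\<lambda>p. h (\<gamma> (snd p) ** fst p, T (snd p))) \<in> borel_measurable (borel \<Otimes>\<^sub>M P)" by measurable
  have "(\<integral>\<^sup>+x. h (fwd (Suc n) x, (T ^^ Suc n) x) \<partial>P) = (\<integral>\<^sup>+g. \<integral>\<^sup>+x. h (\<gamma> x ** g, T x) \<partial>P \<partial>conv_pow n)"
    using Suc.IH[OF m] by simp
  also have "\<dots> = (\<integral>\<^sup>+g. \<integral>\<^sup>+g'. \<integral>\<^sup>+x. h (retract g' ** g, x) \<partial>P \<partial>\<mu> \<partial>conv_pow n)"
  proof (rule nn_integral_cong)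
    fix g :: "'k^'n^'n"
    have "(\<lambda>p. (fst p ** g, snd p)) \<in> \<mu> \<Otimes>\<^sub>M P \<rightarrow>\<^sub>M borel \<Otimes>\<^sub>M P"
      by (intro measurable_Pair measurable_mm measurable_compose[OF measurable_fst id_mu_borel] measurable_const measurable_snd) auto
    then have "(\<lambda>p. h (fst p ** g, snd p)) \<in> borel_measurable (\<mu> \<Otimes>\<^sub>M P)"
      by (rule measurable_compose[OF _ Suc.prems])
    from law_retract[OF this] show "(\<integral>\<^sup>+x. h (\<gamma> x ** g, T x) \<partial>P) = (\<integral>\<^sup>+g'. \<integral>\<^sup>+x. h (retract g' ** g, x) \<partial>P \<partial>\<mu>)"
      by simp
  qed
  also have "\<dots> = (\<integral>\<^sup>+g. \<integral>\<^sup>+x. h (g, x) \<partial>P \<partial>conv_pow (Suc n))"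
    by (rule nn_conv_pow_Suc(2)[symmetric]) measurable
  finally show ?case .
qed

text \<open>
  For both products, the first \<open>n\<close> matrices are independent of \<open>T\<^sup>n\<close>.
\<close>

lemma distr_product:
  assumes X [measurable]: "X \<in> P \<rightarrow>\<^sub>M borel"
    and lw: "\<And>h. h \<in> borel_measurable (borel \<Otimes>\<^sub>M P) \<Longrightarrow>
      (\<integral>\<^sup>+x. h (X x, (T ^^ n) x) \<partial>P) = (\<integral>\<^sup>+g. \<integral>\<^sup>+x. h (g, x) \<partial>P \<partial>conv_pow n)"
  shows "distr P (borel \<Otimes>\<^sub>M P) (\<lambda>x. (X x, (T ^^ n) x)) = conv_pow n \<Otimes>\<^sub>M P"
proof (rule measure_eqI)
  show "sets (distr P (borel \<Otimes>\<^sub>M P) (\<lambda>x. (X x, (T ^^ n) x))) = sets (conv_pow n \<Otimes>\<^sub>M P)"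
    by (simp add: sets_pair_measure_cong[OF sets_conv_pow refl])
  fix A assume "A \<in> sets (distr P (borel \<Otimes>\<^sub>M P) (\<lambda>x. (X x, (T ^^ n) x)))"
  then have A [measurable]: "A \<in> sets (borel \<Otimes>\<^sub>M P)" by simp
  then have A': "A \<in> sets (conv_pow n \<Otimes>\<^sub>M P)" by (simp add: sets_pair_measure_cong[OF sets_conv_pow refl])
  have "emeasure (distr P (borel \<Otimes>\<^sub>M P) (\<lambda>x. (X x, (T ^^ n) x))) A = (\<integral>\<^sup>+x. indicator A (X x, (T ^^ n) x) \<partial>P)"
    by (rule emeasure_distr_indicator) measurable
  also have "\<dots> = (\<integral>\<^sup>+g. \<integral>\<^sup>+x. indicator A (g, x) \<partial>P \<partial>conv_pow n)" by (rule lw) measurable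
  also have "\<dots> = emeasure (conv_pow n \<Otimes>\<^sub>M P) A" using A' by (simp add: P.emeasure_pair_measure)
  finally show "emeasure (distr P (borel \<Otimes>\<^sub>M P) (\<lambda>x. (X x, (T ^^ n) x))) A = emeasure (conv_pow n \<Otimes>\<^sub>M P) A" .
qed

lemma product_indep:
  fixes \<phi> :: "'k^'n^'n \<Rightarrow> real"
  assumes X [measurable]: "X \<in> P \<rightarrow>\<^sub>M borel"
    and lw: "\<And>h. h \<in> borel_measurable (borel \<Otimes>\<^sub>M P) \<Longrightarrow>
      (\<integral>\<^sup>+x. h (X x, (T ^^ n) x) \<partial>P) = (\<integral>\<^sup>+g. \<integral>\<^sup>+x. h (g, x) \<partial>P \<partial>conv_pow n)"
    and \<phi> [measurable]: "\<phi> \<in> borel_measurable borel" and \<phi>i: "integrable P (\<lambda>x. \<phi> (X x))"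
    and A [measurable]: "A \<in> sets P"
  shows "(\<integral>x. \<phi> (X x) \<partial>P) = (\<integral>g. \<phi> g \<partial>conv_pow n)"
    and "(\<integral>x. \<phi> (X x) * indicator A ((T ^^ n) x) \<partial>P) = (\<integral>x. \<phi> (X x) \<partial>P) * measure P A"
proof -
  interpret c: prob_space "conv_pow n" by (rule prob_conv_pow)
  interpret pp: pair_prob_space "conv_pow n" P ..
  note d = distr_product[OF X lw]
  have gen: "(\<integral>x. \<phi> (X x) * indicator B ((T ^^ n) x) \<partial>P) = (\<integral>g. \<phi> g \<partial>conv_pow n) * measure P B" if B [measurable]: "B \<in> sets P" for B
  proof -
    have m: "(\<lambda>p. \<phi> (fst p) * indicator B (snd p)) \<in> borel_measurable (borel \<Otimes>\<^sub>M P)" by measurable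
    have "integrable P (\<lambda>x. \<phi> (X x) * indicator B ((T ^^ n) x))"
    proof -
      have "(\<lambda>x. \<phi> (X x) * indicator B ((T ^^ n) x)) = (\<lambda>x. \<phi> (X x) * indicator ((T ^^ n) -` B) x)"
        by (auto simp: indicator_def)
      moreover have "integrable P (\<lambda>x. \<phi> (X x) * indicator ((T ^^ n) -` B \<inter> space P) x)"
        by (intro integrable_real_mult_indicator \<phi>i measurable_sets[OF iter_measurable B])
      ultimately show ?thesis
        by (simp cong: Bochner_Integration.integrable_cong add: indicator_def)
    qed
    then have "integrable (distr P (borel \<Otimes>\<^sub>M P) (\<lambda>x. (X x, (T ^^ n) x))) (\<lambda>p. \<phi> (fst p) * indicator B (snd p))"
      by (subst integrable_distr_eq) auto
    then have int: "integrable (conv_pow n \<Otimes>\<^sub>M P) (\<lambda>(g, x). \<phi> g * indicator B x)"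
      by (simp add: d split_beta')
    have "(\<integral>x. \<phi> (X x) * indicator B ((T ^^ n) x) \<partial>P) = (\<integral>p. \<phi> (fst p) * indicator B (snd p) \<partial>distr P (borel \<Otimes>\<^sub>M P) (\<lambda>x. (X x, (T ^^ n) x)))"
      by (subst integral_distr) auto
    also have "\<dots> = (\<integral>(g, x). \<phi> g * indicator B x \<partial>(conv_pow n \<Otimes>\<^sub>M P))" by (simp add: d split_beta')
    also have "\<dots> = (\<integral>g. \<integral>x. \<phi> g * indicator B x \<partial>P \<partial>conv_pow n)"
      using pp.integral_fst[OF int] by simp
    also have "\<dots> = (\<integral>g. \<phi> g * measure P B \<partial>conv_pow n)" by simp
    finally show ?thesis by simp
  qed
  have "(\<integral>x. \<phi> (X x) \<partial>P) = (\<integral>x. \<phi> (X x) * indicator (space P) ((T ^^ n) x) \<partial>P)"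
    by (intro Bochner_Integration.integral_cong) (auto simp: iter_space)
  then show 1: "(\<integral>x. \<phi> (X x) \<partial>P) = (\<integral>g. \<phi> g \<partial>conv_pow n)" using gen[of "space P"] P.prob_space by simp
  show "(\<integral>x. \<phi> (X x) * indicator A ((T ^^ n) x) \<partial>P) = (\<integral>x. \<phi> (X x) \<partial>P) * measure P A"
    unfolding 1 by (rule gen[OF A])
qed

end

subsection \<open>The top Lyapunov exponent\<close>

context mu_space
begin

text \<open>
  The value of the top Lyapunov exponent on \<open>W \<noteq> {0}\<close>, by \<open>top_lyapunov_eq\<close>.
\<close>

definition exponent :: real where
  "exponent = (INF n\<in>{1..}. (\<integral>g. ln (onorm_on W g) \<partial>conv_pow n) / real n)"

end

context walk_system
begin

text \<open>
  The limit depends only on the laws \<open>conv_pow n\<close>, hence is the same for \<open>bwd\<close> and \<open>fwd\<close> and in every system.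
\<close>

lemma kingman_product:
  assumes W: "W \<noteq> {0}"
    and X [measurable]: "\<And>n. X n \<in> P \<rightarrow>\<^sub>M borel"
    and stab: "\<And>n x. x \<in> space P \<Longrightarrow> X n x \<in> stab W"
    and X0: "\<And>x. X 0 x = mat 1"
    and sub: "\<And>n m x. x \<in> space P \<Longrightarrow> ln (onorm_on W (X (n + m) x)) \<le> ln (onorm_on W (X n x)) + ln (onorm_on W (X m ((T ^^ n) x)))"
    and step: "\<And>n x. x \<in> space P \<Longrightarrow> \<bar>ln (onorm_on W (X (Suc n) x)) - ln (onorm_on W (X n (T x)))\<bar> \<le> log_norm (\<gamma> x)"
    and lw: "\<And>n h. h \<in> borel_measurable (borel \<Otimes>\<^sub>M P) \<Longrightarrow>
      (\<integral>\<^sup>+x. h (X n x, (T ^^ n) x) \<partial>P) = (\<integral>\<^sup>+g. \<integral>\<^sup>+x. h (g, x) \<partial>P \<partial>conv_pow n)"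
  shows "AE x in P. (\<lambda>n. ln (onorm_on W (X n x)) / real n) \<longlonglongrightarrow> exponent"
proof -
  have F0: "ln (onorm_on W (X 0 x)) = 0" if "x \<in> space P" for x
  proof -
    obtain w where w: "w \<in> W" "w \<noteq> 0" using W W0 by blast
    have "onorm_on W (mat 1) \<le> 1" by (rule onorm_on_bound) auto
    moreover have "norm w \<le> onorm_on W (mat 1) * norm w" using onorm_on_le[OF w(1), of "mat 1"] by simp
    then have "1 \<le> onorm_on W (mat 1)" using w(2) by simp
    ultimately show ?thesis by (simp add: X0)
  qed
  have [measurable]: "(\<lambda>x. ln (onorm_on W (X n x))) \<in> borel_measurable P" for n by measurable
  have int: "integrable P (\<lambda>x. ln (onorm_on W (X n x)))" for n
  proof (induction n)
    case 0 then show ?case using F0 by (simp cong: Bochner_Integration.integrable_cong)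
  next
    case (Suc n)
    have "integrable P (\<lambda>x. \<bar>ln (onorm_on W (X n (T x)))\<bar> + log_norm (\<gamma> x))"
      using integrable_iter[OF Suc, of 1] integrable_log_gamma by auto
    then show ?case
    proof (rule Bochner_Integration.integrable_bound)
      show "AE x in P. norm (ln (onorm_on W (X (Suc n) x))) \<le> norm (\<bar>ln (onorm_on W (X n (T x)))\<bar> + log_norm (\<gamma> x))"
      proof (rule AE_I2)
        fix x assume "x \<in> space P"
        from step[OF this, of n] show "norm (ln (onorm_on W (X (Suc n) x))) \<le> norm (\<bar>ln (onorm_on W (X n (T x)))\<bar> + log_norm (\<gamma> x))"
          by simp
      qed
    qed measurable
  qed
  have m: "(\<lambda>g. ln (onorm_on W g)) \<in> borel_measurable borel" by measurable
  have "AE x in P. (\<lambda>n. ln (onorm_on W (X n x)) / real n) \<longlonglongrightarrow> (INF n\<in>{1..}. (\<integral>x. ln (onorm_on W (X n x)) \<partial>P) / real n)"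
  proof (rule kingman_indep(1))
    show "ln (onorm_on W (X 0 x)) = 0" if "x \<in> space P" for x using F0 that .
    show "ln (onorm_on W (X (n + m) x)) \<le> ln (onorm_on W (X n x)) + ln (onorm_on W (X m ((T ^^ n) x)))"
      if "x \<in> space P" for n m x using sub that .
    show "\<bar>ln (onorm_on W (X (Suc n) x)) - ln (onorm_on W (X n (T x)))\<bar> \<le> log_norm (\<gamma> x)"
      if "x \<in> space P" for n x using step that .
    show "integrable P (\<lambda>x. log_norm (\<gamma> x))" by (rule integrable_log_gamma)
    show "(\<integral>x. ln (onorm_on W (X n x)) * indicator A ((T ^^ n) x) \<partial>P) = (\<integral>x. ln (onorm_on W (X n x)) \<partial>P) * measure P A"
      if "A \<in> sets P" for n A
      by (rule product_indep(2)[where X="X n" and \<phi>="\<lambda>g. ln (onorm_on W g)", OF X _ m int that]) (rule lw)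
  qed measurable
  moreover have "(\<integral>x. ln (onorm_on W (X n x)) \<partial>P) = (\<integral>g. ln (onorm_on W g) \<partial>conv_pow n)" for n
    by (rule product_indep(1)[where X="X n" and \<phi>="\<lambda>g. ln (onorm_on W g)", OF X _ m int sets.top]) (rule lw)
  ultimately show ?thesis by (simp add: exponent_def)
qed

lemma kingman_bwd:
  assumes "W \<noteq> {0}"
  shows "AE x in P. (\<lambda>n. ln (onorm_on W (bwd n x)) / real n) \<longlonglongrightarrow> exponent"
proof (rule kingman_product[OF assms bwd_measurable bwd_stab])
  show "ln (onorm_on W (bwd (n + m) x)) \<le> ln (onorm_on W (bwd n x)) + ln (onorm_on W (bwd m ((T ^^ n) x)))"
    if "x \<in> space P" for n m x
    unfolding bwd_add by (intro ln_onorm_on_mult assms bwd_stab iter_space that)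
  show "\<bar>ln (onorm_on W (bwd (Suc n) x)) - ln (onorm_on W (bwd n (T x)))\<bar> \<le> log_norm (\<gamma> x)"
    if "x \<in> space P" for n x
    unfolding bwd.simps by (intro ln_onorm_on_step(1) assms bwd_stab T_space gamma_stab that)
qed (auto intro: law_bwd)

lemma kingman_fwd:
  assumes "W \<noteq> {0}"
  shows "AE x in P. (\<lambda>n. ln (onorm_on W (fwd n x)) / real n) \<longlonglongrightarrow> exponent"
proof (rule kingman_product[OF assms fwd_measurable fwd_stab])
  show "ln (onorm_on W (fwd (n + m) x)) \<le> ln (onorm_on W (fwd n x)) + ln (onorm_on W (fwd m ((T ^^ n) x)))"
    if "x \<in> space P" for n m x
    unfolding fwd_add using ln_onorm_on_mult[OF assms fwd_stab[OF iter_space[OF that]] fwd_stab[OF that], of m n n]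
    by linarith
  show "\<bar>ln (onorm_on W (fwd (Suc n) x)) - ln (onorm_on W (fwd n (T x)))\<bar> \<le> log_norm (\<gamma> x)"
    if "x \<in> space P" for n x
    using fwd_add[of 1 n x] ln_onorm_on_step(2)[OF assms gamma_stab[OF that] fwd_stab[OF T_space[OF that]], of n] by simp
qed (auto intro: law_fwd)

end

context mu_space
begin

abbreviation "paths \<equiv> PiM (UNIV :: nat set) (\<lambda>_. \<mu>)"

text \<open>
  The sequence space is a system because the first entry is independent of the shifted sequence.
\<close>

lemma walk_system_paths: "walk_system W \<pi> \<mu> paths (\<lambda>\<omega> n. \<omega> (Suc n)) (\<lambda>\<omega>. retract (\<omega> 0))"
proof -
  interpret sequence_space \<mu> ..
  have pp: "prob_space paths" by (rule prob_space_PiM[OF prob_mu])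
  have sh: "(\<lambda>\<omega> n. \<omega> (Suc n)) \<in> paths \<rightarrow>\<^sub>M paths"
    by (rule measurable_PiM_single') (auto simp: space_PiM)
  have c0: "(\<lambda>\<omega>. \<omega> 0) \<in> paths \<rightarrow>\<^sub>M \<mu>" by (rule measurable_component_singleton) simp
  have lw: "(\<integral>\<^sup>+\<omega>. h (retract (\<omega> 0), \<lambda>n. \<omega> (Suc n)) \<partial>paths) = (\<integral>\<^sup>+g. \<integral>\<^sup>+\<omega>. h (g, \<omega>) \<partial>paths \<partial>\<mu>)"
    if h: "h \<in> borel_measurable (\<mu> \<Otimes>\<^sub>M paths)" for h
  proof -
    have mrt: "(\<lambda>p. (retract (fst p), snd p)) \<in> \<mu> \<Otimes>\<^sub>M paths \<rightarrow>\<^sub>M \<mu> \<Otimes>\<^sub>M paths"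
      by (intro measurable_Pair measurable_compose[OF measurable_fst retract_mu] measurable_snd)
    have msh: "(\<lambda>\<omega>. (retract (\<omega> 0), \<lambda>n. \<omega> (Suc n))) \<in> paths \<rightarrow>\<^sub>M \<mu> \<Otimes>\<^sub>M paths"
      by (intro measurable_Pair sh measurable_compose[OF c0 retract_mu])
    have "(\<integral>\<^sup>+\<omega>. h (retract (\<omega> 0), \<lambda>n. \<omega> (Suc n)) \<partial>paths) =
        (\<integral>\<^sup>+\<omega>. h (retract (\<omega> 0), \<lambda>n. \<omega> (Suc n)) \<partial>distr (\<mu> \<Otimes>\<^sub>M paths) paths (\<lambda>(s, \<omega>). case_nat s \<omega>))"
      by (simp only: PiM_iter)
    also have "\<dots> = (\<integral>\<^sup>+p. h (retract (fst p), snd p) \<partial>(\<mu> \<Otimes>\<^sub>M paths))"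
    proof (subst nn_integral_distr)
      show "(\<lambda>\<omega>. h (retract (\<omega> 0), \<lambda>n. \<omega> (Suc n))) \<in> borel_measurable (distr (\<mu> \<Otimes>\<^sub>M paths) paths (\<lambda>(s, \<omega>). case_nat s \<omega>))"
        using measurable_compose[OF msh h] by simp
      show "(\<lambda>(s, \<omega>). case_nat s \<omega>) \<in> \<mu> \<Otimes>\<^sub>M paths \<rightarrow>\<^sub>M paths"
        by measurable
    qed (simp add: split_beta')
    also have "\<dots> = (\<integral>\<^sup>+g. \<integral>\<^sup>+\<omega>. h (retract g, \<omega>) \<partial>paths \<partial>\<mu>)"
      using sigma_finite_measure.nn_integral_fst[OF prob_space_imp_sigma_finite[OF pp] measurable_compose[OF mrt h]] by simp
    also have "\<dots> = (\<integral>\<^sup>+g. \<integral>\<^sup>+\<omega>. h (g, \<omega>) \<partial>paths \<partial>\<mu>)"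
      using AE_retract by (intro nn_integral_cong_AE) auto
    finally show "(\<integral>\<^sup>+\<omega>. h (retract (\<omega> 0), \<lambda>n. \<omega> (Suc n)) \<partial>paths) = (\<integral>\<^sup>+g. \<integral>\<^sup>+\<omega>. h (g, \<omega>) \<partial>paths \<partial>\<mu>)" .
  qed
  have m: "(\<lambda>\<omega>. retract (\<omega> 0)) \<in> paths \<rightarrow>\<^sub>M \<mu>"
    by (rule measurable_compose[OF c0 retract_mu])
  show ?thesis
    by (intro walk_system.intro walk_system_axioms.intro mu_space_axioms pp sh m retract_stab lw)
qed

text \<open>
  By \<open>kingman_fwd\<close> the limit in the definition of the exponent exists almost surely and is constant,
  which makes the description well defined.
\<close>

lemma top_lyapunov_eq:
  assumes W: "W \<noteq> {0}" shows "top_lyapunov \<mu> W = ereal exponent"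
proof -
  interpret s: walk_system W \<pi> \<mu> paths "\<lambda>\<omega> n. \<omega> (Suc n)" "\<lambda>\<omega>. retract (\<omega> 0)" by (rule walk_system_paths)
  interpret sequence_space \<mu> ..
  have pp: "prob_space paths" by (rule prob_space_PiM[OF prob_mu])
  have iter: "((\<lambda>\<omega> n. \<omega> (Suc n)) ^^ n) \<omega> m = \<omega> (n + m)" for n m and \<omega> :: "nat \<Rightarrow> 'k^'n^'n"
    by (induction n arbitrary: m) auto
  have "AE \<omega> in paths. \<omega> i \<in> stab W" for i
    by (rule AE_PiM_component) (use AE_stab prob_mu in auto)
  then have "AE \<omega> in paths. \<forall>i. \<omega> i \<in> stab W" by (simp add: AE_all_countable)
  then have "AE \<omega> in paths. (\<lambda>n. ereal (1 / real n * ln (onorm_on W (walk \<omega> n)))) \<longlonglongrightarrow> ereal exponent"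
    using s.kingman_fwd[OF W]
  proof eventually_elim
    case (elim \<omega>)
    have "walk \<omega> n = s.fwd n \<omega>" for n
      by (induction n) (simp_all add: iter retract_id elim(1))
    then have eq: "(\<lambda>n. 1 / real n * ln (onorm_on W (walk \<omega> n))) = (\<lambda>n. ln (onorm_on W (s.fwd n \<omega>)) / real n)" by simp
    show ?case unfolding lim_ereal eq by (rule elim(2))
  qed
  note conv = this
  have "(THE l. AE \<omega> in paths. (\<lambda>n. ereal (1 / real n * ln (onorm_on W (walk \<omega> n)))) \<longlonglongrightarrow> l) = ereal exponent"
  proof (rule the_equality)
    show "AE \<omega> in paths. (\<lambda>n. ereal (1 / real n * ln (onorm_on W (walk \<omega> n)))) \<longlonglongrightarrow> ereal exponent" by (rule conv)
    fix l assume "AE \<omega> in paths. (\<lambda>n. ereal (1 / real n * ln (onorm_on W (walk \<omega> n)))) \<longlonglongrightarrow> l"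
    with conv have "AE \<omega> in paths. l = ereal exponent" by eventually_elim (rule LIMSEQ_unique)
    then show "l = ereal exponent" by (simp only: prob_space.AE_const[OF pp])
  qed
  then show ?thesis using W by (simp add: top_lyapunov_def)
qed

subsection \<open>Stationarity as invariance under convolution\<close>

text \<open>
  For a jointly measurable action, stationarity is the equation of measures \<open>\<mu> * \<nu> = \<nu>\<close>. The matrices
  that do not preserve \<open>W\<close> form a null set, but the inner integrand has to be measurable there too
  for the two integrals to agree; this is what \<open>fm\<close> provides.
\<close>

lemma stationary_iff:
  fixes a :: "'k^'n^'n \<Rightarrow> 'x \<Rightarrow> 'x" and X :: "'x measure"
  assumes am: "(\<lambda>(g, x). a (retract g) x) \<in> \<mu> \<Otimes>\<^sub>M X \<rightarrow>\<^sub>M X"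
    and fm: "\<And>f x. f \<in> borel_measurable X \<Longrightarrow> x \<in> space X \<Longrightarrow>
        (\<lambda>g. if a g x \<in> space X then f (a g x) else (0::real)) \<in> borel_measurable \<mu>"
  shows "stationary a \<mu> X \<nu> \<longleftrightarrow>
    prob_space \<nu> \<and> sets \<nu> = sets X \<and> distr (\<mu> \<Otimes>\<^sub>M \<nu>) X (\<lambda>(g, x). a (retract g) x) = \<nu>"
proof -
  have inner: "(\<integral>g. (if a g x \<in> space X then f (a g x) else 0) \<partial>\<mu>) = (\<integral>g. f (a (retract g) x) \<partial>\<mu>)"
    if f: "f \<in> borel_measurable X" and x: "x \<in> space X" for f :: "'x \<Rightarrow> real" and x
  proof (rule integral_cong_AE)
    have m: "(\<lambda>g. a (retract g) x) \<in> \<mu> \<rightarrow>\<^sub>M X"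
      using measurable_Pair1[OF am x] by simp
    show "(\<lambda>g. if a g x \<in> space X then f (a g x) else 0) \<in> borel_measurable \<mu>" by (rule fm[OF f x])
    show "(\<lambda>g. f (a (retract g) x)) \<in> borel_measurable \<mu>" by (rule measurable_compose[OF m f])
    have "a (retract g) x \<in> space X" if "g \<in> space \<mu>" for g using measurable_space[OF m that] .
    then have "AE g in \<mu>. a (retract g) x \<in> space X" by (intro AE_I2)
    with AE_retract show "AE g in \<mu>. (if a g x \<in> space X then f (a g x) else 0) = f (a (retract g) x)"
      by eventually_elim auto
  qed
  have dbl: "(\<integral>x. (\<integral>g. (if a g x \<in> space X then f (a g x) else 0) \<partial>\<mu>) \<partial>\<nu>) = (\<integral>x. f x \<partial>distr (\<mu> \<Otimes>\<^sub>M \<nu>) X (\<lambda>(g, x). a (retract g) x))"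
    if f: "f \<in> borel_measurable X" and bd: "\<And>x. x \<in> space X \<Longrightarrow> \<bar>f x\<bar> \<le> B" and p: "prob_space \<nu>" and s: "sets \<nu> = sets X" for f :: "'x \<Rightarrow> real" and B
  proof -
    interpret n: prob_space \<nu> by fact
    interpret pp: pair_prob_space \<mu> \<nu> ..
    have sp: "space \<nu> = space X" using s by (rule sets_eq_imp_space_eq)
    have am': "(\<lambda>(g, x). a (retract g) x) \<in> \<mu> \<Otimes>\<^sub>M \<nu> \<rightarrow>\<^sub>M X"
      using am by (simp add: measurable_cong_sets[OF sets_pair_measure_cong[OF refl s] refl])
    have int: "integrable (\<mu> \<Otimes>\<^sub>M \<nu>) (\<lambda>(g, x). f (a (retract g) x))"
    proof (rule pp.P.integrable_const_bound[of _ B])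
      show "(\<lambda>(g, x). f (a (retract g) x)) \<in> borel_measurable (\<mu> \<Otimes>\<^sub>M \<nu>)"
        using measurable_compose[OF am' f] by (simp add: split_beta')
      show "AE p in \<mu> \<Otimes>\<^sub>M \<nu>. norm (case p of (g, x) \<Rightarrow> f (a (retract g) x)) \<le> B"
        using measurable_space[OF am'] by (intro AE_I2) (auto simp: split_beta' intro!: bd)
    qed
    have "(\<integral>x. (\<integral>g. (if a g x \<in> space X then f (a g x) else 0) \<partial>\<mu>) \<partial>\<nu>) = (\<integral>x. (\<integral>g. f (a (retract g) x) \<partial>\<mu>) \<partial>\<nu>)"
      by (intro Bochner_Integration.integral_cong refl inner f) (simp add: sp)
    also have "\<dots> = (\<integral>(g, x). f (a (retract g) x) \<partial>(\<mu> \<Otimes>\<^sub>M \<nu>))" by (rule pp.integral_snd[OF int])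
    also have "\<dots> = (\<integral>x. f x \<partial>distr (\<mu> \<Otimes>\<^sub>M \<nu>) X (\<lambda>(g, x). a (retract g) x))"
      by (subst integral_distr[OF am' f]) (simp add: split_beta')
    finally show ?thesis .
  qed
  show ?thesis
  proof
    assume st: "stationary a \<mu> X \<nu>"
    then have p: "prob_space \<nu>" and s: "sets \<nu> = sets X" by (auto simp: stationary_def)
    interpret n: prob_space \<nu> by fact
    interpret pp: pair_prob_space \<mu> \<nu> ..
    have am': "(\<lambda>(g, x). a (retract g) x) \<in> \<mu> \<Otimes>\<^sub>M \<nu> \<rightarrow>\<^sub>M X"
      using am by (simp add: measurable_cong_sets[OF sets_pair_measure_cong[OF refl s] refl])
    interpret d: prob_space "distr (\<mu> \<Otimes>\<^sub>M \<nu>) X (\<lambda>(g, x). a (retract g) x)" by (rule pp.P.prob_space_distr[OF am'])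
    have "distr (\<mu> \<Otimes>\<^sub>M \<nu>) X (\<lambda>(g, x). a (retract g) x) = \<nu>"
    proof (rule measure_eqI)
      fix A assume "A \<in> sets (distr (\<mu> \<Otimes>\<^sub>M \<nu>) X (\<lambda>(g, x). a (retract g) x))"
      then have A: "A \<in> sets X" by simp
      then have ind: "(indicator A :: 'x \<Rightarrow> real) \<in> borel_measurable X" by simp
      have "\<exists>B. \<forall>x\<in>space X. \<bar>indicator A x :: real\<bar> \<le> B" by (intro exI[of _ 1]) (auto simp: indicator_def)
      then have "(\<integral>x. (\<integral>g. (if a g x \<in> space X then indicator A (a g x) else (0::real)) \<partial>\<mu>) \<partial>\<nu>) = (\<integral>x. indicator A x \<partial>\<nu>)"
        using st ind unfolding stationary_def by blast
      then have "(\<integral>x. (indicator A x :: real) \<partial>distr (\<mu> \<Otimes>\<^sub>M \<nu>) X (\<lambda>(g, x). a (retract g) x)) = (\<integral>x. indicator A x \<partial>\<nu>)"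
        using dbl[OF ind _ p s, of 1] by (simp add: indicator_def)
      then have "measure (distr (\<mu> \<Otimes>\<^sub>M \<nu>) X (\<lambda>(g, x). a (retract g) x)) A = measure \<nu> A"
        using A s by simp
      then show "emeasure (distr (\<mu> \<Otimes>\<^sub>M \<nu>) X (\<lambda>(g, x). a (retract g) x)) A = emeasure \<nu> A"
        by (simp add: d.emeasure_eq_measure n.emeasure_eq_measure)
    qed (simp add: s)
    then show "prob_space \<nu> \<and> sets \<nu> = sets X \<and> distr (\<mu> \<Otimes>\<^sub>M \<nu>) X (\<lambda>(g, x). a (retract g) x) = \<nu>" using p s by simp
  next
    assume h: "prob_space \<nu> \<and> sets \<nu> = sets X \<and> distr (\<mu> \<Otimes>\<^sub>M \<nu>) X (\<lambda>(g, x). a (retract g) x) = \<nu>"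
    show "stationary a \<mu> X \<nu>"
      unfolding stationary_def
    proof (intro conjI ballI impI)
      fix f :: "'x \<Rightarrow> real" assume f: "f \<in> borel_measurable X" and "\<exists>B. \<forall>x\<in>space X. \<bar>f x\<bar> \<le> B"
      then obtain B where "\<And>x. x \<in> space X \<Longrightarrow> \<bar>f x\<bar> \<le> B" by blast
      from dbl[OF f this] h show "(\<integral>x. (\<integral>g. (if a g x \<in> space X then f (a g x) else 0) \<partial>\<mu>) \<partial>\<nu>) = (\<integral>x. f x \<partial>\<nu>)"
        by simp
    qed (use h in auto)
  qed
qed

lemma sigma_notin: assumes "x \<in> space (proj_quot W)" shows "\<sigma> x \<notin> W" "qline (\<sigma> x) = x" "infdist (\<sigma> x) W = 1" "\<pi> (\<sigma> x) = \<sigma> x"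
proof -
  obtain v where v: "v \<notin> W" "x = qline v" using assms by (auto simp: space_proj_quot)
  then show "\<sigma> x \<notin> W" "qline (\<sigma> x) = x" "infdist (\<sigma> x) W = 1" "\<pi> (\<sigma> x) = \<sigma> x"
    by (simp_all add: sigma_qline normal_notin_W pi_in_W qline_normal qline_pi infdist_normal pi_normal pi_pi)
qed

lemma tau_notin: assumes "x \<in> space (proj_diff W)" shows "\<tau> x \<notin> W" "line (\<tau> x) = x" "\<theta> (\<tau> x) = 1"
proof -
  obtain v where v: "v \<notin> W" "x = line v" using assms by (auto simp: space_proj_diff)
  then show "\<tau> x \<notin> W" "line (\<tau> x) = x" "\<theta> (\<tau> x) = 1"
    by (simp_all add: tau_line normal_notin_W line_normal theta_normal)
qed

lemma act_quot_sigma: "g \<in> stab W \<Longrightarrow> x \<in> space (proj_quot W) \<Longrightarrow> act_quot g x = qline (g *v \<sigma> x)"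
  using act_qline[of g "\<sigma> x"] sigma_notin(2)[of x] by simp

lemma act_tau: "x \<in> space (proj_diff W) \<Longrightarrow> act g x = line (g *v \<tau> x)"
  using act_line[of g "\<tau> x"] tau_notin(2)[of x] by simp

lemma pair_mv_measurable:
  assumes "f \<in> borel_measurable X"
  shows "(\<lambda>p. retract (fst p) *v f (snd p)) \<in> borel_measurable (\<mu> \<Otimes>\<^sub>M X)"
  by (intro measurable_mv measurable_compose[OF measurable_fst retract_borel] measurable_compose[OF measurable_snd assms])

lemma act_quot_measurable: "(\<lambda>(g, x). act_quot (retract g) x) \<in> \<mu> \<Otimes>\<^sub>M proj_quot W \<rightarrow>\<^sub>M proj_quot W"
proof -
  have "(\<lambda>p. qline (retract (fst p) *v \<sigma> (snd p))) \<in> \<mu> \<Otimes>\<^sub>M proj_quot W \<rightarrow>\<^sub>M proj_quot W"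
    by (rule qline_measurable'[OF pair_mv_measurable[OF sigma_measurable]])
      (auto simp: space_pair_measure stab_in_W[OF retract_stab] sigma_notin)
  then show ?thesis
    by (rule measurable_cong[THEN iffD1, rotated]) (auto simp: space_pair_measure act_quot_sigma[OF retract_stab])
qed

lemma act_measurable: "(\<lambda>(g, x). act (retract g) x) \<in> \<mu> \<Otimes>\<^sub>M proj_diff W \<rightarrow>\<^sub>M proj_diff W"
proof -
  have "(\<lambda>p. line (retract (fst p) *v \<tau> (snd p))) \<in> \<mu> \<Otimes>\<^sub>M proj_diff W \<rightarrow>\<^sub>M proj_diff W"
    by (rule line_measurable'[OF pair_mv_measurable[OF tau_measurable]])
      (auto simp: space_pair_measure stab_in_W[OF retract_stab] tau_notin)
  then show ?thesis
    by (rule measurable_cong[THEN iffD1, rotated]) (auto simp: space_pair_measure act_tau)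
qed

text \<open>
  Every point of \<open>P(V/W)\<close>, being a set of cosets, contains \<open>W\<close>. The image of \<open>W\<close> contains \<open>0\<close>, hence it
  can only be a coset of \<open>W\<close> if it is \<open>W\<close>.
\<close>

lemma act_quot_in_space_iff:
  assumes g: "invertible g" and x: "x \<in> space (proj_quot W)"
  shows "act_quot g x \<in> space (proj_quot W) \<longleftrightarrow> g \<in> stab W"
proof
  assume "g \<in> stab W"
  then show "act_quot g x \<in> space (proj_quot W)"
    using x by (simp add: act_quot_sigma qline_in_space stab_in_W sigma_notin)
next
  assume a: "act_quot g x \<in> space (proj_quot W)"
  obtain v where v: "x = qline v" using x by (auto simp: space_proj_quot)
  obtain u where u: "act_quot g x = qline u" using a by (auto simp: space_proj_quot)
  have "coset W (0 *s v) \<in> qline v" unfolding qline_eq by blast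
  then have "W \<in> qline v" by (simp add: coset_W)
  then have "act g W \<in> act_quot g x" unfolding v act_quot_def by (rule imageI)
  then have "act g W \<in> qline u" unfolding u .
  then obtain c where c: "act g W = coset W (c *s u)" by (auto simp: qline_eq)
  have "g *v 0 \<in> act g W" unfolding act_def using W0 by blast
  then have "0 \<in> coset W (c *s u)" using c by simp
  then obtain w where "w \<in> W" "0 = c *s u + w" by (auto simp: coset_def)
  then have "c *s u = (-1) *s w" by (simp add: eq_neg_iff_add_eq_0)
  then have "c *s u \<in> W" using W_scale[OF \<open>w \<in> W\<close>, of "-1"] by simp
  then have "coset W (c *s u) = W" using coset_eq_iff[of "c *s u" 0] by (simp add: coset_W)
  then have "act g W = W" using c by simp
  then show "g \<in> stab W" using g by (auto simp: stab_def act_def)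
qed

lemma stationary_quot_iff:
  "stationary act_quot \<mu> (proj_quot W) \<nu> \<longleftrightarrow> prob_space \<nu> \<and> sets \<nu> = sets (proj_quot W) \<and>
    distr (\<mu> \<Otimes>\<^sub>M \<nu>) (proj_quot W) (\<lambda>(g, x). act_quot (retract g) x) = \<nu>"
proof (rule stationary_iff[OF act_quot_measurable])
  fix f :: "('k^'n) set set \<Rightarrow> real" and x assume f: "f \<in> borel_measurable (proj_quot W)" and x: "x \<in> space (proj_quot W)"
  have m: "(\<lambda>g. act_quot (retract g) x) \<in> \<mu> \<rightarrow>\<^sub>M proj_quot W"
    using measurable_Pair1[OF act_quot_measurable x] by simp
  have "(\<lambda>g. if g \<in> stab W then f (act_quot (retract g) x) else 0) \<in> borel_measurable \<mu>"
  proof (rule measurable_If)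
    show "{g \<in> space \<mu>. g \<in> stab W} \<in> sets \<mu>"
      using sets.sets_into_space[OF stab_sets] stab_sets by (simp add: Collect_conj_eq Int_absorb1)
  qed (auto intro: measurable_compose[OF m f])
  then show "(\<lambda>g. if act_quot g x \<in> space (proj_quot W) then f (act_quot g x) else 0) \<in> borel_measurable \<mu>"
    by (rule measurable_cong[THEN iffD1, rotated]) (simp add: space_mu act_quot_in_space_iff[OF _ x] retract_def)
qed

lemma stationary_diff_iff:
  "stationary act \<mu> (proj_diff W) \<nu> \<longleftrightarrow> prob_space \<nu> \<and> sets \<nu> = sets (proj_diff W) \<and>
    distr (\<mu> \<Otimes>\<^sub>M \<nu>) (proj_diff W) (\<lambda>(g, x). act (retract g) x) = \<nu>"
proof (rule stationary_iff[OF act_measurable])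
  fix f :: "('k^'n) set \<Rightarrow> real" and x assume f: "f \<in> borel_measurable (proj_diff W)" and x: "x \<in> space (proj_diff W)"
  have mv: "(\<lambda>g. g *v \<tau> x) \<in> borel_measurable \<mu>"
    by (intro measurable_mv id_mu_borel measurable_const) simp
  define G where "G = (\<lambda>g. if g *v \<tau> x \<in> W then \<tau> x else g *v \<tau> x)"
  have pr: "{g \<in> space \<mu>. g *v \<tau> x \<in> W} \<in> sets \<mu>"
    using measurable_sets[OF mv W_sets] by (simp add: vimage_def Int_def conj_commute)
  have "G \<in> borel_measurable \<mu>" unfolding G_def by (intro measurable_If mv measurable_const pr) simp
  then have "(\<lambda>g. line (G g)) \<in> \<mu> \<rightarrow>\<^sub>M proj_diff W"
    by (rule line_measurable') (simp add: G_def tau_notin[OF x])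
  then have "(\<lambda>g. f (line (G g))) \<in> borel_measurable \<mu>" using f by (rule measurable_compose)
  then have "(\<lambda>g. if g *v \<tau> x \<in> W then 0 else f (line (G g))) \<in> borel_measurable \<mu>"
    by (intro measurable_If pr measurable_const) auto
  moreover have "line v \<in> space (proj_diff W) \<longleftrightarrow> v \<notin> W" if "v \<noteq> 0" for v
  proof
    assume "line v \<in> space (proj_diff W)"
    then obtain u where u: "u \<notin> W" "line v = line u" by (auto simp: space_proj_diff)
    from u(2) that obtain c where "c \<noteq> 0" "v = c *s u" by (rule line_eqD)
    then show "v \<notin> W" using u(1) W_scale_iff by simp
  qed (rule line_in_space)
  moreover have "g *v \<tau> x \<noteq> 0" if "invertible g" for g :: "'k^'n^'n"
    using inv_mv_cancel[OF that, of "\<tau> x"] tau_notin(1)[OF x] W0 by auto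
  ultimately show "(\<lambda>g. if act g x \<in> space (proj_diff W) then f (act g x) else 0) \<in> borel_measurable \<mu>"
    by (subst measurable_cong[where g="\<lambda>g. if g *v \<tau> x \<in> W then 0 else f (line (G g))"])
      (auto simp: space_mu act_tau[OF x] G_def)
qed

end

subsection \<open>The norm cocycle\<close>

context mu_space
begin

lemma quot_norm_coset: "quot_norm (coset W v) = infdist v W"
proof -
  have "norm ` coset W v = dist v ` W"
  proof (intro equalityI subsetI)
    fix r assume "r \<in> norm ` coset W v"
    then obtain w where w: "w \<in> W" "r = norm (v + w)" by (auto simp: coset_def)
    have "r = dist v ((-1) *s w)" using w by (simp add: dist_norm)
    then show "r \<in> dist v ` W" using W_scale[OF w(1), of "-1"] by blast
  next
    fix r assume "r \<in> dist v ` W"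
    then obtain w where w: "w \<in> W" "r = dist v w" by auto
    have "r = norm (v + (-1) *s w)" using w by (simp add: dist_norm)
    then show "r \<in> norm ` coset W v" using W_scale[OF w(1), of "-1"] unfolding coset_def by blast
  qed
  moreover have "W \<noteq> {}" using W0 by auto
  ultimately show ?thesis by (simp add: quot_norm_def infdist_notempty)
qed

text \<open>
  The representative chosen in the definition of the cocycle does not depend on the matrix.
\<close>

lemma cocycle_rep:
  assumes "v \<notin> W"
  shows "\<exists>c. c \<noteq> 0 \<and> (\<forall>g. cocycle W g (qline v) = ln (quot_norm (act g (coset W (c *s v))) / quot_norm (coset W (c *s v))))"
proof -
  define C where "C = (SOME C. C \<in> qline v \<and> C \<noteq> W)"
  have "coset W (1 *s v) \<in> qline v" unfolding qline_eq by blast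
  moreover have "coset W (1 *s v) \<noteq> W" using coset_eq_iff[of v 0] assms by (simp add: coset_W)
  ultimately have C: "C \<in> qline v" "C \<noteq> W"
    using someI[of "\<lambda>C. C \<in> qline v \<and> C \<noteq> W" "coset W (1 *s v)"] by (auto simp: C_def)
  then obtain c where c: "C = coset W (c *s v)" by (auto simp: qline_eq)
  have "c \<noteq> 0" using C(2) c by (auto simp: coset_W)
  moreover have "cocycle W g (qline v) = ln (quot_norm (act g (coset W (c *s v))) / quot_norm (coset W (c *s v)))" for g
    unfolding cocycle_def C_def[symmetric] Let_def c ..
  ultimately show ?thesis by blast
qed

lemma cocycle_eq:
  assumes g: "g \<in> stab W" and v: "v \<notin> W"
  shows "cocycle W g (qline v) = ln (infdist (g *v v) W / infdist v W)"
proof -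
  obtain c where c: "c \<noteq> 0" "\<And>g. cocycle W g (qline v) = ln (quot_norm (act g (coset W (c *s v))) / quot_norm (coset W (c *s v)))"
    using cocycle_rep[OF v] by blast
  have "quot_norm (act g (coset W (c *s v))) = norm c * infdist (g *v v) W"
    by (simp add: act_coset[OF g] quot_norm_coset vector_scalar_commute infdist_scale)
  moreover have "quot_norm (coset W (c *s v)) = norm c * infdist v W"
    by (simp add: quot_norm_coset infdist_scale)
  ultimately show ?thesis using c by simp
qed

lemma cocycle_sigma:
  assumes "g \<in> stab W" "x \<in> space (proj_quot W)"
  shows "cocycle W g x = ln (infdist (g *v \<sigma> x) W)"
  using cocycle_eq[OF assms(1) sigma_notin(1)[OF assms(2)]]
  unfolding sigma_notin(2)[OF assms(2)] sigma_notin(3)[OF assms(2)] div_by_1 .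

lemma cocycle_bound:
  assumes g: "g \<in> stab W" and x: "x \<in> space (proj_quot W)"
  shows "\<bar>cocycle W g x\<bar> \<le> log_norm g"
proof -
  have p: "infdist (g *v \<sigma> x) W > 0"
    using infdist_pos stab_in_W[OF g] sigma_notin[OF x] by blast
  have "infdist (g *v \<sigma> x) W \<le> exp (log_norm g)" "1 \<le> exp (log_norm g) * infdist (g *v \<sigma> x) W"
    using stab_infdist[OF g, of "\<sigma> x"] by (simp_all add: sigma_notin[OF x])
  note le = this
  have "ln (infdist (g *v \<sigma> x) W) \<le> ln (exp (log_norm g))" using p le(1) by (intro ln_mono) auto
  moreover have "ln (exp (- log_norm g)) \<le> ln (infdist (g *v \<sigma> x) W)"
    using le(2) by (intro ln_mono) (auto simp: exp_minus field_simps)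
  ultimately show ?thesis by (simp add: cocycle_sigma[OF g x])
qed

text \<open>
  The matrices range over all of \<open>GL(V)\<close> here, so \<open>cocycle_eq\<close> does not apply. But for a fixed coset the
  quotient norm of its image is an infimum of continuous functions of the matrix.
\<close>

lemma cocycle_measurable_fst:
  assumes x: "x \<in> space (proj_quot W)"
  shows "(\<lambda>g. cocycle W g x) \<in> borel_measurable \<mu>"
proof -
  obtain v where v: "v \<notin> W" "x = qline v" using x by (auto simp: space_proj_quot)
  obtain c where c: "c \<noteq> 0" "\<And>g. cocycle W g x = ln (quot_norm (act g (coset W (c *s v))) / quot_norm (coset W (c *s v)))"
    using cocycle_rep[OF v(1)] unfolding v(2)[symmetric] by blast
  have "(\<lambda>g. quot_norm (act g (coset W u))) \<in> borel_measurable borel" for u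
  proof (rule borel_measurableI_less)
    fix a :: real
    have ne: "coset W u \<noteq> {}" using W0 by (auto simp: coset_def)
    have "quot_norm (act g (coset W u)) < a \<longleftrightarrow> (\<exists>w\<in>coset W u. norm (g *v w) < a)" for g
      unfolding quot_norm_def act_def image_image
      by (subst cINF_less_iff[OF ne]) (auto intro!: bdd_belowI2[where m=0])
    then have "{g \<in> space borel. quot_norm (act g (coset W u)) < a} = (\<Union>w\<in>coset W u. {g. norm (g *v w) < a})"
      by auto
    also have "open \<dots>" by (intro open_UN ballI open_Collect_less continuous_intros)
    finally show "{g \<in> space borel. quot_norm (act g (coset W u)) < a} \<in> sets borel" by simp
  qed
  then have "(\<lambda>g. quot_norm (act g (coset W u))) \<in> borel_measurable \<mu>" for u
    by (rule measurable_compose[OF id_mu_borel])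
  then show ?thesis unfolding c(2) by (intro borel_measurable_ln borel_measurable_divide borel_measurable_const)
qed

lemma cocycle_measurable: "(\<lambda>p. cocycle W (retract (fst p)) (snd p)) \<in> borel_measurable (\<mu> \<Otimes>\<^sub>M proj_quot W)"
proof -
  have inf: "(\<lambda>v. infdist v W) \<in> borel_measurable borel" by (intro borel_measurable_continuous_onI continuous_intros)
  have "(\<lambda>p. ln (infdist (retract (fst p) *v \<sigma> (snd p)) W)) \<in> borel_measurable (\<mu> \<Otimes>\<^sub>M proj_quot W)"
    by (intro borel_measurable_ln measurable_compose[OF pair_mv_measurable[OF sigma_measurable] inf])
  then show ?thesis
    by (rule measurable_cong[THEN iffD1, rotated]) (auto simp: space_pair_measure cocycle_sigma[OF retract_stab])
qed

lemma cocycle_average_eq: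
  assumes "sets \<nu> = sets (proj_quot W)"
  shows "cocycle_average \<mu> W \<nu> = (\<integral>x. (\<integral>g. cocycle W (retract g) x \<partial>\<mu>) \<partial>\<nu>)"
  unfolding cocycle_average_def
proof (rule Bochner_Integration.integral_cong[OF refl])
  fix x assume "x \<in> space \<nu>"
  then have x: "x \<in> space (proj_quot W)" using sets_eq_imp_space_eq[OF assms] by simp
  show "(\<integral>g. cocycle W g x \<partial>\<mu>) = (\<integral>g. cocycle W (retract g) x \<partial>\<mu>)"
  proof (rule integral_cong_AE)
    show "(\<lambda>g. cocycle W g x) \<in> borel_measurable \<mu>" by (rule cocycle_measurable_fst[OF x])
    show "(\<lambda>g. cocycle W (retract g) x) \<in> borel_measurable \<mu>"
      using measurable_compose[OF retract_mu cocycle_measurable_fst[OF x]] .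
    show "AE g in \<mu>. cocycle W g x = cocycle W (retract g) x" using AE_retract by eventually_elim simp
  qed
qed

end

subsection \<open>Independence of invariant events\<close>

lemma (in mu_space) proj_map_measurable: "proj_map W \<in> proj_diff W \<rightarrow>\<^sub>M proj_quot W"
proof -
  have "(\<lambda>x. qline (\<tau> x)) \<in> proj_diff W \<rightarrow>\<^sub>M proj_quot W"
    by (rule qline_measurable'[OF tau_measurable tau_notin(1)])
  moreover have "proj_map W x = qline (\<tau> x)" if "x \<in> space (proj_diff W)" for x
    using tau_notin(2)[OF that] proj_map_line[of "\<tau> x"] by simp
  ultimately show ?thesis using measurable_cong[of "proj_diff W" "proj_map W" "\<lambda>x. qline (\<tau> x)"] by simp
qed

context walk_system
begin

lemma law_integral:
  fixes k :: "_ \<Rightarrow> real"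
  assumes k: "k \<in> borel_measurable (\<mu> \<Otimes>\<^sub>M P)" and i: "integrable P (\<lambda>x. k (\<gamma> x, T x))"
  shows "(\<integral>x. k (\<gamma> x, T x) \<partial>P) = (\<integral>p. k p \<partial>(\<mu> \<Otimes>\<^sub>M P))" "integrable (\<mu> \<Otimes>\<^sub>M P) k"
proof -
  have m: "(\<lambda>x. (\<gamma> x, T x)) \<in> P \<rightarrow>\<^sub>M \<mu> \<Otimes>\<^sub>M P" by measurable
  show "(\<integral>x. k (\<gamma> x, T x) \<partial>P) = (\<integral>p. k p \<partial>(\<mu> \<Otimes>\<^sub>M P))"
    using integral_distr[OF m k] by (simp add: law_distr)
  show "integrable (\<mu> \<Otimes>\<^sub>M P) k"
    using integrable_distr_eq[OF m k] i by (simp add: law_distr)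
qed

text \<open>
  Since \<open>\<gamma>\<close> and \<open>Y \<circ> T\<close> are independent and \<open>Y \<circ> T\<close> has the law of \<open>Y\<close>, the law of \<open>a \<gamma> (Y \<circ> T)\<close> is the
  convolution of \<open>\<mu>\<close> with the law of \<open>Y\<close>.
\<close>

lemma system_stationary:
  assumes Y: "Y \<in> P \<rightarrow>\<^sub>M X" and am: "(\<lambda>(g, x). a (retract g) x) \<in> \<mu> \<Otimes>\<^sub>M X \<rightarrow>\<^sub>M X"
    and eq: "AE x in P. Y x = a (\<gamma> x) (Y (T x))"
  shows "distr (\<mu> \<Otimes>\<^sub>M distr P X Y) X (\<lambda>(g, x). a (retract g) x) = distr P X Y"
proof (rule measure_eqI)
  fix A assume "A \<in> sets (distr (\<mu> \<Otimes>\<^sub>M distr P X Y) X (\<lambda>(g, x). a (retract g) x))"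
  then have A [measurable]: "A \<in> sets X" by simp
  interpret d: prob_space "distr P X Y" by (rule P.prob_space_distr[OF Y])
  have am': "(\<lambda>(g, x). a (retract g) x) \<in> \<mu> \<Otimes>\<^sub>M distr P X Y \<rightarrow>\<^sub>M X"
    using am by (simp add: measurable_cong_sets[OF sets_pair_measure_cong[OF refl sets_distr] refl])
  have ind: "(\<lambda>p. indicator A (a (retract (fst p)) (snd p)) :: ennreal) \<in> borel_measurable (\<mu> \<Otimes>\<^sub>M X)"
    using measurable_compose[OF am borel_measurable_indicator[OF A]] by (simp add: split_beta')
  then have ind': "(\<lambda>p. indicator A (a (retract (fst p)) (snd p)) :: ennreal) \<in> borel_measurable (\<mu> \<Otimes>\<^sub>M distr P X Y)"
    by (simp add: measurable_cong_sets[OF sets_pair_measure_cong[OF refl sets_distr] refl])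
  have mY: "(\<lambda>p. (fst p, Y (snd p))) \<in> \<mu> \<Otimes>\<^sub>M P \<rightarrow>\<^sub>M \<mu> \<Otimes>\<^sub>M X"
    by (intro measurable_Pair measurable_fst measurable_compose[OF measurable_snd Y])
  have "emeasure (distr (\<mu> \<Otimes>\<^sub>M distr P X Y) X (\<lambda>(g, x). a (retract g) x)) A
      = (\<integral>\<^sup>+p. indicator A (a (retract (fst p)) (snd p)) \<partial>(\<mu> \<Otimes>\<^sub>M distr P X Y))"
    using emeasure_distr_indicator[OF am' A] by (simp only: split_beta')
  also have "\<dots> = (\<integral>\<^sup>+g. \<integral>\<^sup>+x. indicator A (a (retract g) x) \<partial>distr P X Y \<partial>\<mu>)"
    using d.nn_integral_fst[OF ind'] by (simp only: fst_conv snd_conv)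
  also have "\<dots> = (\<integral>\<^sup>+g. \<integral>\<^sup>+x. indicator A (a (retract g) (Y x)) \<partial>P \<partial>\<mu>)"
  proof (rule nn_integral_cong)
    fix g assume g: "g \<in> space \<mu>"
    have "(\<lambda>x. indicator A (a (retract g) x) :: ennreal) \<in> borel_measurable X"
      using measurable_Pair2[OF ind g] by simp
    then show "(\<integral>\<^sup>+x. indicator A (a (retract g) x) \<partial>distr P X Y) = (\<integral>\<^sup>+x. indicator A (a (retract g) (Y x)) \<partial>P)"
      using Y by (intro nn_integral_distr) simp_all
  qed
  also have "\<dots> = (\<integral>\<^sup>+x. indicator A (a (retract (\<gamma> x)) (Y (T x))) \<partial>P)"
    using law[OF measurable_compose[OF mY ind]] by (simp only: fst_conv snd_conv)
  also have "\<dots> = (\<integral>\<^sup>+x. indicator A (Y x) \<partial>P)"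
  proof (rule nn_integral_cong_AE)
    have "AE x in P. \<gamma> x \<in> stab W" by (rule AE_I2) (rule gamma_stab)
    then show "AE x in P. indicator A (a (retract (\<gamma> x)) (Y (T x))) = (indicator A (Y x) :: ennreal)"
      using eq by eventually_elim (simp add: retract_id)
  qed
  also have "\<dots> = emeasure (distr P X Y) A" by (rule emeasure_distr_indicator[OF Y A, symmetric])
  finally show "emeasure (distr (\<mu> \<Otimes>\<^sub>M distr P X Y) X (\<lambda>(g, x). a (retract g) x)) A = emeasure (distr P X Y) A" .
qed simp

text \<open>
  An invariant event \<open>D\<close> depends on \<open>T\<close> alone, hence conditioning on it does not affect the law of \<open>\<gamma>\<close> nor
  its independence of \<open>T\<close>.
\<close>

lemma system_restrict:
  assumes D [measurable]: "D \<in> sets P" and inv: "\<And>x. x \<in> space P \<Longrightarrow> T x \<in> D \<longleftrightarrow> x \<in> D" and pos: "measure P D > 0"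
  shows "walk_system W \<pi> \<mu> (uniform_measure P D) T \<gamma>"
proof -
  have e: "emeasure P D \<noteq> 0" "emeasure P D \<noteq> \<infinity>" using pos by (auto simp: P.emeasure_eq_measure)
  have lw: "(\<integral>\<^sup>+x. h (\<gamma> x, T x) \<partial>uniform_measure P D) = (\<integral>\<^sup>+g. \<integral>\<^sup>+x. h (g, x) \<partial>uniform_measure P D \<partial>\<mu>)"
    if "h \<in> borel_measurable (\<mu> \<Otimes>\<^sub>M uniform_measure P D)" for h
  proof -
    have h [measurable]: "h \<in> borel_measurable (\<mu> \<Otimes>\<^sub>M P)"
      using that by (simp add: measurable_cong_sets[OF sets_pair_measure_cong[OF refl sets_uniform_measure] refl])
    have "(\<integral>\<^sup>+x. h (\<gamma> x, T x) \<partial>uniform_measure P D) = (\<integral>\<^sup>+x. h (\<gamma> x, T x) * indicator D x \<partial>P) / emeasure P D"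
      by (rule nn_integral_uniform_measure) measurable
    also have "(\<integral>\<^sup>+x. h (\<gamma> x, T x) * indicator D x \<partial>P) = (\<integral>\<^sup>+x. (\<lambda>p. h p * indicator D (snd p)) (\<gamma> x, T x) \<partial>P)"
      using inv by (intro nn_integral_cong) (auto simp: indicator_def)
    also have "\<dots> = (\<integral>\<^sup>+g. \<integral>\<^sup>+x. h (g, x) * indicator D x \<partial>P \<partial>\<mu>)"
      by (subst law) auto
    also have "\<dots> / emeasure P D = (\<integral>\<^sup>+g. (\<integral>\<^sup>+x. h (g, x) * indicator D x \<partial>P) / emeasure P D \<partial>\<mu>)"
      by (rule nn_integral_divide[symmetric]) measurable
    also have "\<dots> = (\<integral>\<^sup>+g. \<integral>\<^sup>+x. h (g, x) \<partial>uniform_measure P D \<partial>\<mu>)"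
    proof (rule nn_integral_cong)
      fix g assume "g \<in> space \<mu>"
      then have "(\<lambda>x. h (g, x)) \<in> borel_measurable P" by (rule measurable_Pair2[OF h])
      then show "(\<integral>\<^sup>+x. h (g, x) * indicator D x \<partial>P) / emeasure P D = (\<integral>\<^sup>+x. h (g, x) \<partial>uniform_measure P D)"
        by (rule nn_integral_uniform_measure[symmetric, OF _ D])
    qed
    finally show ?thesis .
  qed
  show ?thesis
  proof (intro walk_system.intro walk_system_axioms.intro mu_space_axioms lw)
    show "prob_space (uniform_measure P D)" using e by (rule prob_space_uniform_measure)
    show "T \<in> uniform_measure P D \<rightarrow>\<^sub>M uniform_measure P D"
      using T_meas by (simp add: measurable_cong_sets[OF sets_uniform_measure sets_uniform_measure])
    show "\<gamma> \<in> uniform_measure P D \<rightarrow>\<^sub>M \<mu>"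
      using gamma_mu by (simp add: measurable_cong_sets[OF sets_uniform_measure refl])
  qed (auto intro: gamma_stab)
qed

end

locale ergodic_system = walk_system W \<pi> \<mu> P T \<gamma>
  for W :: "('k::{real_normed_field,euclidean_space}^'n) set" and \<pi> \<mu> and P :: "'w measure" and T \<gamma> +
  fixes \<nu>' :: "('k^'n) set set measure" and C :: "'w \<Rightarrow> ('k^'n) set set"
  assumes erg: "ergodic act_quot \<mu> (proj_quot W) \<nu>'"
    and C_meas [measurable]: "C \<in> P \<rightarrow>\<^sub>M proj_quot W"
    and C_law: "distr P (proj_quot W) C = \<nu>'"
    and C_eq: "AE x in P. C x = act_quot (\<gamma> x) (C (T x))"
begin

lemma sets_nu: "sets \<nu>' = sets (proj_quot W)" using C_law by auto

lemma C_space: "x \<in> space P \<Longrightarrow> C x \<in> space (proj_quot W)"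
  by (rule measurable_space[OF C_meas])

lemma stationary_restrict:
  assumes "D \<in> sets P" "\<And>x. x \<in> space P \<Longrightarrow> T x \<in> D \<longleftrightarrow> x \<in> D" "measure P D > 0"
  shows "stationary act_quot \<mu> (proj_quot W) (distr (uniform_measure P D) (proj_quot W) C)"
proof -
  interpret D: walk_system W \<pi> \<mu> "uniform_measure P D" T \<gamma> by (rule system_restrict[OF assms])
  have Cm: "C \<in> uniform_measure P D \<rightarrow>\<^sub>M proj_quot W"
    using C_meas by (simp add: measurable_cong_sets[OF sets_uniform_measure refl])
  have "AE x in uniform_measure P D. C x = act_quot (\<gamma> x) (C (T x))"
    using C_eq by (intro AE_uniform_measureI assms(1)) auto
  then have "distr (\<mu> \<Otimes>\<^sub>M distr (uniform_measure P D) (proj_quot W) C) (proj_quot W) (\<lambda>(g, x). act_quot (retract g) x) =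
     distr (uniform_measure P D) (proj_quot W) C"
    by (intro D.system_stationary Cm act_quot_measurable)
  then show ?thesis unfolding stationary_quot_iff using D.P.prob_space_distr[OF Cm] by simp
qed

text \<open>
  The laws of \<open>C\<close> conditioned on \<open>D\<close> and on its complement are stationary by \<open>stationary_restrict\<close> and \<open>\<nu>'\<close>
  is a convex combination of them. As \<open>\<nu>'\<close> is extremal, both are equal to \<open>\<nu>'\<close>.
\<close>

lemma indep_C:
  assumes D [measurable]: "D \<in> sets P" and inv: "\<And>x. x \<in> space P \<Longrightarrow> T x \<in> D \<longleftrightarrow> x \<in> D"
    and A [measurable]: "A \<in> sets (proj_quot W)"
  shows "measure P (C -` A \<inter> space P \<inter> D) = measure P D * measure \<nu>' A"
proof -
  have nuA: "measure \<nu>' A = measure P (C -` A \<inter> space P)" unfolding C_law[symmetric] by (simp add: measure_distr)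
  have CA [measurable]: "C -` A \<inter> space P \<in> sets P" by measurable
  define D' where "D' = space P - D"
  have D' [measurable]: "D' \<in> sets P" by (auto simp: D'_def)
  have inv': "T x \<in> D' \<longleftrightarrow> x \<in> D'" if "x \<in> space P" for x using inv[OF that] T_space[OF that] that by (simp add: D'_def)
  have PD': "measure P D' = 1 - measure P D" unfolding D'_def using P.prob_compl[OF D] .
  have split: "measure P (C -` B \<inter> space P) = measure P (C -` B \<inter> space P \<inter> D) + measure P (C -` B \<inter> space P \<inter> D')"
    if [measurable]: "B \<in> sets (proj_quot W)" for B
  proof -
    have [measurable]: "C -` B \<inter> space P \<in> sets P" by measurable
    have "C -` B \<inter> space P = (C -` B \<inter> space P \<inter> D) \<union> (C -` B \<inter> space P \<inter> D')" by (auto simp: D'_def)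
    then have "measure P (C -` B \<inter> space P) = measure P ((C -` B \<inter> space P \<inter> D) \<union> (C -` B \<inter> space P \<inter> D'))" by simp
    also have "\<dots> = measure P (C -` B \<inter> space P \<inter> D) + measure P (C -` B \<inter> space P \<inter> D')"
      by (rule P.finite_measure_Union) (auto simp: D'_def)
    finally show ?thesis .
  qed
  consider "measure P D = 0" | "measure P D' = 0" | "measure P D > 0" "measure P D' > 0"
    using zero_less_measure_iff[of P D] zero_less_measure_iff[of P D'] by blast
  then show ?thesis
  proof cases
    case 1
    have "measure P (C -` A \<inter> space P \<inter> D) \<le> measure P D" by (rule P.finite_measure_mono) auto
    then show ?thesis using 1 measure_nonneg[of P "C -` A \<inter> space P \<inter> D"] by simp
  next
    case 2
    have "measure P (C -` A \<inter> space P \<inter> D') \<le> measure P D'" by (rule P.finite_measure_mono) auto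
    then have "measure P (C -` A \<inter> space P \<inter> D') = 0" using 2 measure_nonneg[of P "C -` A \<inter> space P \<inter> D'"] by simp
    moreover have "measure P D = 1" using 2 PD' by simp
    ultimately show ?thesis using split[OF A] nuA by simp
  next
    case 3
    let ?n = "\<lambda>D. distr (uniform_measure P D) (proj_quot W) C"
    have me: "measure (?n E) B = measure P (C -` B \<inter> space P \<inter> E) / measure P E"
      if [measurable]: "E \<in> sets P" "B \<in> sets (proj_quot W)" and "measure P E > 0" for E B
    proof -
      have Cm: "C \<in> uniform_measure P E \<rightarrow>\<^sub>M proj_quot W"
        using C_meas by (simp add: measurable_cong_sets[OF sets_uniform_measure refl])
      have "measure (?n E) B = measure (uniform_measure P E) (C -` B \<inter> space P)"
        by (simp add: measure_distr[OF Cm])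
      also have "\<dots> = measure P (E \<inter> (C -` B \<inter> space P)) / measure P E"
        using that(3) by (intro measure_uniform_measure) (auto simp: P.emeasure_eq_measure)
      finally show ?thesis by (simp add: Int_commute Int_left_commute)
    qed
    have "?n D = \<nu>' \<and> ?n D' = \<nu>'"
    proof (rule erg[unfolded ergodic_def, THEN conjunct2, rule_format, of "?n D" "?n D'" "measure P D"], intro conjI ballI)
      show "stationary act_quot \<mu> (proj_quot W) (?n D)" by (rule stationary_restrict[OF D inv 3(1)])
      show "stationary act_quot \<mu> (proj_quot W) (?n D')" by (rule stationary_restrict[OF D' inv' 3(2)])
      show "0 < measure P D" "measure P D < 1" using 3 PD' by auto
      fix B assume B: "B \<in> sets (proj_quot W)"
      have "measure \<nu>' B = measure P (C -` B \<inter> space P)" unfolding C_law[symmetric] using B by (simp add: measure_distr)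
      also have "\<dots> = measure P D * measure (?n D) B + measure P D' * measure (?n D') B"
        using 3 by (simp add: split[OF B] me[OF D B] me[OF D' B])
      finally show "measure \<nu>' B = measure P D * measure (?n D) B + (1 - measure P D) * measure (?n D') B"
        by (simp add: PD')
    qed
    then have "measure (?n D) A = measure \<nu>' A" by simp
    then show ?thesis using me[OF D A 3(1)] 3(1) by (simp add: field_simps)
  qed
qed

subsection \<open>Decay of the contraction rate\<close>

definition \<alpha> :: real where "\<alpha> = cocycle_average \<mu> W \<nu>'"

text \<open>
  The increment of the cocycle in the last step of the trajectory.
\<close>

definition log_factor :: "'w \<Rightarrow> real" where "log_factor x = cocycle W (\<gamma> x) (C (T x))"

lemma log_factor_retract: "x \<in> space P \<Longrightarrow> log_factor x = cocycle W (retract (\<gamma> x)) (C (T x))"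
  by (simp add: log_factor_def retract_id gamma_stab)

lemma pair_C_measurable: "(\<lambda>p. (fst p, C (snd p))) \<in> \<mu> \<Otimes>\<^sub>M P \<rightarrow>\<^sub>M \<mu> \<Otimes>\<^sub>M proj_quot W"
  by (intro measurable_Pair measurable_fst measurable_compose[OF measurable_snd C_meas])

lemma cocycle_C_measurable: "(\<lambda>p. cocycle W (retract (fst p)) (C (snd p))) \<in> borel_measurable (\<mu> \<Otimes>\<^sub>M P)"
  using measurable_compose[OF pair_C_measurable cocycle_measurable] by simp

lemma log_factor_measurable [measurable]: "log_factor \<in> borel_measurable P"
proof -
  have m: "(\<lambda>x. (\<gamma> x, T x)) \<in> P \<rightarrow>\<^sub>M \<mu> \<Otimes>\<^sub>M P" by measurable
  have "(\<lambda>x. cocycle W (retract (\<gamma> x)) (C (T x))) \<in> borel_measurable P"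
    using measurable_compose[OF m cocycle_C_measurable] by simp
  then show ?thesis by (rule measurable_cong[THEN iffD1, rotated]) (simp add: log_factor_retract)
qed

lemma integrable_log_factor: "integrable P log_factor"
proof (rule Bochner_Integration.integrable_bound[OF integrable_log_gamma log_factor_measurable])
  show "AE x in P. norm (log_factor x) \<le> norm (log_norm (\<gamma> x))"
  proof (rule AE_I2)
    fix x assume x: "x \<in> space P"
    have "\<bar>log_factor x\<bar> \<le> log_norm (\<gamma> x)"
      unfolding log_factor_def by (rule cocycle_bound[OF gamma_stab[OF x] C_space[OF T_space[OF x]]])
    then show "norm (log_factor x) \<le> norm (log_norm (\<gamma> x))" by simp
  qed
qed

lemma indep_C_integral:
  fixes u :: "_ \<Rightarrow> real"
  assumes D [measurable]: "D \<in> sets P" and inv: "\<And>x. x \<in> space P \<Longrightarrow> T x \<in> D \<longleftrightarrow> x \<in> D"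
    and u [measurable]: "u \<in> borel_measurable (proj_quot W)"
  shows "(\<integral>x. indicator D x * u (C x) \<partial>P) = measure P D * (\<integral>x. u x \<partial>\<nu>')"
proof -
  interpret nu: prob_space \<nu>' unfolding C_law[symmetric] by (rule P.prob_space_distr[OF C_meas])
  let ?N = "density P (indicator D)"
  have Cm: "C \<in> ?N \<rightarrow>\<^sub>M proj_quot W" using C_meas by simp
  have "distr ?N (proj_quot W) C = density \<nu>' (\<lambda>_. ennreal (measure P D))"
  proof (rule measure_eqI)
    fix A assume "A \<in> sets (distr ?N (proj_quot W) C)"
    then have A [measurable]: "A \<in> sets (proj_quot W)" by simp
    have CA [measurable]: "C -` A \<inter> space P \<in> sets P" by measurable
    have "emeasure (distr ?N (proj_quot W) C) A = emeasure ?N (C -` A \<inter> space P)"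
      using emeasure_distr[OF Cm A] by simp
    also have "\<dots> = (\<integral>\<^sup>+x. indicator D x * indicator (C -` A \<inter> space P) x \<partial>P)"
      by (rule emeasure_density) measurable
    also have "\<dots> = (\<integral>\<^sup>+x. indicator (C -` A \<inter> space P \<inter> D) x \<partial>P)"
      by (intro nn_integral_cong) (auto simp: indicator_def)
    also have "\<dots> = emeasure P (C -` A \<inter> space P \<inter> D)" by (rule nn_integral_indicator) measurable
    also have "\<dots> = emeasure (density \<nu>' (\<lambda>_. ennreal (measure P D))) A"
      using A by (simp add: emeasure_density_const sets_nu P.emeasure_eq_measure nu.emeasure_eq_measure indep_C[OF D inv A] ennreal_mult)
    finally show "emeasure (distr ?N (proj_quot W) C) A = emeasure (density \<nu>' (\<lambda>_. ennreal (measure P D))) A" .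
  qed (simp add: sets_nu)
  note law = this
  have um: "(\<lambda>x. u (C x)) \<in> borel_measurable P" by measurable
  have "(\<integral>x. indicator D x * u (C x) \<partial>P) = (\<integral>x. u (C x) \<partial>density P (\<lambda>x. ennreal (indicator D x)))"
    by (subst integral_density[OF um]) auto
  also have "(\<lambda>x. ennreal (indicator D x)) = (indicator D :: _ \<Rightarrow> ennreal)"
    by (simp add: fun_eq_iff ennreal_indicator)
  also have "(\<integral>x. u (C x) \<partial>?N) = (\<integral>x. u x \<partial>distr ?N (proj_quot W) C)"
    by (rule integral_distr[OF Cm u, symmetric])
  also have "\<dots> = measure P D * (\<integral>x. u x \<partial>\<nu>')"
    unfolding law using u by (subst integral_density) (auto simp: measurable_cong_sets[OF sets_nu refl])
  finally show ?thesis .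
qed

text \<open>
  On an invariant event \<open>D\<close>, the increment is integrated first over the matrix, which is independent of
  \<open>C \<circ> T\<close> and of \<open>D\<close>, and then over \<open>C\<close>, which is independent of \<open>D\<close> by \<open>indep_C\<close>.
\<close>

lemma birkhoff_log_factor: "AE x in P. (\<lambda>n. (\<Sum>i<n. log_factor ((T ^^ i) x)) / real n) \<longlonglongrightarrow> \<alpha>"
proof (rule birkhoff[OF integrable_log_factor])
  fix D assume D [measurable]: "D \<in> sets P" and inv: "\<And>x. x \<in> space P \<Longrightarrow> T x \<in> D \<longleftrightarrow> x \<in> D"
  interpret pp: pair_prob_space \<mu> P ..
  let ?k = "\<lambda>p. cocycle W (retract (fst p)) (C (snd p)) * indicator D (snd p)"
  have km: "?k \<in> borel_measurable (\<mu> \<Otimes>\<^sub>M P)"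
    by (intro borel_measurable_times cocycle_C_measurable measurable_compose[OF measurable_snd borel_measurable_indicator[OF D]])
  have eq: "log_factor x * indicator D x = ?k (\<gamma> x, T x)" if "x \<in> space P" for x
    using inv[OF that] by (simp add: log_factor_retract[OF that] indicator_def)
  have ki: "integrable P (\<lambda>x. ?k (\<gamma> x, T x))"
    using integrable_real_mult_indicator[OF D integrable_log_factor] eq
    by (simp cong: Bochner_Integration.integrable_cong)
  have "(\<integral>x. log_factor x * indicator D x \<partial>P) = (\<integral>x. ?k (\<gamma> x, T x) \<partial>P)"
    by (rule Bochner_Integration.integral_cong[OF refl eq])
  also have "\<dots> = (\<integral>p. ?k p \<partial>(\<mu> \<Otimes>\<^sub>M P))" by (rule law_integral(1)[OF km ki])
  also have "\<dots> = (\<integral>x. (\<integral>g. cocycle W (retract g) (C x) * indicator D x \<partial>\<mu>) \<partial>P)"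
    using pp.integral_snd[of "\<lambda>g x. cocycle W (retract g) (C x) * indicator D x"] law_integral(2)[OF km ki]
    by (simp add: split_beta')
  also have "\<dots> = (\<integral>x. indicator D x * (\<integral>g. cocycle W (retract g) (C x) \<partial>\<mu>) \<partial>P)"
    by (simp add: mult.commute)
  also have "\<dots> = measure P D * (\<integral>x. (\<integral>g. cocycle W (retract g) x \<partial>\<mu>) \<partial>\<nu>')"
  proof (rule indep_C_integral[OF D inv])
    show "(\<lambda>x. \<integral>g. cocycle W (retract g) x \<partial>\<mu>) \<in> borel_measurable (proj_quot W)"
    proof (rule mu.borel_measurable_lebesgue_integral)
      have "(\<lambda>p. (snd p, fst p)) \<in> proj_quot W \<Otimes>\<^sub>M \<mu> \<rightarrow>\<^sub>M \<mu> \<Otimes>\<^sub>M proj_quot W"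
        by (intro measurable_Pair measurable_fst measurable_snd)
      from measurable_compose[OF this cocycle_measurable]
      show "(\<lambda>(x, g). cocycle W (retract g) x) \<in> borel_measurable (proj_quot W \<Otimes>\<^sub>M \<mu>)"
        by (simp add: split_beta')
    qed
  qed
  also have "\<dots> = \<alpha> * measure P D" by (simp add: \<alpha>_def cocycle_average_eq[OF sets_nu])
  finally show "(\<integral>x. log_factor x * indicator D x \<partial>P) = \<alpha> * measure P D" .
qed

text \<open>
  The terms of a sequence whose averages converge are of smaller order than \<open>n\<close>.
\<close>

lemma log_gamma_sublinear:
  "AE x in P. \<forall>\<delta>>0. \<forall>\<^sub>F n in sequentially. log_norm (\<gamma> ((T ^^ n) x)) \<le> \<delta> * real n"
proof -
  let ?f = "\<lambda>x. log_norm (\<gamma> x)"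
  have "AE x in P. (\<lambda>n. (\<Sum>i<n. ?f ((T ^^ i) x)) / real n) \<longlonglongrightarrow> (\<integral>g. log_norm g \<partial>\<mu>)"
  proof (rule birkhoff[OF integrable_log_gamma])
    fix D assume D [measurable]: "D \<in> sets P" and inv: "\<And>x. x \<in> space P \<Longrightarrow> T x \<in> D \<longleftrightarrow> x \<in> D"
    interpret pp: pair_prob_space \<mu> P ..
    let ?k = "\<lambda>p. log_norm (fst p) * indicator D (snd p)"
    have lm: "log_norm \<in> borel_measurable \<mu>" using int_log_norm by auto
    have km: "?k \<in> borel_measurable (\<mu> \<Otimes>\<^sub>M P)"
      by (intro borel_measurable_times measurable_compose[OF measurable_fst lm] measurable_compose[OF measurable_snd borel_measurable_indicator[OF D]])
    have eq: "?f x * indicator D x = ?k (\<gamma> x, T x)" if "x \<in> space P" for x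
      using inv[OF that] by (simp add: indicator_def)
    have ki: "integrable P (\<lambda>x. ?k (\<gamma> x, T x))"
      using integrable_real_mult_indicator[OF D integrable_log_gamma] eq
      by (simp cong: Bochner_Integration.integrable_cong)
    have "(\<integral>x. ?f x * indicator D x \<partial>P) = (\<integral>x. ?k (\<gamma> x, T x) \<partial>P)"
      by (rule Bochner_Integration.integral_cong[OF refl eq])
    also have "\<dots> = (\<integral>p. ?k p \<partial>(\<mu> \<Otimes>\<^sub>M P))" by (rule law_integral(1)[OF km ki])
    also have "\<dots> = (\<integral>x. (\<integral>g. log_norm g * indicator D x \<partial>\<mu>) \<partial>P)"
      using pp.integral_snd[of "\<lambda>g x. log_norm g * indicator D x"] law_integral(2)[OF km ki]
      by (simp add: split_beta')
    also have "\<dots> = (\<integral>g. log_norm g \<partial>\<mu>) * measure P D" by simp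
    finally show "(\<integral>x. ?f x * indicator D x \<partial>P) = (\<integral>g. log_norm g \<partial>\<mu>) * measure P D" .
  qed
  then show ?thesis
  proof eventually_elim
    case (elim x)
    let ?S = "\<lambda>n. (\<Sum>i<n. ?f ((T ^^ i) x))"
    have "(\<lambda>n. ?S (Suc n) / real (Suc n) * (1 + 1 / real n) - ?S n / real n) \<longlonglongrightarrow> (\<integral>g. log_norm g \<partial>\<mu>) * (1 + 0) - (\<integral>g. log_norm g \<partial>\<mu>)"
      by (intro tendsto_intros elim LIMSEQ_Suc[OF elim] lim_1_over_n)
    then have lim: "(\<lambda>n. ?S (Suc n) / real (Suc n) * (1 + 1 / real n) - ?S n / real n) \<longlonglongrightarrow> 0" by simp
    show ?case
    proof (intro allI impI)
      fix \<delta> :: real assume "\<delta> > 0"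
      from order_tendstoD(2)[OF lim this] eventually_gt_at_top[of 0]
      show "\<forall>\<^sub>F n in sequentially. ?f ((T ^^ n) x) \<le> \<delta> * real n"
      proof eventually_elim
        case (elim n)
        have "?S (Suc n) / real (Suc n) * (1 + 1 / real n) - ?S n / real n = ?f ((T ^^ n) x) / real n"
        proof -
          have "1 + 1 / real n = real (Suc n) / real n" using elim(2) by (simp add: field_simps)
          then have "?S (Suc n) / real (Suc n) * (1 + 1 / real n) = ?S (Suc n) / real n" by simp
          then show ?thesis by (simp add: add_divide_distrib)
        qed
        then have "?f ((T ^^ n) x) / real n < \<delta>" using elim(1) by simp
        then show ?case using elim(2) by (simp add: field_simps)
      qed
    qed
  qed
qed

text \<open>
  The base point \<open>c\<^sub>n\<close> in the fibre over \<open>C \<circ> T\<^sup>n\<close>.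
\<close>

definition rep :: "nat \<Rightarrow> 'w \<Rightarrow> 'k^'n" where "rep n x = \<sigma> (C ((T ^^ n) x))"

text \<open>
  The trajectories whose points all move by the matrices of the trajectory.
\<close>

definition regular :: "'w \<Rightarrow> bool" where
  "regular x \<longleftrightarrow> x \<in> space P \<and> (\<forall>n. C ((T ^^ n) x) = act_quot (\<gamma> ((T ^^ n) x)) (C ((T ^^ Suc n) x)))"

lemma AE_regular: "AE x in P. regular x"
proof -
  have "AE x in P. C ((T ^^ n) x) = act_quot (\<gamma> ((T ^^ n) x)) (C ((T ^^ Suc n) x))" for n
    using AE_iter[OF C_eq, of n] by simp
  then have "AE x in P. \<forall>n. C ((T ^^ n) x) = act_quot (\<gamma> ((T ^^ n) x)) (C ((T ^^ Suc n) x))"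
    by (simp only: AE_all_countable) blast
  then show ?thesis by (rule AE_mp) (intro AE_I2, simp add: regular_def)
qed

text \<open>
  In the step from time \<open>n + 1\<close> to \<open>n\<close>, the matrix maps \<open>c\<^sub>n\<^sub>+\<^sub>1\<close> to \<open>factor n\<close> times \<open>c\<^sub>n\<close>, up to a vector of
  \<open>W\<close>; see \<open>step_rep\<close>. The product of these scalars is the one by which the linear part of the affine
  action of \<open>bwd n\<close> is divided.
\<close>

definition factor :: "nat \<Rightarrow> 'w \<Rightarrow> 'k" where "factor n x = \<theta> (\<gamma> ((T ^^ n) x) *v rep (Suc n) x)"
definition factors :: "nat \<Rightarrow> 'w \<Rightarrow> 'k" where "factors n x = (\<Prod>i<n. factor i x)"

lemma rep_props:
  assumes "x \<in> space P"
  shows "rep n x \<notin> W" "qline (rep n x) = C ((T ^^ n) x)" "infdist (rep n x) W = 1" "\<pi> (rep n x) = rep n x"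
  unfolding rep_def by (intro sigma_notin C_space iter_space assms)+

lemma norm_factor: assumes "x \<in> space P" shows "norm (factor n x) = exp (log_factor ((T ^^ n) x))"
proof -
  have Tn: "(T ^^ n) x \<in> space P" using assms by (rule iter_space)
  have "T ((T ^^ n) x) = (T ^^ Suc n) x" by simp
  then have "log_factor ((T ^^ n) x) = ln (infdist (\<gamma> ((T ^^ n) x) *v rep (Suc n) x) W)"
    unfolding log_factor_def rep_def using cocycle_sigma[OF gamma_stab[OF Tn] C_space[OF T_space[OF Tn]]] by simp
  moreover have "infdist (\<gamma> ((T ^^ n) x) *v rep (Suc n) x) W > 0"
    by (intro infdist_pos) (simp only: stab_in_W[OF gamma_stab[OF Tn]] rep_props[OF assms] not_False_eq_True)
  ultimately show ?thesis by (simp add: factor_def norm_theta)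
qed

lemma norm_factors: assumes "x \<in> space P" shows "norm (factors n x) = exp (\<Sum>i<n. log_factor ((T ^^ i) x))"
  by (simp add: factors_def prod_norm[symmetric] norm_factor[OF assms] exp_sum)

lemma step_rep:
  assumes "regular x"
  shows "\<gamma> ((T ^^ n) x) *v rep (Suc n) x - factor n x *s rep n x \<in> W"
proof -
  have x: "x \<in> space P" and e: "C ((T ^^ n) x) = act_quot (\<gamma> ((T ^^ n) x)) (C ((T ^^ Suc n) x))"
    using assms by (auto simp: regular_def)
  let ?v = "\<gamma> ((T ^^ n) x) *v rep (Suc n) x"
  have g: "\<gamma> ((T ^^ n) x) \<in> stab W" by (intro gamma_stab iter_space x)
  have v: "?v \<notin> W" using rep_props(1)[OF x] stab_in_W[OF g] by blast
  have "C ((T ^^ n) x) = act_quot (\<gamma> ((T ^^ n) x)) (qline (rep (Suc n) x))"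
    unfolding rep_props(2)[OF x, of "Suc n"] by (rule e)
  also have "\<dots> = qline ?v" by (rule act_qline[OF g])
  finally have "rep n x = normal (\<pi> ?v)" using sigma_qline[OF v] by (simp only: rep_def[of n])
  then have "factor n x *s rep n x = \<pi> ?v"
    using theta_eq_0[of ?v] v by (simp add: normal_def theta_pi factor_def)
  moreover have "?v - \<pi> ?v \<in> W" using W_scale[OF retr[of ?v], of "-1"] by simp
  ultimately show ?thesis by simp
qed

text \<open>
  The translation part of the affine action of the step from time \<open>n + 1\<close> to \<open>n\<close>, before division by
  \<open>factor n\<close>.
\<close>

definition offset :: "nat \<Rightarrow> 'w \<Rightarrow> 'k^'n" where
  "offset n x = \<gamma> ((T ^^ n) x) *v rep (Suc n) x - factor n x *s rep n x"

lemma regular_space: "regular x \<Longrightarrow> x \<in> space P" by (simp add: regular_def)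

lemma offset_in_W: "regular x \<Longrightarrow> offset n x \<in> W" unfolding offset_def by (rule step_rep)

lemma bwd_step:
  "bwd (Suc n) x *v rep (Suc n) x = factor n x *s (bwd n x *v rep n x) + bwd n x *v offset n x"
proof -
  have "bwd (Suc n) x = bwd n x ** \<gamma> ((T ^^ n) x)" using bwd_add[of n 1 x] by simp
  then have "bwd (Suc n) x *v rep (Suc n) x = bwd n x *v (factor n x *s rep n x + offset n x)"
    by (simp add: offset_def matrix_vector_mul_assoc)
  then show ?thesis by (simp add: matrix_vector_right_distrib vector_scalar_commute)
qed

text \<open>
  Up to vectors of \<open>W\<close>, to which \<open>\<theta>\<close> is insensitive, every step multiplies the base point by \<open>factor\<close>.
\<close>

lemma theta_bwd: assumes "regular x" shows "\<theta> (bwd n x *v rep n x) = factors n x"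
proof (induction n)
  case 0
  have x: "x \<in> space P" by (rule regular_space[OF assms])
  obtain v where v: "v \<notin> W" "C x = qline v" using C_space[OF x] by (auto simp: space_proj_quot)
  then have "rep 0 x = normal (\<pi> v)" by (simp add: rep_def sigma_qline)
  then show ?case using v by (simp add: factors_def theta_normal pi_in_W)
next
  case (Suc n)
  have "bwd n x *v offset n x \<in> W"
    by (intro stabD(2)[OF bwd_stab] regular_space offset_in_W assms)
  then show ?case unfolding bwd_step using Suc by (simp add: theta_add_W theta_scale factors_def)
qed

text \<open>
  The norm of the linear part of the affine action of \<open>bwd n\<close> from the fibre over \<open>C \<circ> T\<^sup>n\<close> to that over \<open>C\<close>.
\<close>

definition \<kappa> :: "nat \<Rightarrow> 'w \<Rightarrow> real" where "\<kappa> n x = onorm_on W (bwd n x) / norm (factors n x)"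

text \<open>
  If \<open>W = {0}\<close> the fibres are points and \<open>\<kappa>\<close> vanishes. Otherwise \<open>ln (\<kappa> n) / n\<close> converges to
  \<open>exponent - \<alpha>\<close> by \<open>kingman_bwd\<close> and \<open>birkhoff_log_factor\<close>.
\<close>

lemma kappa_decay:
  assumes gap: "W = {0} \<or> exponent < \<alpha>"
  shows "AE x in P. \<exists>\<delta>>0. \<forall>\<^sub>F n in sequentially. \<kappa> n x \<le> exp (- \<delta> * real n)"
proof (cases "W = {0}")
  case True
  have "onorm_on W g = 0" for g
    using onorm_on_bound[of g 0] onorm_on_nonneg[of g] True by auto
  then have "\<kappa> n x \<le> exp (- 1 * real n)" for n x by (simp add: \<kappa>_def)
  then show ?thesis by (intro AE_I2 exI[of _ 1]) (auto intro: always_eventually)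
next
  case False
  then have gap: "exponent < \<alpha>" using gap by simp
  define \<delta> where "\<delta> = (\<alpha> - exponent) / 3"
  have d: "\<delta> > 0" using gap by (simp add: \<delta>_def)
  have "AE x in P. x \<in> space P" by (rule AE_I2)
  with birkhoff_log_factor kingman_bwd[OF False] show ?thesis
  proof eventually_elim
    case (elim x)
    have pos: "onorm_on W (bwd n x) > 0" for n
      by (intro onorm_on_pos False stabD(1) bwd_stab elim(3))
    have "\<forall>\<^sub>F n in sequentially. ln (onorm_on W (bwd n x)) / real n < exponent + \<delta>"
      using d by (intro order_tendstoD(2)[OF elim(2)]) auto
    moreover have "\<forall>\<^sub>F n in sequentially. \<alpha> - \<delta> < (\<Sum>i<n. log_factor ((T ^^ i) x)) / real n"
      using d by (intro order_tendstoD(1)[OF elim(1)]) auto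
    ultimately have "\<forall>\<^sub>F n in sequentially. \<kappa> n x \<le> exp (- \<delta> * real n)"
      using eventually_gt_at_top[of 0]
    proof eventually_elim
      case (elim n)
      let ?S = "\<Sum>i<n. log_factor ((T ^^ i) x)"
      have "ln (onorm_on W (bwd n x)) < (exponent + \<delta>) * real n" "(\<alpha> - \<delta>) * real n < ?S"
        using elim by (simp_all add: field_simps)
      moreover have "(exponent + \<delta>) * real n - (\<alpha> - \<delta>) * real n = - \<delta> * real n"
        by (simp add: \<delta>_def field_simps)
      ultimately have "ln (onorm_on W (bwd n x)) - ?S \<le> - \<delta> * real n" by linarith
      then have "exp (ln (onorm_on W (bwd n x)) - ?S) \<le> exp (- \<delta> * real n)" by simp
      then show ?case using pos[of n] by (simp add: \<kappa>_def norm_factors[OF \<open>x \<in> space P\<close>] exp_diff)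
    qed
    then show ?case using d by blast
  qed
qed

end

section \<open>Stationary extensions\<close>

lemma distr_pair_distr:
  assumes M: "prob_space M" and n: "prob_space n" and s: "s \<in> n \<rightarrow>\<^sub>M N"
    and f: "(\<lambda>(g, x). f g x) \<in> M \<Otimes>\<^sub>M N \<rightarrow>\<^sub>M L"
  shows "distr (M \<Otimes>\<^sub>M distr n N s) L (\<lambda>(g, x). f g x) = distr (M \<Otimes>\<^sub>M n) L (\<lambda>(g, x). f g (s x))"
proof -
  interpret M: prob_space M by fact
  interpret n: prob_space n by fact
  interpret d: prob_space "distr n N s" by (rule n.prob_space_distr[OF s])
  have id: "(\<lambda>g. g) \<in> M \<rightarrow>\<^sub>M M" by (rule measurable_ident_sets[OF refl])
  have "distr M M (\<lambda>g. g) \<Otimes>\<^sub>M distr n N s = distr (M \<Otimes>\<^sub>M n) (M \<Otimes>\<^sub>M N) (\<lambda>(g, x). (g, s x))"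
    using pair_measure_distr[OF id s d.sigma_finite_measure_axioms] .
  then have e: "M \<Otimes>\<^sub>M distr n N s = distr (M \<Otimes>\<^sub>M n) (M \<Otimes>\<^sub>M N) (\<lambda>(g, x). (g, s x))"
    by (simp add: distr_id2)
  have m: "(\<lambda>(g, x). (g, s x)) \<in> M \<Otimes>\<^sub>M n \<rightarrow>\<^sub>M M \<Otimes>\<^sub>M N"
    unfolding split_beta' by (intro measurable_Pair measurable_fst measurable_compose[OF measurable_snd s])
  show ?thesis unfolding e by (subst distr_distr[OF f m]) (simp add: comp_def split_beta')
qed

lemma open_invertible: "open {g :: 'k::{real_normed_field,euclidean_space}^'n^'n. invertible g}"
proof -
  have "continuous_on UNIV (\<lambda>g :: 'k^'n^'n. det g)"
    unfolding det_def by (intro continuous_intros)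
  then have "open {g :: 'k^'n^'n. det g \<noteq> 0}" by (intro open_Collect_neq continuous_on_const)
  then show ?thesis by (simp add: invertible_det_nz)
qed

context mu_space
begin

lemma retract_borel_borel: "retract \<in> borel \<rightarrow>\<^sub>M borel" "retract \<in> borel \<rightarrow>\<^sub>M \<mu>"
proof -
  have "stab W = {g. invertible g} \<inter> {g. \<forall>w\<in>W. g *v w \<in> W}" by (auto simp: stab_def)
  also have "\<dots> \<in> sets borel" by (intro sets.Int borel_open open_invertible borel_closed closed_preserve)
  finally have "{g \<in> space borel. g \<in> stab W} \<in> sets borel" by simp
  then show 1: "retract \<in> borel \<rightarrow>\<^sub>M borel" unfolding retract_def[abs_def] by (intro measurable_If measurable_ident_sets refl measurable_const) auto
  show "retract \<in> borel \<rightarrow>\<^sub>M \<mu>" by (rule measurable_to_mu[OF 1]) (rule stabD(1)[OF retract_stab])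
qed

text \<open>
  A stationary Markov chain on a Polish space can be run backwards forever. Starting from the
  stationary law and prepending \<open>N\<close> steps gives a measure \<open>pl N\<close> on sequences of pairs (matrix, state)
  in which the first \<open>N\<close> entries are the last \<open>N\<close> steps. By stationarity (\<open>cons\<close>) these finite marginals
  are consistent, so that Kolmogorov's theorem yields a limit \<open>Q\<close>. It is invariant under
  prepending a step (\<open>fix_pt\<close>), which is what the axioms of a system and the equation for \<open>z\<close> say.
\<close>

lemma ex_stationary_extension:
  fixes b :: "'k^'n^'n \<Rightarrow> 'k^'n \<Rightarrow> 'k^'n"
  assumes m: "prob_space m" "sets m = sets borel"
    and bm: "(\<lambda>(g, x). b (retract g) x) \<in> \<mu> \<Otimes>\<^sub>M borel \<rightarrow>\<^sub>M borel"
    and inv: "distr (\<mu> \<Otimes>\<^sub>M m) borel (\<lambda>(g, x). b (retract g) x) = m"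
  shows "\<exists>(P :: (nat \<Rightarrow> ('k^'n^'n) \<times> ('k^'n)) measure) T \<gamma> z. walk_system W \<pi> \<mu> P T \<gamma> \<and>
    z \<in> P \<rightarrow>\<^sub>M borel \<and> distr P borel z = m \<and> (AE x in P. z x = b (\<gamma> x) (z (T x)))"
proof -
  interpret m: prob_space m by fact
  define S :: "(nat \<Rightarrow> ('k^'n^'n) \<times> ('k^'n)) measure" where "S = PiM UNIV (\<lambda>_. borel)"
  have spS: "space S = UNIV" by (simp add: S_def space_PiM)
  have mcomp: "(\<lambda>x. x i) \<in> S \<rightarrow>\<^sub>M borel" for i unfolding S_def by (rule measurable_component_singleton) simp
  have fst_b: "fst \<in> (borel :: (('k^'n^'n) \<times> ('k^'n)) measure) \<rightarrow>\<^sub>M borel" "snd \<in> (borel :: (('k^'n^'n) \<times> ('k^'n)) measure) \<rightarrow>\<^sub>M borel"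
    by (auto intro!: borel_measurable_continuous_onI continuous_intros)
  have zm: "(\<lambda>x. snd (x 0)) \<in> S \<rightarrow>\<^sub>M borel" by (rule measurable_compose[OF mcomp fst_b(2)])
  define pre :: "('k^'n^'n) \<times> (nat \<Rightarrow> ('k^'n^'n) \<times> ('k^'n)) \<Rightarrow> (nat \<Rightarrow> ('k^'n^'n) \<times> ('k^'n))" where
    "pre = (\<lambda>(g, x). case_nat (retract g, b (retract g) (snd (x 0))) x)"
  have toS: "f \<in> M \<rightarrow>\<^sub>M S" if "\<And>i. (\<lambda>x. f x i) \<in> M \<rightarrow>\<^sub>M borel" for f and M :: "'q measure"
    unfolding S_def by (rule measurable_PiM_single') (use that in \<open>auto simp: space_PiM\<close>)
  have prem: "pre \<in> \<mu> \<Otimes>\<^sub>M S \<rightarrow>\<^sub>M S"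
  proof (rule toS)
    fix i
    have b1: "(\<lambda>p. b (retract (fst p)) (snd (snd p 0))) \<in> \<mu> \<Otimes>\<^sub>M S \<rightarrow>\<^sub>M borel"
    proof -
      have "(\<lambda>p. (fst p, snd (snd p 0))) \<in> \<mu> \<Otimes>\<^sub>M S \<rightarrow>\<^sub>M \<mu> \<Otimes>\<^sub>M borel"
        by (intro measurable_Pair measurable_fst measurable_compose[OF measurable_snd zm])
      from measurable_compose[OF this bm] show ?thesis by simp
    qed
    have "(\<lambda>p. (retract (fst p), b (retract (fst p)) (snd (snd p 0)))) \<in> \<mu> \<Otimes>\<^sub>M S \<rightarrow>\<^sub>M borel"
      by (intro borel_measurable_Pair measurable_compose[OF measurable_fst retract_borel] b1)
    then show "(\<lambda>p. pre p i) \<in> \<mu> \<Otimes>\<^sub>M S \<rightarrow>\<^sub>M borel"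
      by (cases i) (simp_all add: pre_def split_beta' measurable_compose[OF measurable_snd mcomp])
  qed
  define pl where "pl = rec_nat (distr m S (\<lambda>x i. (mat 1, x))) (\<lambda>_ M. distr (\<mu> \<Otimes>\<^sub>M M) S pre)"
  have pl0: "pl 0 = distr m S (\<lambda>x i. (mat 1, x))" and plS: "pl (Suc N) = distr (\<mu> \<Otimes>\<^sub>M pl N) S pre" for N
    by (simp_all add: pl_def)
  have spl: "sets (pl N) = sets S" for N by (cases N) (simp_all add: pl0 plS)
  have m0: "(\<lambda>x i. (mat 1, x)) \<in> m \<rightarrow>\<^sub>M S"
    by (rule toS) (intro borel_measurable_Pair measurable_const measurable_ident_sets[OF m(2)], simp)
  have prem': "pre \<in> \<mu> \<Otimes>\<^sub>M M \<rightarrow>\<^sub>M S" if "sets M = sets S" for M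
    using prem by (simp add: measurable_cong_sets[OF sets_pair_measure_cong[OF refl that] refl])
  have ppl: "prob_space (pl N)" for N
  proof (induction N)
    case 0 show ?case unfolding pl0 by (rule m.prob_space_distr[OF m0])
  next
    case (Suc N)
    interpret p: prob_space "pl N" by fact
    interpret pp: pair_prob_space \<mu> "pl N" ..
    show ?case unfolding plS by (rule pp.P.prob_space_distr[OF prem'[OF spl]])
  qed
  have nn_pre: "(\<integral>\<^sup>+x. h x \<partial>distr (\<mu> \<Otimes>\<^sub>M M) S pre) = (\<integral>\<^sup>+g. \<integral>\<^sup>+x. h (pre (g, x)) \<partial>M \<partial>\<mu>)"
    if h: "h \<in> borel_measurable S" and M: "sets M = sets S" "prob_space M" for h M
  proof -
    interpret M: prob_space M by fact
    have "(\<integral>\<^sup>+x. h x \<partial>distr (\<mu> \<Otimes>\<^sub>M M) S pre) = (\<integral>\<^sup>+p. h (pre p) \<partial>(\<mu> \<Otimes>\<^sub>M M))"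
      using h by (intro nn_integral_distr prem'[OF M(1)]) simp
    also have "\<dots> = (\<integral>\<^sup>+g. \<integral>\<^sup>+x. h (pre (g, x)) \<partial>M \<partial>\<mu>)"
      by (rule M.nn_integral_fst[symmetric]) (rule measurable_compose[OF prem'[OF M(1)] h])
    finally show ?thesis .
  qed
  have pre_g: "(\<lambda>x. pre (g, x)) \<in> S \<rightarrow>\<^sub>M S" if "g \<in> space \<mu>" for g
    by (rule measurable_Pair2[OF prem that])
  \<comment> \<open>The first \<open>N\<close> entries, and the state at time \<open>0\<close>, have the same law after \<open>N\<close> and \<open>N + 1\<close> steps.\<close>
  have cons: "(\<integral>\<^sup>+x. h x \<partial>pl (Suc N)) = (\<integral>\<^sup>+x. h x \<partial>pl N)"
    if "h \<in> borel_measurable S" "\<And>x y. snd (x 0) = snd (y 0) \<Longrightarrow> (\<And>i. i < N \<Longrightarrow> x i = y i) \<Longrightarrow> h x = h y" for h N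
    using that
  proof (induction N arbitrary: h)
    case (0 h)
    define h' where "h' = (\<lambda>v. h (\<lambda>i. (mat 1, v)))"
    have hh: "h x = h' (snd (x 0))" for x unfolding h'_def by (rule 0(2)) auto
    have "(\<lambda>v i. (mat 1, v)) \<in> borel \<rightarrow>\<^sub>M S"
      by (rule toS) (intro borel_measurable_Pair measurable_const measurable_ident_sets refl, simp)
    from measurable_compose[OF this 0(1)] have h'm: "h' \<in> borel_measurable borel" unfolding h'_def .
    have "(\<integral>\<^sup>+x. h x \<partial>pl (Suc 0)) = (\<integral>\<^sup>+g. \<integral>\<^sup>+x. h (pre (g, x)) \<partial>pl 0 \<partial>\<mu>)"
      unfolding plS by (rule nn_pre[OF 0(1) spl ppl])
    also have "\<dots> = (\<integral>\<^sup>+g. \<integral>\<^sup>+x. h' (b (retract g) x) \<partial>m \<partial>\<mu>)"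
    proof (rule nn_integral_cong)
      fix g assume "g \<in> space \<mu>"
      have "(\<integral>\<^sup>+x. h (pre (g, x)) \<partial>pl 0) = (\<integral>\<^sup>+x. h (pre (g, \<lambda>i. (mat 1, x))) \<partial>m)"
        unfolding pl0 using measurable_compose[OF pre_g[OF \<open>g \<in> space \<mu>\<close>] 0(1)] by (intro nn_integral_distr m0) simp
      then show "(\<integral>\<^sup>+x. h (pre (g, x)) \<partial>pl 0) = (\<integral>\<^sup>+x. h' (b (retract g) x) \<partial>m)"
        by (simp add: hh pre_def)
    qed
    also have "\<dots> = (\<integral>\<^sup>+x. h' x \<partial>m)"
    proof -
      have bm': "(\<lambda>(g, x). b (retract g) x) \<in> \<mu> \<Otimes>\<^sub>M m \<rightarrow>\<^sub>M borel"
        using bm by (simp add: measurable_cong_sets[OF sets_pair_measure_cong[OF refl m(2)] refl])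
      have "(\<integral>\<^sup>+x. h' x \<partial>m) = (\<integral>\<^sup>+x. h' x \<partial>distr (\<mu> \<Otimes>\<^sub>M m) borel (\<lambda>(g, x). b (retract g) x))"
        by (simp only: inv)
      also have "\<dots> = (\<integral>\<^sup>+p. h' (case p of (g, x) \<Rightarrow> b (retract g) x) \<partial>(\<mu> \<Otimes>\<^sub>M m))"
        using h'm by (intro nn_integral_distr bm') simp
      also have "\<dots> = (\<integral>\<^sup>+g. \<integral>\<^sup>+x. h' (b (retract g) x) \<partial>m \<partial>\<mu>)"
        using m.nn_integral_fst[OF measurable_compose[OF bm' h'm]] by simp
      finally show ?thesis by simp
    qed
    also have "\<dots> = (\<integral>\<^sup>+x. h x \<partial>pl 0)"
    proof -
      have "(\<integral>\<^sup>+x. h x \<partial>pl 0) = (\<integral>\<^sup>+x. h (\<lambda>i. (mat 1, x)) \<partial>m)"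
        unfolding pl0 using 0(1) by (intro nn_integral_distr m0) simp
      then show ?thesis by (simp add: h'_def)
    qed
    finally show ?case .
  next
    case (Suc N h)
    have "(\<integral>\<^sup>+x. h x \<partial>pl (Suc (Suc N))) = (\<integral>\<^sup>+g. \<integral>\<^sup>+x. h (pre (g, x)) \<partial>pl (Suc N) \<partial>\<mu>)"
      unfolding plS[of "Suc N"] by (rule nn_pre[OF Suc.prems(1) spl ppl])
    also have "\<dots> = (\<integral>\<^sup>+g. \<integral>\<^sup>+x. h (pre (g, x)) \<partial>pl N \<partial>\<mu>)"
    proof (rule nn_integral_cong)
      fix g assume g: "g \<in> space \<mu>"
      show "(\<integral>\<^sup>+x. h (pre (g, x)) \<partial>pl (Suc N)) = (\<integral>\<^sup>+x. h (pre (g, x)) \<partial>pl N)"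
      proof (rule Suc.IH)
        show "(\<lambda>x. h (pre (g, x))) \<in> borel_measurable S" by (rule measurable_compose[OF pre_g[OF g] Suc.prems(1)])
        fix x y :: "nat \<Rightarrow> ('k^'n^'n) \<times> ('k^'n)" assume xy: "snd (x 0) = snd (y 0)" "\<And>i. i < N \<Longrightarrow> x i = y i"
        show "h (pre (g, x)) = h (pre (g, y))"
        proof (rule Suc.prems(2))
          fix i assume "i < Suc N"
          then show "pre (g, x) i = pre (g, y) i" using xy by (cases i) (auto simp: pre_def)
        qed (simp add: pre_def xy)
      qed
    qed
    also have "\<dots> = (\<integral>\<^sup>+x. h x \<partial>pl (Suc N))"
      unfolding plS[of N] by (rule nn_pre[OF Suc.prems(1) spl ppl, symmetric])
    finally show ?case .
  qed
  have cons_ge: "(\<integral>\<^sup>+x. h x \<partial>pl N) = (\<integral>\<^sup>+x. h x \<partial>pl K)"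
    if h: "h \<in> borel_measurable S" and dep: "\<And>x y. (\<And>i. i < K \<Longrightarrow> x i = y i) \<Longrightarrow> h x = h y" and "K \<le> N" for h N K
    using \<open>K \<le> N\<close>
  proof (induction N rule: dec_induct)
    case (step N)
    have "(\<integral>\<^sup>+x. h x \<partial>pl (Suc N)) = (\<integral>\<^sup>+x. h x \<partial>pl N)"
      using step.hyps by (intro cons h dep) auto
    then show ?case using step.IH by simp
  qed simp
  define nb where "nb = (\<lambda>J :: nat set. Suc (\<Sum>J))"
  have nb: "i < nb J" if "finite J" "i \<in> J" for i J
    using member_le_sum[OF that(2), of "\<lambda>i. i"] that(1) by (simp add: nb_def less_Suc_eq_le)
  have nb_mono: "nb J \<le> nb H" if "finite H" "J \<subseteq> H" for J H
    unfolding nb_def by (intro Suc_le_mono[THEN iffD2] sum_mono2 that) auto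
  define PJ where "PJ = (\<lambda>J. distr (pl (nb J)) (PiM J (\<lambda>_. borel)) (\<lambda>x. restrict x J))"
  have rm: "(\<lambda>x. restrict x J) \<in> S \<rightarrow>\<^sub>M PiM J (\<lambda>_. borel)" for J
    unfolding S_def by (rule measurable_restrict_subset) simp
  have rm': "(\<lambda>x. restrict x J) \<in> pl N \<rightarrow>\<^sub>M PiM J (\<lambda>_. borel)" for J N
    using rm by (simp add: measurable_cong_sets[OF spl refl])
  have PJ_ge: "distr (pl N) (PiM J (\<lambda>_. borel)) (\<lambda>x. restrict x J) = PJ J" if "finite J" "nb J \<le> N" for J N
  proof (rule measure_eqI)
    fix A assume "A \<in> sets (distr (pl N) (PiM J (\<lambda>_. borel)) (\<lambda>x. restrict x J))"
    then have A: "A \<in> sets (PiM J (\<lambda>_. borel))" by simp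
    have "(\<lambda>x. indicator A (restrict x J) :: ennreal) \<in> borel_measurable S"
      by (rule measurable_compose[OF rm borel_measurable_indicator[OF A]])
    moreover have "(indicator A (restrict x J) :: ennreal) = indicator A (restrict y J)" if "\<And>i. i < nb J \<Longrightarrow> x i = y i" for x y
      using that nb[OF \<open>finite J\<close>] by (metis restrict_ext)
    ultimately have "(\<integral>\<^sup>+x. indicator A (restrict x J) \<partial>pl N) = (\<integral>\<^sup>+x. indicator A (restrict x J) \<partial>pl (nb J))"
      using \<open>nb J \<le> N\<close> by (rule cons_ge)
    then show "emeasure (distr (pl N) (PiM J (\<lambda>_. borel)) (\<lambda>x. restrict x J)) A = emeasure (PJ J) A"
      unfolding PJ_def by (simp add: emeasure_distr_indicator[OF rm' A])
  qed (simp add: PJ_def)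
  interpret polish_projective "UNIV :: nat set" PJ
  proof (intro polish_projective.intro projective_family.intro)
    fix J H :: "nat set" assume J: "J \<subseteq> H" "finite H" "H \<subseteq> UNIV"
    have fJ: "finite J" using J finite_subset by blast
    have "distr (PJ H) (PiM J (\<lambda>_. borel)) (\<lambda>f. restrict f J)
       = distr (pl (nb H)) (PiM J (\<lambda>_. borel)) ((\<lambda>f. restrict f J) \<circ> (\<lambda>x. restrict x H))"
      unfolding PJ_def by (rule distr_distr[OF measurable_restrict_subset[OF J(1)] rm'])
    also have "(\<lambda>f. restrict f J) \<circ> (\<lambda>x. restrict x H) = (\<lambda>x :: nat \<Rightarrow> ('k^'n^'n) \<times> ('k^'n). restrict x J)"
      using J(1) by (simp add: comp_def Int_absorb1)
    also have "distr (pl (nb H)) (PiM J (\<lambda>_. borel)) (\<lambda>x. restrict x J) = PJ J"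
      by (rule PJ_ge[OF fJ nb_mono[OF J(2,1)]])
    finally show "PJ J = distr (PJ H) (PiM J (\<lambda>_. borel)) (\<lambda>f. restrict f J)" by (rule sym)
  next
    fix J :: "nat set" assume "finite J"
    interpret p: prob_space "pl (nb J)" by (rule ppl)
    show "prob_space (PJ J)" unfolding PJ_def by (rule p.prob_space_distr[OF rm'])
  qed
  define Q where "Q = lim"
  have sQ: "sets Q = sets S" by (simp add: Q_def S_def)
  have spQ: "space Q = UNIV" using sets_eq_imp_space_eq[OF sQ] spS by simp
  have pQ: "prob_space Q" unfolding Q_def by (rule P.prob_space_axioms)
  interpret Q: prob_space Q by (rule pQ)
  have Q_fin: "(\<integral>\<^sup>+x. h x \<partial>Q) = (\<integral>\<^sup>+x. h x \<partial>pl N)"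
    if h: "h \<in> borel_measurable S" and dep: "\<And>x y. (\<And>i. i < K \<Longrightarrow> x i = y i) \<Longrightarrow> h x = h y" and N: "K \<le> N" for h N K
  proof -
    let ?J = "{..<K}"
    have rQ: "(\<lambda>x. restrict x ?J) \<in> Q \<rightarrow>\<^sub>M PiM ?J (\<lambda>_. borel)"
      using rm by (simp add: measurable_cong_sets[OF sQ refl])
    have dQ: "distr Q (PiM ?J (\<lambda>_. borel)) (\<lambda>x. restrict x ?J) = PJ ?J"
    proof (rule measure_eqI)
      fix A assume "A \<in> sets (distr Q (PiM ?J (\<lambda>_. borel)) (\<lambda>x. restrict x ?J))"
      then have A: "A \<in> sets (PiM ?J (\<lambda>_. borel :: (('k^'n^'n) \<times> ('k^'n)) measure))" by simp
      have "emeasure (distr Q (PiM ?J (\<lambda>_. borel)) (\<lambda>x. restrict x ?J)) A = emeasure Q (emb UNIV ?J A)"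
        using spQ by (subst emeasure_distr[OF rQ A]) (simp add: prod_emb_def space_PiM vimage_def)
      also have "\<dots> = emeasure (PJ ?J) A" unfolding Q_def by (rule emeasure_lim_emb) (use A in auto)
      finally show "emeasure (distr Q (PiM ?J (\<lambda>_. borel)) (\<lambda>x. restrict x ?J)) A = emeasure (PJ ?J) A" .
    qed (simp add: PJ_def)
    have em: "(\<lambda>y. y) \<in> PiM ?J (\<lambda>_. borel) \<rightarrow>\<^sub>M S"
    proof (rule toS)
      fix i show "(\<lambda>y. y i) \<in> PiM ?J (\<lambda>_. borel :: (('k^'n^'n) \<times> ('k^'n)) measure) \<rightarrow>\<^sub>M borel"
      proof (cases "i < K")
        case False
        have "(\<lambda>y. undefined) \<in> PiM ?J (\<lambda>_. borel :: (('k^'n^'n) \<times> ('k^'n)) measure) \<rightarrow>\<^sub>M (borel :: (('k^'n^'n) \<times> ('k^'n)) measure)" by simp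
        then show ?thesis by (rule measurable_cong[THEN iffD1, rotated]) (use False in \<open>auto simp: space_PiM PiE_def extensional_def\<close>)
      qed (auto intro: measurable_component_singleton)
    qed
    have hm: "h \<in> borel_measurable (PiM ?J (\<lambda>_. borel))" using measurable_compose[OF em h] by simp
    have hr: "h x = h (restrict x ?J)" for x by (rule dep) simp
    have "(\<integral>\<^sup>+x. h x \<partial>Q) = (\<integral>\<^sup>+x. h (restrict x ?J) \<partial>Q)" using hr by (intro nn_integral_cong) simp
    also have "\<dots> = (\<integral>\<^sup>+x. h x \<partial>distr Q (PiM ?J (\<lambda>_. borel)) (\<lambda>x. restrict x ?J))"
      using hm by (intro nn_integral_distr[symmetric] rQ) simp
    also have "\<dots> = (\<integral>\<^sup>+x. h (restrict x ?J) \<partial>pl (nb ?J))"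
      unfolding dQ PJ_def using hm by (intro nn_integral_distr rm') simp
    also have "\<dots> = (\<integral>\<^sup>+x. h x \<partial>pl (nb ?J))" using hr by (intro nn_integral_cong) simp
    also have "\<dots> = (\<integral>\<^sup>+x. h x \<partial>pl K)"
    proof (rule cons_ge[OF h dep])
      show "K \<le> nb ?J" using nb[of ?J "K - 1"] by (cases K) auto
    qed
    also have "\<dots> = (\<integral>\<^sup>+x. h x \<partial>pl N)" by (rule cons_ge[OF h dep N, symmetric])
    finally show ?thesis .
  qed
  have fix_pt: "Q = distr (\<mu> \<Otimes>\<^sub>M Q) S pre"
  proof (rule measure_eqI_PiM_infinite)
    show "sets Q = sets (PiM UNIV (\<lambda>_. borel))" "sets (distr (\<mu> \<Otimes>\<^sub>M Q) S pre) = sets (PiM UNIV (\<lambda>_. borel))"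
      by (simp_all add: sQ S_def)
    show "finite_measure Q" by (rule Q.finite_measure_axioms)
    fix A and J :: "nat set" assume J: "finite J" "J \<subseteq> UNIV" and A: "\<And>i. i \<in> J \<Longrightarrow> A i \<in> sets (borel :: (('k^'n^'n) \<times> ('k^'n)) measure)"
    let ?E = "prod_emb UNIV (\<lambda>_. borel) J (Pi\<^sub>E J A)"
    have E: "?E \<in> sets S" unfolding S_def using J A by (intro sets_PiM_I) auto
    have EQ: "emeasure M ?E = (\<integral>\<^sup>+x. indicator ?E x \<partial>M)" if "sets M = sets S" for M using E that by simp
    have im: "(indicator ?E :: _ \<Rightarrow> ennreal) \<in> borel_measurable S" using E by simp
    have ext: "(indicator ?E x :: ennreal) = indicator ?E y" if "\<And>i. i < nb J \<Longrightarrow> x i = y i" for x y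
    proof -
      have "restrict x J = restrict y J" using that nb[OF J(1)] by (metis restrict_ext)
      then have "x \<in> ?E \<longleftrightarrow> y \<in> ?E" by (simp add: prod_emb_def)
      then show ?thesis by (simp add: indicator_def)
    qed
    have "emeasure Q ?E = (\<integral>\<^sup>+x. indicator ?E x \<partial>pl (Suc (nb J)))"
      unfolding EQ[OF sQ] by (rule Q_fin[OF im ext]) auto
    also have "\<dots> = (\<integral>\<^sup>+g. \<integral>\<^sup>+x. indicator ?E (pre (g, x)) \<partial>pl (nb J) \<partial>\<mu>)"
      unfolding plS by (rule nn_pre[OF im spl ppl])
    also have "\<dots> = (\<integral>\<^sup>+g. \<integral>\<^sup>+x. indicator ?E (pre (g, x)) \<partial>Q \<partial>\<mu>)"
    proof (rule nn_integral_cong)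
      fix g assume g: "g \<in> space \<mu>"
      have "(\<integral>\<^sup>+x. indicator ?E (pre (g, x)) \<partial>Q) = (\<integral>\<^sup>+x. indicator ?E (pre (g, x)) \<partial>pl (nb J))"
      proof (rule Q_fin)
        show "(\<lambda>x. indicator ?E (pre (g, x)) :: ennreal) \<in> borel_measurable S"
          by (rule measurable_compose[OF pre_g[OF g] im])
        fix x y :: "nat \<Rightarrow> ('k^'n^'n) \<times> ('k^'n)" assume xy: "\<And>i. i < nb J \<Longrightarrow> x i = y i"
        have "x 0 = y 0" by (rule xy) (simp add: nb_def)
        then show "(indicator ?E (pre (g, x)) :: ennreal) = indicator ?E (pre (g, y))"
          using xy by (intro ext) (auto simp: pre_def split: nat.split)
      qed simp
      then show "(\<integral>\<^sup>+x. indicator ?E (pre (g, x)) \<partial>pl (nb J)) = (\<integral>\<^sup>+x. indicator ?E (pre (g, x)) \<partial>Q)" by simp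
    qed
    also have "\<dots> = (\<integral>\<^sup>+x. indicator ?E x \<partial>distr (\<mu> \<Otimes>\<^sub>M Q) S pre)"
      by (rule nn_pre[OF im sQ pQ, symmetric])
    also have "\<dots> = emeasure (distr (\<mu> \<Otimes>\<^sub>M Q) S pre) ?E" by (rule EQ[symmetric]) simp
    finally show "emeasure Q ?E = emeasure (distr (\<mu> \<Otimes>\<^sub>M Q) S pre) ?E" .
  qed
  define T where "T = (\<lambda>(x :: nat \<Rightarrow> ('k^'n^'n) \<times> ('k^'n)) i. x (Suc i))"
  define \<gamma> where "\<gamma> = (\<lambda>x :: nat \<Rightarrow> ('k^'n^'n) \<times> ('k^'n). retract (fst (x 0)))"
  define z where "z = (\<lambda>x :: nat \<Rightarrow> ('k^'n^'n) \<times> ('k^'n). snd (x 0))"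
  have Tpre: "T (pre (g, x)) = x" for g x by (simp add: T_def pre_def)
  have gpre: "\<gamma> (pre (g, x)) = retract g" for g x by (simp add: \<gamma>_def pre_def retract_id[OF retract_stab])
  have zpre: "z (pre (g, x)) = b (retract g) (z x)" for g x by (simp add: z_def pre_def)
  have TS: "T \<in> S \<rightarrow>\<^sub>M S" unfolding T_def by (rule toS) (rule mcomp)
  have TQ: "T \<in> Q \<rightarrow>\<^sub>M Q" using TS by (simp add: measurable_cong_sets[OF sQ sQ])
  have gS: "\<gamma> \<in> S \<rightarrow>\<^sub>M \<mu>" unfolding \<gamma>_def
    by (intro measurable_compose[OF _ retract_borel_borel(2)] measurable_compose[OF mcomp fst_b(1)])
  have gQ: "\<gamma> \<in> Q \<rightarrow>\<^sub>M \<mu>" using gS by (simp add: measurable_cong_sets[OF sQ refl])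
  have zS: "z \<in> S \<rightarrow>\<^sub>M borel" unfolding z_def by (rule zm)
  have zQ: "z \<in> Q \<rightarrow>\<^sub>M borel" using zS by (simp add: measurable_cong_sets[OF sQ refl])
  have lw: "(\<integral>\<^sup>+x. h (\<gamma> x, T x) \<partial>Q) = (\<integral>\<^sup>+g. \<integral>\<^sup>+x. h (g, x) \<partial>Q \<partial>\<mu>)"
    if "h \<in> borel_measurable (\<mu> \<Otimes>\<^sub>M Q)" for h
  proof -
    have h: "h \<in> borel_measurable (\<mu> \<Otimes>\<^sub>M S)"
      using that by (simp add: measurable_cong_sets[OF sets_pair_measure_cong[OF refl sQ] refl])
    have "(\<lambda>x. (\<gamma> x, T x)) \<in> S \<rightarrow>\<^sub>M \<mu> \<Otimes>\<^sub>M S" by (intro measurable_Pair gS TS)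
    then have hm: "(\<lambda>x. h (\<gamma> x, T x)) \<in> borel_measurable S" using h by (rule measurable_compose)
    have "(\<integral>\<^sup>+x. h (\<gamma> x, T x) \<partial>Q) = (\<integral>\<^sup>+x. h (\<gamma> x, T x) \<partial>distr (\<mu> \<Otimes>\<^sub>M Q) S pre)"
      using fix_pt by simp
    also have "\<dots> = (\<integral>\<^sup>+g. \<integral>\<^sup>+x. h (retract g, x) \<partial>Q \<partial>\<mu>)"
      using nn_pre[OF hm sQ pQ] by (simp only: Tpre gpre)
    also have "\<dots> = (\<integral>\<^sup>+g. \<integral>\<^sup>+x. h (g, x) \<partial>Q \<partial>\<mu>)"
      using AE_retract by (intro nn_integral_cong_AE) auto
    finally show ?thesis .
  qed
  have ws: "walk_system W \<pi> \<mu> Q T \<gamma>"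
    by (intro walk_system.intro walk_system_axioms.intro mu_space_axioms pQ TQ gQ lw) (simp_all add: \<gamma>_def retract_stab)
  have zlaw: "distr Q borel z = m"
  proof (rule measure_eqI)
    fix A assume "A \<in> sets (distr Q borel z)"
    then have A: "A \<in> sets borel" by simp
    then have A': "A \<in> sets m" using m(2) by simp
    have im: "(\<lambda>x. indicator A (z x) :: ennreal) \<in> borel_measurable S"
      by (rule measurable_compose[OF zS borel_measurable_indicator[OF A]])
    have "emeasure (distr Q borel z) A = (\<integral>\<^sup>+x. indicator A (z x) \<partial>Q)"
      by (rule emeasure_distr_indicator[OF zQ A])
    also have "\<dots> = (\<integral>\<^sup>+x. indicator A (z x) \<partial>pl (Suc 0))"
      by (rule Q_fin[OF im, of "Suc 0"]) (simp_all add: z_def)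
    also have "\<dots> = (\<integral>\<^sup>+x. indicator A (z x) \<partial>pl 0)"
      by (rule cons[OF im]) (simp_all add: z_def)
    also have "\<dots> = (\<integral>\<^sup>+x. indicator A x \<partial>m)"
      unfolding pl0 using im by (subst nn_integral_distr[OF m0]) (simp_all add: z_def)
    also have "\<dots> = emeasure m A" using A' by simp
    finally show "emeasure (distr Q borel z) A = emeasure m A" .
  qed (simp add: m(2))
  have "AE x in Q. z x = b (\<gamma> x) (z (T x))"
  proof -
    have "(\<lambda>x. (\<gamma> x, z (T x))) \<in> S \<rightarrow>\<^sub>M \<mu> \<Otimes>\<^sub>M borel" by (intro measurable_Pair gS measurable_compose[OF TS zS])
    from measurable_compose[OF this bm] have bS: "(\<lambda>x. b (\<gamma> x) (z (T x))) \<in> S \<rightarrow>\<^sub>M borel"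
      by (simp add: \<gamma>_def retract_id[OF retract_stab])
    have "{x \<in> space S. z x = b (\<gamma> x) (z (T x))} \<in> sets S"
      using zS bS by measurable
    then have "(AE x in distr (\<mu> \<Otimes>\<^sub>M Q) S pre. z x = b (\<gamma> x) (z (T x))) \<longleftrightarrow> (AE p in \<mu> \<Otimes>\<^sub>M Q. z (pre p) = b (\<gamma> (pre p)) (z (T (pre p))))"
      by (rule AE_distr_iff[OF prem'[OF sQ]])
    moreover have "z (pre p) = b (\<gamma> (pre p)) (z (T (pre p)))" for p
      by (cases p) (simp add: zpre gpre Tpre)
    ultimately have "AE x in distr (\<mu> \<Otimes>\<^sub>M Q) S pre. z x = b (\<gamma> x) (z (T x))" by simp
    then show ?thesis unfolding fix_pt[symmetric] .
  qed
  then show ?thesis using ws zQ zlaw by blast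
qed

lemma borel_extend:
  assumes "f \<in> restrict_space borel (UNIV - W) \<rightarrow>\<^sub>M N" "c \<in> space N"
  shows "(\<lambda>u. if u \<in> W then c else f u) \<in> borel \<rightarrow>\<^sub>M N"
proof -
  have "(\<lambda>u. if u \<in> UNIV - W then f u else c) \<in> borel \<rightarrow>\<^sub>M N"
    using assms by (subst measurable_restrict_space_iff[symmetric]) auto
  then show ?thesis by (rule measurable_cong[THEN iffD1, rotated]) auto
qed

text \<open>
  The chain of \<open>ex_stationary_extension\<close> is vector valued; here it is transported through a measurable
  section \<open>s\<close> of the projection \<open>p\<close> from \<open>V - W\<close> onto the space \<open>X\<close>. It applies to \<open>P(V/W)\<close> as well as to
  \<open>P(V) - P(W)\<close>.
\<close>

lemma stationary_system:
  fixes p :: "'k^'n \<Rightarrow> 'x" and s :: "'x \<Rightarrow> 'k^'n" and a :: "'k^'n^'n \<Rightarrow> 'x \<Rightarrow> 'x"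
  assumes pm: "p \<in> restrict_space borel (UNIV - W) \<rightarrow>\<^sub>M X"
    and sm: "s \<in> X \<rightarrow>\<^sub>M borel"
    and s_notin: "\<And>x. x \<in> space X \<Longrightarrow> s x \<notin> W" and ps: "\<And>x. x \<in> space X \<Longrightarrow> p (s x) = x"
    and act: "\<And>g x. g \<in> stab W \<Longrightarrow> x \<in> space X \<Longrightarrow> a g x = p (g *v s x)"
    and am: "(\<lambda>(g, x). a (retract g) x) \<in> \<mu> \<Otimes>\<^sub>M X \<rightarrow>\<^sub>M X"
    and nu: "prob_space \<nu>" "sets \<nu> = sets X" "distr (\<mu> \<Otimes>\<^sub>M \<nu>) X (\<lambda>(g, x). a (retract g) x) = \<nu>"
  shows "\<exists>(P :: (nat \<Rightarrow> ('k^'n^'n) \<times> ('k^'n)) measure) T \<gamma> Y. walk_system W \<pi> \<mu> P T \<gamma> \<and>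
    Y \<in> P \<rightarrow>\<^sub>M X \<and> distr P X Y = \<nu> \<and> (AE x in P. Y x = a (\<gamma> x) (Y (T x)))"
proof -
  interpret nu: prob_space \<nu> by fact
  have spn: "space \<nu> = space X" by (rule sets_eq_imp_space_eq[OF nu(2)])
  obtain x0 where x0: "x0 \<in> space X" using nu.not_empty spn by auto
  \<comment> \<open>The value on \<open>W\<close> is arbitrary: the chain stays in the range of \<open>s\<close>, which avoids \<open>W\<close>.\<close>
  define p' where "p' = (\<lambda>u. if u \<in> W then x0 else p u)"
  have p'm: "p' \<in> borel \<rightarrow>\<^sub>M X" unfolding p'_def by (rule borel_extend[OF pm x0])
  have p's: "p' (s x) = x" if "x \<in> space X" for x using that by (simp add: p'_def s_notin ps)
  have p'_space: "p' u \<in> space X" for u using measurable_space[OF p'm, of u] by simp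
  define b where "b = (\<lambda>(g :: 'k^'n^'n) v. s (p' (g *v v)))"
  have smn: "s \<in> \<nu> \<rightarrow>\<^sub>M borel" using sm by (simp add: measurable_cong_sets[OF nu(2) refl])
  define m where "m = distr \<nu> borel s"
  have pm': "prob_space m" unfolding m_def by (rule nu.prob_space_distr[OF smn])
  have mvb: "(\<lambda>p. retract (fst p) *v snd p) \<in> \<mu> \<Otimes>\<^sub>M borel \<rightarrow>\<^sub>M borel"
    by (intro measurable_mv measurable_compose[OF measurable_fst retract_borel] measurable_snd)
  have bm: "(\<lambda>(g, x). b (retract g) x) \<in> \<mu> \<Otimes>\<^sub>M borel \<rightarrow>\<^sub>M borel"
    unfolding b_def split_beta' by (intro measurable_compose[OF measurable_compose[OF mvb p'm] sm])
  have bs: "b g (s x) = s (a g x)" if "g \<in> stab W" "x \<in> space X" for g x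
    using that by (simp add: b_def act p'_def stab_in_W s_notin)
  have inv: "distr (\<mu> \<Otimes>\<^sub>M m) borel (\<lambda>(g, x). b (retract g) x) = m"
  proof -
    have am': "(\<lambda>(g, x). a (retract g) x) \<in> \<mu> \<Otimes>\<^sub>M \<nu> \<rightarrow>\<^sub>M X"
      using am by (simp add: measurable_cong_sets[OF sets_pair_measure_cong[OF refl nu(2)] refl])
    have "distr (\<mu> \<Otimes>\<^sub>M m) borel (\<lambda>(g, x). b (retract g) x) = distr (\<mu> \<Otimes>\<^sub>M \<nu>) borel (\<lambda>(g, x). b (retract g) (s x))"
      unfolding m_def by (rule distr_pair_distr[OF prob_mu nu(1) smn bm])
    also have "\<dots> = distr (\<mu> \<Otimes>\<^sub>M \<nu>) borel (s \<circ> (\<lambda>(g, x). a (retract g) x))"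
      by (rule distr_cong) (auto simp: space_pair_measure spn bs[OF retract_stab])
    also have "\<dots> = distr (distr (\<mu> \<Otimes>\<^sub>M \<nu>) X (\<lambda>(g, x). a (retract g) x)) borel s"
      by (rule distr_distr[OF sm am', symmetric])
    also have "\<dots> = m" unfolding nu(3) m_def ..
    finally show ?thesis .
  qed
  have "sets m = sets borel" by (simp add: m_def)
  from ex_stationary_extension[OF pm' this bm inv]
  obtain P :: "(nat \<Rightarrow> ('k^'n^'n) \<times> ('k^'n)) measure" and T \<gamma> z where
    ws: "walk_system W \<pi> \<mu> P T \<gamma>" and z: "z \<in> P \<rightarrow>\<^sub>M borel" "distr P borel z = m" "AE x in P. z x = b (\<gamma> x) (z (T x))"
    by blast
  interpret ws: walk_system W \<pi> \<mu> P T \<gamma> by (rule ws)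
  define Y where "Y = (\<lambda>x. p' (z x))"
  have Ym: "Y \<in> P \<rightarrow>\<^sub>M X" unfolding Y_def by (rule measurable_compose[OF z(1) p'm])
  have "distr P X Y = distr (distr P borel z) X p'"
    by (subst distr_distr[OF p'm z(1)]) (simp add: Y_def comp_def)
  also have "\<dots> = distr \<nu> X (p' \<circ> s)" unfolding z(2) m_def by (rule distr_distr[OF p'm smn])
  also have "\<dots> = distr \<nu> \<nu> (\<lambda>x. x)" by (rule distr_cong) (simp_all add: nu(2) spn p's)
  also have "\<dots> = \<nu>" by (simp add: distr_id2)
  finally have Yl: "distr P X Y = \<nu>" .
  have "AE x in P. s (p' (z x)) = z x"
  proof -
    have spm: "(\<lambda>u. s (p' u)) \<in> borel \<rightarrow>\<^sub>M borel" by (rule measurable_compose[OF p'm sm])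
    have ms: "{u \<in> space borel. s (p' u) = u} \<in> sets borel"
      using spm by measurable
    have "AE u in m. s (p' u) = u"
      unfolding m_def by (subst AE_distr_iff[OF smn ms]) (auto simp: spn p's)
    then show ?thesis using AE_distr_iff[OF z(1) ms] unfolding z(2) by blast
  qed
  note sz = this
  have "AE x in P. x \<in> space P" by (rule AE_I2)
  with ws.AE_iter[OF sz, of 1] z(3) have "AE x in P. Y x = a (\<gamma> x) (Y (T x))"
  proof eventually_elim
    case (elim x)
    have g: "\<gamma> x \<in> stab W" by (rule ws.gamma_stab[OF elim(3)])
    have sT: "s (p' (z (T x))) = z (T x)" using elim(1) by simp
    then have zT: "z (T x) \<notin> W" using s_notin[OF p'_space, of "z (T x)"] by simp
    have "Y x = p' (s (p' (\<gamma> x *v z (T x))))" using elim(2) by (simp add: Y_def b_def)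
    also have "\<dots> = p (\<gamma> x *v z (T x))" using zT by (simp add: p's p'_space) (simp add: p'_def stab_in_W[OF g])
    also have "\<dots> = a (\<gamma> x) (Y (T x))" unfolding act[OF g p'_space] Y_def by (simp only: sT)
    finally show ?case .
  qed
  then show ?thesis using ws Ym Yl by blast
qed

end

section \<open>Existence of the lift\<close>

context ergodic_system
begin

lemma bwd_rep: assumes "regular x" shows "bwd n x *v rep n x - factors n x *s rep 0 x \<in> W"
proof (induction n)
  case 0 then show ?case by (simp add: factors_def W0)
next
  case (Suc n)
  have "bwd (Suc n) x *v rep (Suc n) x - factors (Suc n) x *s rep 0 x =
      factor n x *s (bwd n x *v rep n x - factors n x *s rep 0 x) + bwd n x *v offset n x"
    unfolding bwd_step by (simp add: factors_def vec.scale_right_diff_distrib mult.commute)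
  also have "\<dots> \<in> W"
    by (intro W_add W_scale Suc stabD(2)[OF bwd_stab] regular_space offset_in_W assms)
  finally show ?case .
qed

lemma factors_nonzero: "x \<in> space P \<Longrightarrow> factors n x \<noteq> 0"
  using norm_factors[of x n] by auto

lemma factor_nonzero: "x \<in> space P \<Longrightarrow> factor n x \<noteq> 0"
  using norm_factor[of x n] by auto

text \<open>
  The base point of the fibre over \<open>C \<circ> T\<^sup>n\<close>, moved by \<open>bwd n\<close> into the fibre over \<open>C\<close>.
\<close>

definition pullback :: "nat \<Rightarrow> 'w \<Rightarrow> 'k^'n" where
  "pullback n x = normal (bwd n x *v rep n x)"

lemma pullback_eq: "regular x \<Longrightarrow> pullback n x = inverse (factors n x) *s (bwd n x *v rep n x)"
  by (simp add: pullback_def normal_def theta_bwd)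

lemma rep_measurable [measurable]: "rep n \<in> P \<rightarrow>\<^sub>M borel"
  unfolding rep_def[abs_def] by (intro measurable_compose[OF _ sigma_measurable] measurable_compose[OF iter_measurable C_meas])

lemma pullback_measurable [measurable]: "pullback n \<in> P \<rightarrow>\<^sub>M borel"
  unfolding pullback_def[abs_def] by (intro measurable_compose[OF _ normal_measurable] measurable_mv bwd_measurable rep_measurable)

lemma pi_pullback: assumes "regular x" shows "\<pi> (pullback n x) = rep 0 x"
proof -
  have x: "x \<in> space P" by (rule regular_space[OF assms])
  have "\<pi> (bwd n x *v rep n x) = factors n x *s rep 0 x"
    using bwd_rep[OF assms, of n] pi_eq_iff[of "bwd n x *v rep n x" "factors n x *s rep 0 x"] by (simp add: pi.scale rep_props(4)[OF x])
  then show ?thesis using factors_nonzero[OF x] by (simp add: pullback_eq[OF assms] pi.scale)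
qed

lemma norm_rep_le: "x \<in> space P \<Longrightarrow> norm (rep n x) \<le> onorm \<pi>"
  using norm_pi_le[of "rep n x"] by (simp add: rep_props)

text \<open>
  The base points are bounded because the quotient norm controls the norm on the range of \<open>\<pi>\<close>.
\<close>

lemma norm_offset_le:
  assumes x: "x \<in> space P"
  shows "norm (offset n x) \<le> norm (factor n x) * (2 * onorm \<pi> * exp (2 * log_norm (\<gamma> ((T ^^ n) x))))"
proof -
  let ?g = "\<gamma> ((T ^^ n) x)" let ?l = "log_norm ?g"
  have Tn: "(T ^^ n) x \<in> space P" by (rule iter_space[OF x])
  have g: "invertible ?g" by (rule stabD(1)[OF gamma_stab[OF Tn]])
  have K: "0 \<le> onorm \<pi>" by (rule onorm_pos_le[OF bounded_linear_pi])
  have l0: "0 \<le> ?l" by (rule log_norm_bounds(1)[OF g])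
  have "\<bar>log_factor ((T ^^ n) x)\<bar> \<le> ?l"
    unfolding log_factor_def by (rule cocycle_bound[OF gamma_stab[OF Tn] C_space[OF T_space[OF Tn]]])
  then have "exp (- ?l) \<le> norm (factor n x)" unfolding norm_factor[OF x] by simp
  then have "exp (- ?l) * exp (2 * ?l) \<le> norm (factor n x) * exp (2 * ?l)" by (intro mult_right_mono) auto
  then have r: "exp ?l \<le> norm (factor n x) * exp (2 * ?l)" by (simp add: exp_add[symmetric])
  have "norm (?g *v rep (Suc n) x) \<le> onorm ((*v) ?g) * norm (rep (Suc n) x)" by (rule norm_mv_le)
  also have "\<dots> \<le> exp ?l * onorm \<pi>"
    by (intro mult_mono log_norm_bounds(2)[OF g] norm_rep_le x) auto
  also have "\<dots> \<le> (norm (factor n x) * exp (2 * ?l)) * onorm \<pi>" by (rule mult_right_mono[OF r K])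
  finally have a: "norm (?g *v rep (Suc n) x) \<le> (norm (factor n x) * exp (2 * ?l)) * onorm \<pi>" .
  have "norm (factor n x *s rep n x) \<le> norm (factor n x) * onorm \<pi>"
    unfolding norm_scale by (intro mult_left_mono norm_rep_le x) auto
  also have "\<dots> \<le> (norm (factor n x) * exp (2 * ?l)) * onorm \<pi>"
    using l0 K by (intro mult_right_mono) (auto simp: mult_le_cancel_left1)
  finally have b: "norm (factor n x *s rep n x) \<le> (norm (factor n x) * exp (2 * ?l)) * onorm \<pi>" .
  have "norm (offset n x) \<le> norm (?g *v rep (Suc n) x) + norm (factor n x *s rep n x)"
    unfolding offset_def by (rule norm_triangle_ineq4)
  then show ?thesis using a b by (simp add: algebra_simps)
qed

lemma pullback_diff:
  assumes "regular x"
  shows "norm (pullback (Suc n) x - pullback n x) \<le> \<kappa> n x * (2 * onorm \<pi> * exp (2 * log_norm (\<gamma> ((T ^^ n) x))))"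
proof -
  have x: "x \<in> space P" by (rule regular_space[OF assms])
  have s: "factors (Suc n) x = factors n x * factor n x" by (simp add: factors_def)
  have nz: "factors n x \<noteq> 0" "factor n x \<noteq> 0" using factors_nonzero[OF x] factor_nonzero[OF x] by auto
  have "pullback (Suc n) x - pullback n x = inverse (factors (Suc n) x) *s (bwd n x *v offset n x)"
    unfolding pullback_eq[OF assms] bwd_step s using nz by (simp add: vec.scale_right_distrib inverse_mult_distrib)
  then have "norm (pullback (Suc n) x - pullback n x) = norm (bwd n x *v offset n x) / (norm (factors n x) * norm (factor n x))"
    by (simp add: norm_scale s norm_inverse norm_mult divide_inverse mult.commute)
  also have "\<dots> \<le> (onorm_on W (bwd n x) * (norm (factor n x) * (2 * onorm \<pi> * exp (2 * log_norm (\<gamma> ((T ^^ n) x)))))) / (norm (factors n x) * norm (factor n x))"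
    by (intro divide_right_mono order_trans[OF onorm_on_le[OF offset_in_W[OF assms]]] mult_left_mono norm_offset_le x onorm_on_nonneg) auto
  also have "\<dots> = \<kappa> n x * (2 * onorm \<pi> * exp (2 * log_norm (\<gamma> ((T ^^ n) x))))"
    using nz by (simp add: \<kappa>_def)
  finally show ?thesis .
qed

text \<open>
  The factor \<open>\<kappa> n\<close> in \<open>pullback_diff\<close> decays like \<open>exp (- \<delta> n)\<close>, whereas the norms of the single matrices
  grow at most like \<open>exp (\<delta> n / 4)\<close>, so that the telescoping series converges.
\<close>

lemma pullback_convergent:
  assumes gap: "W = {0} \<or> exponent < \<alpha>"
  shows "AE x in P. convergent (\<lambda>n. pullback n x)"
  using AE_regular kappa_decay[OF gap] log_gamma_sublinear
proof eventually_elim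
  case (elim x)
  obtain \<delta> where d: "\<delta> > 0" and kd: "\<forall>\<^sub>F n in sequentially. \<kappa> n x \<le> exp (- \<delta> * real n)" using elim(2) by blast
  let ?K = "onorm \<pi>"
  have K: "0 \<le> ?K" by (rule onorm_pos_le[OF bounded_linear_pi])
  have "0 < \<delta> / 4" using d by simp
  with elim(3) have "\<forall>\<^sub>F n in sequentially. log_norm (\<gamma> ((T ^^ n) x)) \<le> \<delta> / 4 * real n" by blast
  with kd have "\<forall>\<^sub>F n in sequentially. norm (pullback (Suc n) x - pullback n x) \<le> 2 * ?K * exp (- \<delta> / 2) ^ n"
  proof eventually_elim
    case (elim n)
    have "norm (pullback (Suc n) x - pullback n x) \<le> \<kappa> n x * (2 * ?K * exp (2 * log_norm (\<gamma> ((T ^^ n) x))))"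
      by (rule pullback_diff[OF \<open>regular x\<close>])
    also have "\<dots> \<le> exp (- \<delta> * real n) * (2 * ?K * exp (2 * (\<delta> / 4 * real n)))"
      using elim K by (intro mult_mono) auto
    also have "\<dots> = 2 * ?K * exp (- \<delta> / 2 * real n)"
      by (simp add: exp_add[symmetric] field_simps)
    also have "exp (- \<delta> / 2 * real n) = exp (- \<delta> / 2) ^ n" by (simp add: exp_of_nat_mult[symmetric] mult.commute)
    finally show ?case .
  qed
  moreover have "summable (\<lambda>n. 2 * ?K * exp (- \<delta> / 2) ^ n)"
    using d by (intro summable_mult summable_geometric) simp
  ultimately have "summable (\<lambda>n. pullback (Suc n) x - pullback n x)" by (rule summable_comparison_test_ev)
  moreover have tel: "(\<Sum>i<n. pullback (Suc i) x - pullback i x) = pullback n x - pullback 0 x" for n by (induction n) auto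
  ultimately have "(\<lambda>n. pullback 0 x + (\<Sum>i<n. pullback (Suc i) x - pullback i x)) \<longlonglongrightarrow> pullback 0 x + (\<Sum>i. pullback (Suc i) x - pullback i x)"
    by (intro tendsto_add tendsto_const summable_LIMSEQ)
  then have "(\<lambda>n. pullback n x) \<longlonglongrightarrow> pullback 0 x + (\<Sum>i. pullback (Suc i) x - pullback i x)"
    by (simp only: tel) simp
  then show ?case by (rule convergentI)
qed

lemma regular_T: "regular x \<Longrightarrow> regular (T x)"
  unfolding regular_def using T_space by (metis funpow_Suc_right comp_apply)

text \<open>
  The approximants at consecutive times are related by the action of \<open>\<gamma>\<close>; in the limit this is the
  equation \<open>Y = \<gamma> \<cdot> Y \<circ> T\<close>.
\<close>

lemma pullback_Suc:
  assumes "regular x"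
  shows "pullback (Suc n) x = inverse (factor 0 x) *s (\<gamma> x *v pullback n (T x))"
proof -
  have x: "x \<in> space P" by (rule regular_space[OF assms])
  have c: "rep (Suc n) x = rep n (T x)" by (simp add: rep_def funpow_swap1)
  have r: "factor (Suc i) x = factor i (T x)" for i by (simp add: factor_def rep_def funpow_swap1)
  have s: "factors (Suc n) x = factor 0 x * factors n (T x)"
    unfolding factors_def prod.lessThan_Suc_shift by (simp only: r)
  have nz: "factors n (T x) \<noteq> 0" "factor 0 x \<noteq> 0" using factors_nonzero[OF T_space[OF x]] factor_nonzero[OF x] by auto
  have "bwd (Suc n) x *v rep (Suc n) x = \<gamma> x *v (bwd n (T x) *v rep n (T x))"
    by (simp add: c matrix_vector_mul_assoc)
  then have "pullback (Suc n) x = (inverse (factor 0 x) * inverse (factors n (T x))) *s (\<gamma> x *v (bwd n (T x) *v rep n (T x)))"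
    unfolding pullback_eq[OF assms] s by (simp add: inverse_mult_distrib)
  also have "\<dots> = inverse (factor 0 x) *s (\<gamma> x *v pullback n (T x))"
    by (simp add: pullback_eq[OF regular_T[OF assms]] vector_scalar_commute)
  finally show ?thesis .
qed

lemma ex_stationary_lift:
  assumes gap: "W = {0} \<or> exponent < \<alpha>"
  shows "\<exists>\<nu>. stationary_lift \<mu> W \<nu>' \<nu>"
proof -
  define xl where "xl = (\<lambda>x. lim (\<lambda>n. pullback n x))"
  have xlm: "xl \<in> P \<rightarrow>\<^sub>M borel" unfolding xl_def by (rule borel_measurable_lim_metric) (rule pullback_measurable)
  have "AE x in P. regular x \<and> (\<lambda>n. pullback n x) \<longlonglongrightarrow> xl x"
    using AE_regular pullback_convergent[OF gap] by eventually_elim (simp add: xl_def convergent_LIMSEQ_iff)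
  note xl = this
  obtain x1 where x1: "x1 \<in> space P" using P.not_empty by auto
  define v0 where "v0 = rep 0 x1"
  have v0: "v0 \<notin> W" unfolding v0_def by (rule rep_props(1)[OF x1])
  \<comment> \<open>Where the limit fails to exist, or lies in \<open>W\<close>, the line of \<open>v0\<close> is used; this is a null set.\<close>
  define Y where "Y = (\<lambda>x. line (if xl x \<in> W then v0 else xl x))"
  have Ym: "Y \<in> P \<rightarrow>\<^sub>M proj_diff W"
    unfolding Y_def
  proof (rule line_measurable')
    have "{x \<in> space P. xl x \<in> W} \<in> sets P" using measurable_sets[OF xlm W_sets] by (simp add: vimage_def Int_def conj_commute)
    then show "(\<lambda>x. if xl x \<in> W then v0 else xl x) \<in> borel_measurable P" by (intro measurable_If measurable_const xlm) simp
  qed (simp add: v0)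
  have pixl: "\<pi> (xl x) = rep 0 x" if "regular x" "(\<lambda>n. pullback n x) \<longlonglongrightarrow> xl x" for x
  proof -
    have "(\<lambda>n. \<pi> (pullback n x)) \<longlonglongrightarrow> \<pi> (xl x)" by (rule bounded_linear.tendsto[OF bounded_linear_pi that(2)])
    then have "(\<lambda>n. rep 0 x) \<longlonglongrightarrow> \<pi> (xl x)" by (simp only: pi_pullback[OF that(1)])
    then show ?thesis using LIMSEQ_unique tendsto_const by blast
  qed
  have xlW: "xl x \<notin> W" if "regular x" "(\<lambda>n. pullback n x) \<longlonglongrightarrow> xl x" for x
    using rep_props(1)[OF regular_space[OF that(1)], of 0] pi_in_W[of "xl x"] pixl[OF that] by simp
  have Yeq: "AE x in P. Y x = act (\<gamma> x) (Y (T x))"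
    using xl AE_iter[OF xl, of 1]
  proof eventually_elim
    case (elim x)
    have g: "regular x" "regular (T x)" and l: "(\<lambda>n. pullback n x) \<longlonglongrightarrow> xl x" "(\<lambda>n. pullback n (T x)) \<longlonglongrightarrow> xl (T x)" using elim by auto
    have bl: "bounded_linear (\<lambda>v. inverse (factor 0 x) *s (\<gamma> x *v v))"
      by (intro linear_conv_bounded_linear[THEN iffD1] linear_real)
        (unfold_locales, simp_all add: vec.add vec.scale vec.scale_right_distrib mult.commute)
    have "(\<lambda>n. inverse (factor 0 x) *s (\<gamma> x *v pullback n (T x))) \<longlonglongrightarrow> inverse (factor 0 x) *s (\<gamma> x *v xl (T x))"
      by (rule bounded_linear.tendsto[OF bl l(2)])
    then have "(\<lambda>n. pullback (Suc n) x) \<longlonglongrightarrow> inverse (factor 0 x) *s (\<gamma> x *v xl (T x))" by (simp only: pullback_Suc[OF g(1)])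
    then have eq: "xl x = inverse (factor 0 x) *s (\<gamma> x *v xl (T x))"
      using LIMSEQ_Suc[OF l(1)] LIMSEQ_unique by blast
    have nz: "inverse (factor 0 x) \<noteq> 0" using factor_nonzero[OF regular_space[OF g(1)]] by simp
    have "line (xl x) = line (\<gamma> x *v xl (T x))"
      unfolding eq line_def using nz by (intro vec.span_image_scale[of "{\<gamma> x *v xl (T x)}" "\<lambda>_. inverse (factor 0 x)", simplified]) auto
    then show ?case using xlW[OF g(1) l(1)] xlW[OF g(2) l(2)] by (simp add: Y_def act_line)
  qed
  have YC: "AE x in P. proj_map W (Y x) = C x"
    using xl
  proof eventually_elim
    case (elim x)
    then have "proj_map W (Y x) = qline (\<pi> (xl x))" using xlW by (simp add: Y_def proj_map_line qline_pi)
    also have "\<dots> = qline (rep 0 x)" using pixl elim by simp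
    also have "\<dots> = C x" using rep_props(2)[OF regular_space, of x 0] elim by simp
    finally show ?case .
  qed
  define \<nu> where "\<nu> = distr P (proj_diff W) Y"
  have st: "stationary act \<mu> (proj_diff W) \<nu>"
    unfolding stationary_diff_iff \<nu>_def
    using system_stationary[OF Ym act_measurable Yeq] P.prob_space_distr[OF Ym] by simp
  have pm: "proj_map W \<in> proj_diff W \<rightarrow>\<^sub>M proj_quot W" by (rule proj_map_measurable)
  have "distr \<nu> (proj_quot W) (proj_map W) = distr P (proj_quot W) (proj_map W \<circ> Y)"
    unfolding \<nu>_def by (rule distr_distr[OF pm Ym])
  also have "\<dots> = distr P (proj_quot W) C"
    using YC by (intro distr_cong_AE) (auto intro: measurable_comp[OF Ym pm])
  also have "\<dots> = \<nu>'" by (rule C_law)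
  finally show ?thesis using st unfolding stationary_lift_def by blast
qed

section \<open>Uniqueness of the lift\<close>

text \<open>
  The law of the approximant does not depend on the system: \<open>bwd n\<close> and \<open>C \<circ> T\<^sup>n\<close> are independent, with
  laws \<open>conv_pow n\<close> and \<open>\<nu>'\<close>.
\<close>

lemma law_pullback: "distr P borel (pullback n) = distr (conv_pow n \<Otimes>\<^sub>M \<nu>') borel (\<lambda>(g, x). normal (g *v \<sigma> x))"
proof -
  have m: "(\<lambda>(g, x). normal (g *v \<sigma> x)) \<in> conv_pow n \<Otimes>\<^sub>M proj_quot W \<rightarrow>\<^sub>M borel"
  proof -
    have "(\<lambda>p. normal (fst p *v \<sigma> (snd p))) \<in> borel \<Otimes>\<^sub>M proj_quot W \<rightarrow>\<^sub>M borel"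
      by (intro measurable_compose[OF _ normal_measurable] measurable_mv measurable_fst measurable_compose[OF measurable_snd sigma_measurable])
    then show ?thesis by (simp add: split_beta' measurable_cong_sets[OF sets_pair_measure_cong[OF sets_conv_pow refl] refl])
  qed
  have m': "(\<lambda>(g, x). normal (g *v \<sigma> (C x))) \<in> borel \<Otimes>\<^sub>M P \<rightarrow>\<^sub>M borel"
    unfolding split_beta'
    by (intro measurable_compose[OF _ normal_measurable] measurable_mv measurable_fst measurable_compose[OF _ sigma_measurable] measurable_compose[OF measurable_snd C_meas])
  have "distr P borel (pullback n) = distr P borel ((\<lambda>(g, x). normal (g *v \<sigma> (C x))) \<circ> (\<lambda>x. (bwd n x, (T ^^ n) x)))"
    by (simp add: pullback_def[abs_def] rep_def comp_def)
  also have "\<dots> = distr (distr P (borel \<Otimes>\<^sub>M P) (\<lambda>x. (bwd n x, (T ^^ n) x))) borel (\<lambda>(g, x). normal (g *v \<sigma> (C x)))"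
    by (rule distr_distr[symmetric, OF m']) measurable
  also have "\<dots> = distr (conv_pow n \<Otimes>\<^sub>M P) borel (\<lambda>(g, x). normal (g *v \<sigma> (C x)))"
    using distr_product[OF bwd_measurable law_bwd, of n] by simp
  also have "\<dots> = distr (conv_pow n \<Otimes>\<^sub>M distr P (proj_quot W) C) borel (\<lambda>(g, x). normal (g *v \<sigma> x))"
    by (rule distr_pair_distr[OF prob_conv_pow prob_P C_meas m, symmetric])
  finally show ?thesis by (simp only: C_law)
qed

lemma kappa_nonneg: "0 \<le> \<kappa> n x" by (simp add: \<kappa>_def onorm_on_nonneg)

lemma kappa_measurable [measurable]: "\<kappa> n \<in> borel_measurable P"
proof -
  have "(\<lambda>x. onorm_on W (bwd n x) / exp (\<Sum>i<n. log_factor ((T ^^ i) x))) \<in> borel_measurable P" by measurable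
  then show ?thesis by (rule measurable_cong[THEN iffD1, rotated]) (simp add: \<kappa>_def norm_factors)
qed

text \<open>
  The vector \<open>\<tau> (Y x)\<close> and the approximant are images of two points of the fibre over \<open>C \<circ> T\<^sup>n\<close> under the
  same affine map, whose linear part has norm at most \<open>\<kappa> n\<close>.
\<close>

lemma lift_approx:
  assumes Ym: "Y \<in> P \<rightarrow>\<^sub>M proj_diff W" and Yeq: "AE x in P. Y x = act (\<gamma> x) (Y (T x))"
    and YC: "\<And>x. x \<in> space P \<Longrightarrow> C x = proj_map W (Y x)"
  shows "AE x in P. \<forall>n. norm (\<tau> (Y x) - pullback n x) \<le> \<kappa> n x * norm (\<tau> (Y ((T ^^ n) x)) - \<sigma> (C ((T ^^ n) x)))"
proof -
  have Ysp: "Y x \<in> space (proj_diff W)" if "x \<in> space P" for x by (rule measurable_space[OF Ym that])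
  have "AE x in P. Y ((T ^^ n) x) = act (\<gamma> ((T ^^ n) x)) (Y ((T ^^ Suc n) x))" for n
    using AE_iter[OF Yeq, of n] by simp
  then have "AE x in P. \<forall>n. Y ((T ^^ n) x) = act (\<gamma> ((T ^^ n) x)) (Y ((T ^^ Suc n) x))"
    by (simp only: AE_all_countable) blast
  with AE_regular show ?thesis
  proof eventually_elim
    case (elim x)
    have x: "x \<in> space P" by (rule regular_space[OF elim(1)])
    define u where "u = (\<lambda>n. \<tau> (Y ((T ^^ n) x)))"
    have u: "u n \<notin> W" "line (u n) = Y ((T ^^ n) x)" "\<theta> (u n) = 1" for n
      unfolding u_def by (intro tau_notin Ysp iter_space x)+
    have Yn: "Y x = line (bwd n x *v u n)" for n
    proof (induction n)
      case 0 then show ?case by (simp add: u(2))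
    next
      case (Suc n)
      have "line (u n) = line (\<gamma> ((T ^^ n) x) *v u (Suc n))"
        using elim(2) u(2)[of "Suc n"] by (simp add: u(2) act_line[symmetric])
      then have "act (bwd n x) (line (u n)) = act (bwd n x) (line (\<gamma> ((T ^^ n) x) *v u (Suc n)))" by simp
      then have "line (bwd n x *v u n) = line (bwd n x *v (\<gamma> ((T ^^ n) x) *v u (Suc n)))" by (simp only: act_line)
      moreover have "bwd (Suc n) x = bwd n x ** \<gamma> ((T ^^ n) x)" using bwd_add[of n 1 x] by simp
      ultimately show ?case using Suc by (simp add: matrix_vector_mul_assoc)
    qed
    show ?case
    proof
      fix n
      have p: "bwd n x \<in> stab W" by (rule bwd_stab[OF x])
      have "rep n x = \<pi> (u n)"
      proof -
        have "C ((T ^^ n) x) = qline (u n)"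
          unfolding YC[OF iter_space[OF x]] u(2)[symmetric] by (rule proj_map_line)
        then have "rep n x = normal (\<pi> (u n))" by (simp add: rep_def sigma_qline[OF u(1)])
        then show ?thesis by (simp add: normal_id theta_pi u(3))
      qed
      then have d: "u n - rep n x \<in> W" using W_scale[OF retr[of "u n"], of "-1"] by simp
      have e: "bwd n x *v u n = bwd n x *v rep n x + bwd n x *v (u n - rep n x)"
        by (simp add: matrix_vector_right_distrib[symmetric])
      have th: "\<theta> (bwd n x *v u n) = factors n x"
        unfolding e using theta_add_W[OF stabD(2)[OF p d]] theta_bwd[OF elim(1)] by simp
      have "\<tau> (Y x) = normal (bwd n x *v u n)"
        unfolding Yn[of n] by (rule tau_line) (simp add: stab_in_W[OF p] u(1))
      also have "\<dots> = inverse (factors n x) *s (bwd n x *v u n)" by (simp add: normal_def th)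
      also have "\<dots> = pullback n x + inverse (factors n x) *s (bwd n x *v (u n - rep n x))"
        unfolding e pullback_eq[OF elim(1)] by (rule vec.scale_right_distrib)
      finally have "norm (\<tau> (Y x) - pullback n x) = norm (bwd n x *v (u n - rep n x)) / norm (factors n x)"
        by (simp add: norm_scale norm_inverse divide_inverse mult.commute)
      also have "\<dots> \<le> (onorm_on W (bwd n x) * norm (u n - rep n x)) / norm (factors n x)"
        by (intro divide_right_mono onorm_on_le d) auto
      finally show "norm (\<tau> (Y x) - pullback n x) \<le> \<kappa> n x * norm (\<tau> (Y ((T ^^ n) x)) - \<sigma> (C ((T ^^ n) x)))"
        by (simp add: \<kappa>_def u_def rep_def)
    qed
  qed
qed

text \<open>
  The distance \<open>R\<close> in the fibre is not integrable in general, but it has the same law at all times. So,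
  outside of an event whose probability is small and the same for all \<open>n\<close>, it is bounded by a
  constant \<open>K\<close>, and there \<open>lift_approx\<close> and the decay of \<open>\<kappa>\<close> apply.
\<close>

lemma lift_integral_limit:
  fixes f :: "'k^'n \<Rightarrow> real"
  assumes gap: "W = {0} \<or> exponent < \<alpha>"
    and Ym: "Y \<in> P \<rightarrow>\<^sub>M proj_diff W" and Yeq: "AE x in P. Y x = act (\<gamma> x) (Y (T x))"
    and YC: "\<And>x. x \<in> space P \<Longrightarrow> C x = proj_map W (Y x)"
    and fm [measurable]: "f \<in> borel_measurable borel" and f01: "\<And>v. 0 \<le> f v" "\<And>v. f v \<le> 1"
    and L: "\<And>v w. \<bar>f v - f w\<bar> \<le> L * norm (v - w)" "0 \<le> L"
  shows "(\<lambda>n. \<integral>x. f (pullback n x) \<partial>P) \<longlonglongrightarrow> (\<integral>x. f (\<tau> (Y x)) \<partial>P)"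
proof -
  define R where "R = (\<lambda>x. norm (\<tau> (Y x) - \<sigma> (C x)))"
  have tY [measurable]: "(\<lambda>x. \<tau> (Y x)) \<in> borel_measurable P" by (rule measurable_compose[OF Ym tau_measurable])
  have sC [measurable]: "(\<lambda>x. \<sigma> (C x)) \<in> borel_measurable P" by (rule measurable_compose[OF C_meas sigma_measurable])
  have Rm [measurable]: "R \<in> borel_measurable P" unfolding R_def by measurable
  have R0: "0 \<le> R x" for x by (simp add: R_def)
  have k0: "AE x in P. (\<lambda>n. \<kappa> n x) \<longlonglongrightarrow> 0"
    using kappa_decay[OF gap]
  proof eventually_elim
    case (elim x)
    then obtain \<delta> where d: "\<delta> > 0" "\<forall>\<^sub>F n in sequentially. \<kappa> n x \<le> exp (- \<delta> * real n)" by blast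
    have "(\<lambda>n. exp (- \<delta>) ^ n) \<longlonglongrightarrow> 0" using d by (intro LIMSEQ_power_zero) simp
    moreover have "exp (- \<delta> * real n) = exp (- \<delta>) ^ n" for n by (simp add: exp_of_nat_mult[symmetric] mult.commute)
    ultimately have "(\<lambda>n. exp (- \<delta> * real n)) \<longlonglongrightarrow> 0" by simp
    then show ?case
      by (intro tendsto_sandwich[OF _ d(2) tendsto_const]) (simp_all add: kappa_nonneg)
  qed
  have "(\<lambda>K. \<integral>x. (if R x > real K then 1 else 0 :: real) \<partial>P) \<longlonglongrightarrow> (\<integral>x. 0 \<partial>P)"
  proof (rule integral_dominated_convergence[where w="\<lambda>_. 1"])
    show "AE x in P. (\<lambda>K. (if R x > real K then 1 else 0 :: real) :: real) \<longlonglongrightarrow> 0"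
    proof (rule AE_I2)
      fix x
      obtain K0 :: nat where "R x \<le> real K0" using real_arch_simple by blast
      then have "\<forall>\<^sub>F K in sequentially. ((if R x > real K then 1 else 0 :: real) :: real) = 0"
        unfolding eventually_sequentially by (intro exI[of _ K0]) auto
      then show "(\<lambda>K. (if R x > real K then 1 else 0 :: real) :: real) \<longlonglongrightarrow> 0" by (rule tendsto_eventually)
    qed
  qed auto
  then have tail: "(\<lambda>K. \<integral>x. (if R x > real K then 1 else 0 :: real) \<partial>P) \<longlonglongrightarrow> 0" by simp
  have main: "(\<lambda>n. \<integral>x. min 1 (L * (\<kappa> n x * real K)) \<partial>P) \<longlonglongrightarrow> 0" for K
  proof -
    have "(\<lambda>n. \<integral>x. min 1 (L * (\<kappa> n x * real K)) \<partial>P) \<longlonglongrightarrow> (\<integral>x. 0 \<partial>P)"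
    proof (rule integral_dominated_convergence[where w="\<lambda>_. 1"])
      show "AE x in P. (\<lambda>n. min 1 (L * (\<kappa> n x * real K))) \<longlonglongrightarrow> 0"
        using k0
      proof eventually_elim
        case (elim x)
        have "(\<lambda>n. min 1 (L * (\<kappa> n x * real K))) \<longlonglongrightarrow> min 1 (L * (0 * real K))" by (intro tendsto_intros elim)
        then show ?case by simp
      qed
      show "AE x in P. norm (min 1 (L * (\<kappa> n x * real K))) \<le> 1" for n
        using L(2) kappa_nonneg by (intro AE_I2) (simp add: min_def)
    qed auto
    then show ?thesis by simp
  qed
  have fi: "integrable P (\<lambda>x. f (g x))" if [measurable]: "g \<in> P \<rightarrow>\<^sub>M borel" for g
    by (rule P.integrable_const_bound[of _ 1]) (use f01 in \<open>auto intro!: AE_I2\<close>)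
  have bound: "\<bar>(\<integral>x. f (pullback n x) \<partial>P) - (\<integral>x. f (\<tau> (Y x)) \<partial>P)\<bar>
      \<le> (\<integral>x. (if R x > real K then 1 else 0 :: real) \<partial>P) + (\<integral>x. min 1 (L * (\<kappa> n x * real K)) \<partial>P)" for n K
  proof -
    let ?I = "\<lambda>x. (if R x > real K then 1 else 0 :: real)"
    have Im [measurable]: "?I \<in> borel_measurable P" by measurable
    have Ii: "integrable P ?I" by (rule P.integrable_const_bound[of _ 1]) auto
    have mi: "integrable P (\<lambda>x. min 1 (L * (\<kappa> n x * real K)))"
      by (rule P.integrable_const_bound[of _ 1]) (use L(2) kappa_nonneg in \<open>auto intro!: AE_I2 simp: min_def\<close>)
    have "\<bar>(\<integral>x. f (pullback n x) \<partial>P) - (\<integral>x. f (\<tau> (Y x)) \<partial>P)\<bar> = \<bar>\<integral>x. f (pullback n x) - f (\<tau> (Y x)) \<partial>P\<bar>"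
      by (simp add: fi)
    also have "\<dots> \<le> (\<integral>x. \<bar>f (pullback n x) - f (\<tau> (Y x))\<bar> \<partial>P)" by (rule integral_abs_bound)
    also have "\<dots> \<le> (\<integral>x. ?I ((T ^^ n) x) + min 1 (L * (\<kappa> n x * real K)) \<partial>P)"
    proof (rule integral_mono_AE)
      show "integrable P (\<lambda>x. \<bar>f (pullback n x) - f (\<tau> (Y x))\<bar>)" by (simp add: fi)
      show "integrable P (\<lambda>x. ?I ((T ^^ n) x) + min 1 (L * (\<kappa> n x * real K)))"
        by (intro Bochner_Integration.integrable_add mi integrable_iter Ii)
      have "AE x in P. x \<in> space P" by (rule AE_I2)
      moreover have "AE x in P. \<forall>n. norm (\<tau> (Y x) - pullback n x) \<le> \<kappa> n x * norm (\<tau> (Y ((T ^^ n) x)) - \<sigma> (C ((T ^^ n) x)))"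
        by (rule lift_approx[OF Ym Yeq]) (rule YC)
      ultimately
      show "AE x in P. \<bar>f (pullback n x) - f (\<tau> (Y x))\<bar> \<le> ?I ((T ^^ n) x) + min 1 (L * (\<kappa> n x * real K))"
      proof eventually_elim
        case (elim x)
        have one: "\<bar>f (pullback n x) - f (\<tau> (Y x))\<bar> \<le> 1" using f01[of "pullback n x"] f01[of "\<tau> (Y x)"] by auto
        have m0: "0 \<le> min 1 (L * (\<kappa> n x * real K))" using L(2) kappa_nonneg by simp
        show ?case
        proof (cases "R ((T ^^ n) x) > real K")
          case True
          then have "?I ((T ^^ n) x) = 1" by simp
          then show ?thesis using one m0 by linarith
        next
          case False
          have "\<bar>f (pullback n x) - f (\<tau> (Y x))\<bar> \<le> L * norm (\<tau> (Y x) - pullback n x)"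
            using L(1)[of "pullback n x" "\<tau> (Y x)"] by (simp add: norm_minus_commute)
          also have "\<dots> \<le> L * (\<kappa> n x * R ((T ^^ n) x))"
            using elim(2) by (intro mult_left_mono L(2)) (simp add: R_def)
          also have "\<dots> \<le> L * (\<kappa> n x * real K)"
            using False by (intro mult_left_mono L(2) kappa_nonneg) simp
          finally have "\<bar>f (pullback n x) - f (\<tau> (Y x))\<bar> \<le> min 1 (L * (\<kappa> n x * real K))" using one by simp
          moreover have "0 \<le> ?I ((T ^^ n) x)" by simp
          ultimately show ?thesis by linarith
        qed
      qed
    qed
    also have "\<dots> = (\<integral>x. ?I ((T ^^ n) x) \<partial>P) + (\<integral>x. min 1 (L * (\<kappa> n x * real K)) \<partial>P)"
      by (intro Bochner_Integration.integral_add mi integrable_iter Ii)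
    also have "(\<integral>x. ?I ((T ^^ n) x) \<partial>P) = (\<integral>x. ?I x \<partial>P)" by (rule integral_iter[OF Im])
    finally show ?thesis .
  qed
  show ?thesis
  proof (rule LIMSEQ_I)
    fix e :: real assume e: "0 < e"
    then obtain K where K: "(\<integral>x. (if R x > real K then 1 else 0 :: real) \<partial>P) < e / 2"
      using order_tendstoD(2)[OF tail, of "e / 2"] by (auto simp: eventually_sequentially)
    obtain n0 where n0: "\<And>n. n \<ge> n0 \<Longrightarrow> (\<integral>x. min 1 (L * (\<kappa> n x * real K)) \<partial>P) < e / 2"
      using order_tendstoD(2)[OF main[of K], of "e / 2"] e by (auto simp: eventually_sequentially)
    have "norm ((\<integral>x. f (pullback n x) \<partial>P) - (\<integral>x. f (\<tau> (Y x)) \<partial>P)) < e" if "n \<ge> n0" for n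
      using bound[of n K] K n0[OF that] by simp
    then show "\<exists>n0. \<forall>n\<ge>n0. norm ((\<integral>x. f (pullback n x) \<partial>P) - (\<integral>x. f (\<tau> (Y x)) \<partial>P)) < e" by blast
  qed
qed

end

text \<open>
  The indicator of a closed set \<open>F\<close> is the limit of the Lipschitz functions \<open>max 0 (1 - k * infdist v F)\<close>,
  and the closed sets generate the Borel sets.
\<close>

lemma measure_eqI_lipschitz:
  fixes M N :: "'a::metric_space measure"
  assumes M: "prob_space M" "sets M = sets borel" and N: "prob_space N" "sets N = sets borel"
    and eq: "\<And>f L. f \<in> borel_measurable borel \<Longrightarrow> (\<And>v. 0 \<le> f v) \<Longrightarrow> (\<And>v. f v \<le> 1) \<Longrightarrow> 0 \<le> L \<Longrightarrow>
        (\<And>v w. \<bar>f v - f w\<bar> \<le> L * dist v w) \<Longrightarrow> (\<integral>x. f x \<partial>M) = (\<integral>x. f x \<partial>N :: real)"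
  shows "M = N"
proof -
  interpret M: prob_space M by fact
  interpret N: prob_space N by fact
  have closed_eq: "emeasure M F = emeasure N F" if F: "closed F" for F
  proof (cases "F = {}")
    case False
    define f where "f = (\<lambda>k v. max 0 (1 - real k * infdist v F))"
    have f01: "0 \<le> f k v" "f k v \<le> 1" for k v by (auto simp: f_def infdist_nonneg)
    have fm: "f k \<in> borel_measurable borel" for k
      unfolding f_def by (intro borel_measurable_continuous_onI continuous_intros)
    have lip: "\<bar>f k v - f k w\<bar> \<le> real k * dist v w" for k v w
    proof -
      have "\<bar>f k v - f k w\<bar> \<le> \<bar>real k * infdist v F - real k * infdist w F\<bar>" by (auto simp: f_def max_def)
      also have "\<dots> = real k * \<bar>infdist v F - infdist w F\<bar>" by (simp add: right_diff_distrib[symmetric] abs_mult)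
      also have "\<dots> \<le> real k * dist v w" by (intro mult_left_mono infdist_triangle_abs) auto
      finally show ?thesis .
    qed
    have lim: "(\<lambda>k. f k v) \<longlonglongrightarrow> indicator F v" for v
    proof (cases "v \<in> F")
      case True then show ?thesis by (simp add: f_def)
    next
      case out: False
      then have p: "infdist v F > 0" by (intro infdist_pos_not_in_closed F False)
      obtain k0 :: nat where k0: "1 / infdist v F \<le> real k0" using real_arch_simple by blast
      have "f k v = 0" if "k \<ge> k0" for k
      proof -
        have "1 / infdist v F \<le> real k" using k0 that by linarith
        then show ?thesis using p by (simp add: f_def field_simps)
      qed
      then have "\<forall>\<^sub>F k in sequentially. f k v = indicator F v" using out by (auto simp: eventually_sequentially)
      then show ?thesis by (rule tendsto_eventually)
    qed
    have conv: "(\<lambda>k. \<integral>x. f k x \<partial>Q) \<longlonglongrightarrow> measure Q F" if Q: "prob_space Q" "sets Q = sets borel" for Q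
    proof -
      interpret Q: prob_space Q by fact
      have FQ: "F \<in> sets Q" using Q(2) F by auto
      have "(\<lambda>k. \<integral>x. f k x \<partial>Q) \<longlonglongrightarrow> (\<integral>x. indicator F x \<partial>Q)"
      proof (rule integral_dominated_convergence[where w="\<lambda>_. 1"])
        show "f k \<in> borel_measurable Q" for k using fm by (simp add: measurable_cong_sets[OF Q(2) refl])
        show "AE x in Q. norm (f k x) \<le> 1" for k using f01 by (intro AE_I2) simp
      qed (use lim FQ in auto)
      then show ?thesis using FQ by simp
    qed
    have "(\<lambda>k. \<integral>x. f k x \<partial>M) = (\<lambda>k. \<integral>x. f k x \<partial>N)"
      using eq[OF fm f01 _ lip] by auto
    then have "measure M F = measure N F" using conv[OF M] conv[OF N] LIMSEQ_unique by metis
    then show ?thesis by (simp add: M.emeasure_eq_measure N.emeasure_eq_measure)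
  qed simp
  show ?thesis
  proof (rule measure_eqI_generator_eq[where E="Collect closed" and \<Omega>=UNIV and A="\<lambda>_. UNIV"])
    show "Int_stable (Collect (closed :: 'a set \<Rightarrow> bool))" by (auto simp: Int_stable_def)
    show "sets M = sigma_sets UNIV (Collect closed)" "sets N = sigma_sets UNIV (Collect closed)"
      by (simp_all add: M(2) N(2) borel_eq_closed)
    show "emeasure M UNIV \<noteq> \<infinity>" by (simp add: M.emeasure_eq_measure)
  qed (auto simp: closed_eq)
qed

context mu_space
begin

lemma ex_ergodic_system:
  assumes erg: "ergodic act_quot \<mu> (proj_quot W) \<nu>'"
  shows "\<exists>(P :: (nat \<Rightarrow> ('k^'n^'n) \<times> ('k^'n)) measure) T \<gamma> C. ergodic_system W \<pi> \<mu> P T \<gamma> \<nu>' C"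
proof -
  have st: "prob_space \<nu>'" "sets \<nu>' = sets (proj_quot W)"
    "distr (\<mu> \<Otimes>\<^sub>M \<nu>') (proj_quot W) (\<lambda>(g, x). act_quot (retract g) x) = \<nu>'"
    using erg stationary_quot_iff[of \<nu>'] unfolding ergodic_def by blast+
  from stationary_system[OF qline_measurable sigma_measurable sigma_notin(1,2) act_quot_sigma act_quot_measurable st]
  obtain P :: "(nat \<Rightarrow> ('k^'n^'n) \<times> ('k^'n)) measure" and T \<gamma> C where
    "walk_system W \<pi> \<mu> P T \<gamma>" "C \<in> P \<rightarrow>\<^sub>M proj_quot W" "distr P (proj_quot W) C = \<nu>'" "AE x in P. C x = act_quot (\<gamma> x) (C (T x))"
    by blast
  then show ?thesis using erg by (intro exI ergodic_system.intro ergodic_system_axioms.intro)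
qed

text \<open>
  The limit on the left does not involve the lift, so integrals of Lipschitz functions against two
  lifts agree.
\<close>

lemma lift_determined:
  fixes f :: "'k^'n \<Rightarrow> real"
  assumes erg: "ergodic act_quot \<mu> (proj_quot W) \<nu>'"
    and gap: "W = {0} \<or> exponent < cocycle_average \<mu> W \<nu>'"
    and lift: "stationary_lift \<mu> W \<nu>' \<nu>"
    and f: "f \<in> borel_measurable borel" "\<And>v. 0 \<le> f v" "\<And>v. f v \<le> 1" "0 \<le> L" "\<And>v w. \<bar>f v - f w\<bar> \<le> L * dist v w"
  shows "(\<lambda>n. \<integral>v. f v \<partial>distr (conv_pow n \<Otimes>\<^sub>M \<nu>') borel (\<lambda>(g, x). normal (g *v \<sigma> x))) \<longlonglongrightarrow> (\<integral>v. f v \<partial>distr \<nu> borel \<tau>)"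
proof -
  have st: "prob_space \<nu>" "sets \<nu> = sets (proj_diff W)"
    "distr (\<mu> \<Otimes>\<^sub>M \<nu>) (proj_diff W) (\<lambda>(g, x). act (retract g) x) = \<nu>"
    and pr: "distr \<nu> (proj_quot W) (proj_map W) = \<nu>'"
    using lift stationary_diff_iff[of \<nu>] unfolding stationary_lift_def by blast+
  from stationary_system[OF line_measurable tau_measurable tau_notin(1,2) act_tau act_measurable st]
  obtain P :: "(nat \<Rightarrow> ('k^'n^'n) \<times> ('k^'n)) measure" and T \<gamma> Y where
    ws: "walk_system W \<pi> \<mu> P T \<gamma>" and Y: "Y \<in> P \<rightarrow>\<^sub>M proj_diff W" "distr P (proj_diff W) Y = \<nu>" "AE x in P. Y x = act (\<gamma> x) (Y (T x))"
    by blast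
  interpret ws: walk_system W \<pi> \<mu> P T \<gamma> by (rule ws)
  define C where "C = (\<lambda>x. proj_map W (Y x))"
  have Cm: "C \<in> P \<rightarrow>\<^sub>M proj_quot W" unfolding C_def by (rule measurable_compose[OF Y(1) proj_map_measurable])
  have "distr P (proj_quot W) C = distr (distr P (proj_diff W) Y) (proj_quot W) (proj_map W)"
    by (subst distr_distr[OF proj_map_measurable Y(1)]) (simp add: C_def comp_def)
  then have Cl: "distr P (proj_quot W) C = \<nu>'" by (simp add: Y(2) pr)
  have "AE x in P. x \<in> space P" by (rule AE_I2)
  with Y(3) have Ceq: "AE x in P. C x = act_quot (\<gamma> x) (C (T x))"
  proof eventually_elim
    case (elim x)
    have t: "line (\<tau> (Y (T x))) = Y (T x)"
      by (rule tau_notin(2)[OF measurable_space[OF Y(1) ws.T_space[OF elim(2)]]])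
    have "C x = proj_map W (act (\<gamma> x) (line (\<tau> (Y (T x)))))" unfolding C_def t by (simp only: elim(1))
    also have "\<dots> = act_quot (\<gamma> x) (proj_map W (line (\<tau> (Y (T x)))))"
      by (simp add: act_line proj_map_line act_qline[OF ws.gamma_stab[OF elim(2)]])
    finally show ?case unfolding t C_def .
  qed
  interpret es: ergodic_system W \<pi> \<mu> P T \<gamma> \<nu>' C
    by (intro ergodic_system.intro ergodic_system_axioms.intro ws erg Cm Cl Ceq)
  have gap': "W = {0} \<or> exponent < es.\<alpha>" using gap by (simp add: es.\<alpha>_def)
  have "(\<lambda>n. \<integral>x. f (es.pullback n x) \<partial>P) \<longlonglongrightarrow> (\<integral>x. f (\<tau> (Y x)) \<partial>P)"
    by (rule es.lift_integral_limit[OF gap' Y(1,3) _ f(1-3) f(5)[unfolded dist_norm] f(4)]) (simp add: C_def)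
  moreover have "(\<integral>x. f (es.pullback n x) \<partial>P) = (\<integral>v. f v \<partial>distr (conv_pow n \<Otimes>\<^sub>M \<nu>') borel (\<lambda>(g, x). normal (g *v \<sigma> x)))" for n
    unfolding es.law_pullback[symmetric] by (rule integral_distr[OF es.pullback_measurable f(1), symmetric])
  moreover have "(\<integral>x. f (\<tau> (Y x)) \<partial>P) = (\<integral>v. f v \<partial>distr \<nu> borel \<tau>)"
  proof -
    have "distr \<nu> borel \<tau> = distr P borel (\<tau> \<circ> Y)" unfolding Y(2)[symmetric] by (rule distr_distr[OF tau_measurable Y(1)])
    moreover have "\<tau> \<circ> Y \<in> P \<rightarrow>\<^sub>M borel" by (rule measurable_comp[OF Y(1) tau_measurable])
    ultimately show ?thesis using integral_distr[of "\<tau> \<circ> Y" P borel f] f(1) by simp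
  qed
  ultimately show ?thesis by simp
qed

lemma unique_stationary_lift:
  assumes erg: "ergodic act_quot \<mu> (proj_quot W) \<nu>'"
    and gap: "W = {0} \<or> exponent < cocycle_average \<mu> W \<nu>'"
    and l1: "stationary_lift \<mu> W \<nu>' \<nu>1" and l2: "stationary_lift \<mu> W \<nu>' \<nu>2"
  shows "\<nu>1 = \<nu>2"
proof -
  have st: "prob_space \<nu>" "sets \<nu> = sets (proj_diff W)" "space \<nu> = space (proj_diff W)" if "stationary_lift \<mu> W \<nu>' \<nu>" for \<nu>
    using that sets_eq_imp_space_eq[of \<nu> "proj_diff W"] unfolding stationary_lift_def stationary_def by blast+
  have tm: "\<tau> \<in> \<nu> \<rightarrow>\<^sub>M borel" if "stationary_lift \<mu> W \<nu>' \<nu>" for \<nu>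
    using tau_measurable by (simp add: measurable_cong_sets[OF st(2)[OF that] refl])
  have eq: "distr \<nu>1 borel \<tau> = distr \<nu>2 borel \<tau>"
  proof (rule measure_eqI_lipschitz)
    show "prob_space (distr \<nu>1 borel \<tau>)" "prob_space (distr \<nu>2 borel \<tau>)"
      by (intro prob_space.prob_space_distr st tm l1 l2)+
    fix f :: "'k^'n \<Rightarrow> real" and L
    assume f: "f \<in> borel_measurable borel" "\<And>v. 0 \<le> f v" "\<And>v. f v \<le> 1" "0 \<le> L" "\<And>v w. \<bar>f v - f w\<bar> \<le> L * dist v w"
    show "(\<integral>v. f v \<partial>distr \<nu>1 borel \<tau>) = (\<integral>v. f v \<partial>distr \<nu>2 borel \<tau>)"
      by (rule LIMSEQ_unique[OF lift_determined[OF erg gap l1 f] lift_determined[OF erg gap l2 f]])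
  qed simp_all
  interpret n1: prob_space \<nu>1 by (rule st(1)[OF l1])
  obtain x0 where x0: "x0 \<in> space (proj_diff W)" using n1.not_empty st(3)[OF l1] by auto
  define p' where "p' = (\<lambda>u. if u \<in> W then x0 else line u)"
  have p'm: "p' \<in> borel \<rightarrow>\<^sub>M proj_diff W" unfolding p'_def by (rule borel_extend[OF line_measurable x0])
  have rec: "distr (distr \<nu> borel \<tau>) (proj_diff W) p' = \<nu>" if l: "stationary_lift \<mu> W \<nu>' \<nu>" for \<nu>
  proof -
    have "distr (distr \<nu> borel \<tau>) (proj_diff W) p' = distr \<nu> (proj_diff W) (p' \<circ> \<tau>)"
      by (rule distr_distr[OF p'm tm[OF l]])
    also have "\<dots> = distr \<nu> \<nu> (\<lambda>x. x)"
      by (rule distr_cong) (simp_all add: st[OF l] p'_def tau_notin)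
    finally show ?thesis by (simp add: distr_id2)
  qed
  have "\<nu>1 = distr (distr \<nu>2 borel \<tau>) (proj_diff W) p'" using rec[OF l1] unfolding eq by (rule sym)
  also have "\<dots> = \<nu>2" by (rule rec[OF l2])
  finally show ?thesis .
qed

end

section \<open>Existence and uniqueness of stationary lifts\<close>

text \<open>
  By the Lindelof property, the open null sets are covered by countably many of them.
\<close>

lemma AE_msupport:
  fixes M :: "'a::second_countable_topology measure"
  assumes s: "sets M = sets (restrict_space borel \<Omega>)"
  shows "AE x in M. x \<in> msupport M"
proof -
  define F where "F = {U :: 'a set. open U \<and> emeasure M (U \<inter> space M) = 0}"
  obtain F' where F': "F' \<subseteq> F" "countable F'" "\<Union>F' = \<Union>F"
    using Lindelof[of F] by (auto simp: F_def)
  have sp: "space M = \<Omega>" using sets_eq_imp_space_eq[OF s] by (simp add: space_restrict_space)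
  have "U \<inter> space M \<in> null_sets M" if "U \<in> F'" for U
  proof -
    have "open U" "emeasure M (U \<inter> space M) = 0" using that F'(1) by (auto simp: F_def)
    moreover have "U \<inter> space M \<in> sets M" using \<open>open U\<close> unfolding s sp sets_restrict_space by (auto intro!: image_eqI[of _ _ U])
    ultimately show ?thesis by (auto simp: null_sets_def)
  qed
  then have "(\<Union>U\<in>F'. U \<inter> space M) \<in> null_sets M" by (intro null_sets_UN' F'(2))
  then have "AE x in M. x \<notin> (\<Union>U\<in>F'. U \<inter> space M)" by (rule AE_not_in)
  then show ?thesis
  proof (rule AE_mp, intro AE_I2 impI)
    fix x assume x: "x \<in> space M" and n: "x \<notin> (\<Union>U\<in>F'. U \<inter> space M)"
    then have "x \<notin> \<Union>F" using F'(3) by blast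
    then have "emeasure M (U \<inter> space M) \<noteq> 0" if "open U" "x \<in> U" for U using that by (auto simp: F_def)
    then show "x \<in> msupport M" using x by (auto simp: msupport_def zero_less_iff_neq_zero)
  qed
qed

theorem theorem1p1:
  fixes \<mu> :: "('k::{real_normed_field,euclidean_space}^'n^'n) measure"
    and W :: "('k^'n) set"
    and \<nu>' :: "('k^'n) set set measure"
  assumes "prob_space \<mu>" and "sets \<mu> = sets GL_borel"
    and "finite_first_moment \<mu>"
    and "invariant_subspace \<mu> W"
    and "ergodic act_quot \<mu> (proj_quot W) \<nu>'"
    and "ereal (cocycle_average \<mu> W \<nu>') > top_lyapunov \<mu> W"
  shows "\<exists>!\<nu>. stationary_lift \<mu> W \<nu>' \<nu>"
proof -
  have W: "vec.subspace W" and pres: "\<And>g w. g \<in> semigroup_of \<mu> \<Longrightarrow> w \<in> W \<Longrightarrow> g *v w \<in> W"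
    using assms(4) unfolding invariant_subspace_def by blast+
  obtain \<pi> where split: "split_subspace W \<pi>" by (rule ex_split_subspace[OF W])
  have sp: "space \<mu> = {g. invertible g}"
    using sets_eq_imp_space_eq[OF assms(2)] by (simp add: GL_borel_def space_restrict_space)
  have "AE g in \<mu>. g \<in> msupport \<mu>" by (rule AE_msupport) (use assms(2) in \<open>simp add: GL_borel_def\<close>)
  moreover have "AE g in \<mu>. g \<in> space \<mu>" by (rule AE_I2)
  ultimately have "AE g in \<mu>. g \<in> stab W"
    by eventually_elim (auto simp: sp stab_def intro: pres semigroup_of.gen)
  moreover have "integrable \<mu> log_norm"
    using assms(3) by (simp add: finite_first_moment_def log_norm_def[abs_def])
  ultimately interpret mu_space W \<pi> \<mu>
    by (intro mu_space.intro mu_space_axioms.intro split assms(1,2))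
  have gap: "W = {0} \<or> exponent < cocycle_average \<mu> W \<nu>'"
    using assms(6) top_lyapunov_eq by (cases "W = {0}") simp_all
  obtain P :: "(nat \<Rightarrow> ('k^'n^'n) \<times> ('k^'n)) measure" and T \<gamma> C where "ergodic_system W \<pi> \<mu> P T \<gamma> \<nu>' C"
    using ex_ergodic_system[OF assms(5)] by blast
  then interpret es: ergodic_system W \<pi> \<mu> P T \<gamma> \<nu>' C .
  have "\<exists>\<nu>. stationary_lift \<mu> W \<nu>' \<nu>"
    using gap by (intro es.ex_stationary_lift) (simp add: es.\<alpha>_def)
  then show ?thesis using unique_stationary_lift[OF assms(5) gap] by blast
qed

end
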